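(* Let $\mu\in\mathcal{M}_{\sigma}(I^{\mathbb{N}})$ with $h_{\mu}<\infty$. Then for every $\mathbf a\in\mathbf Q^{I}$ and for $\mu$-almost every $\mathtt i\in I^{\mathbb N}$ such that $\Lambda_\mu(s,\mathtt i)>-\infty$ for some $s>\dim_{LY}(\mu,\mathtt i)$, we have $$\overline{\dim}_{\mathrm{loc}}(\pi_{\mathbf a}\mu,\pi_{\mathbf a}(\mathtt i))\le\min\{d,\dim_{LY}(\mu,\mathtt i)\}.$$
   Context: Let $I$ be a finite or countably infinite set, $I^{\mathbb{N}}$ the space of infinite sequences $\mathtt{i}=(i_1,i_2,\ldots)$ with the product of discrete topologies and its Borel $\sigma$-algebra. Write $\mathtt{i}|_n=(i_1,\ldots,i_n)$, $[j_1\ldots j_n]=\{\mathtt{i}: \mathtt{i}|_n=(j_1,\dots,j_n)\}$ (cylinder), and $\sigma$ the left shift. $\mathcal{M}_\sigma(I^{\mathbb N})$ denotes the $\sigma$-invariant Borel probability measures. Fix $d\ge1$; for each $i\in I$ fix an invertible real $d\times d$ matrix $A_i$, with $\sup_{i\in I}\|A_i\|<1$. Let $\mathbf{Q}=[-\frac12,\frac12]^d$; for $\mathbf a=(a_i)_{i\in I}\in\mathbf Q^{I}$ put $f_i(x)=A_ix+a_i$, $f_{\mathtt i|_n}=f_{i_1}\circ\cdots\circ f_{i_n}$, and $\{\pi_{\mathbf a}(\mathtt i)\}=\bigcap_n f_{\mathtt i|_n}(B(0,R))$, where $f_i(B(0,R))\subset B(0,R)$ for all $i$. $\pi_{\mathbf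 a}\mu=\mu\circ\pi_{\mathbf a}^{-1}$. For a finite word $\mathtt j=(j_1,\dots,j_n)$, $\alpha_1(\mathtt j)\ge\dots\ge\alpha_d(\mathtt j)>0$ are the singular values of $A_{j_1}\cdots A_{j_n}$; $\phi^s(\mathtt j)=\alpha_1(\mathtt j)\cdots\alpha_k(\mathtt j)\alpha_{k+1}(\mathtt j)^{s-k}$ for $0\le s<d$, $k=\lfloor s\rfloor$, and $\phi^s(\mathtt j)=(\alpha_1(\mathtt j)\cdots\alpha_d(\mathtt j))^{s/d}$ for $s\ge d$. The upper local dimension of $\nu$ at $x$ is $\limsup_{r\to0}\log\nu(B(x,r))/\log r$. Entropy $h_\mu=\lim_n\frac1n H(\mathcal P_n)$ with $H(\mathcal P_n)=-\sum_{\mathtt j\in I^n}\mu[\mathtt j]\log\mu[\mathtt j]$. When $h_\mu<\infty$, for $\mu$-a.e. $\mathtt i$ the limits $h_\mu(\mathtt i)=-\lim_n\frac1n\log\mu[\mathtt i|_n]<\infty$, $\Lambda_\mu(s,\mathtt i)=\lim_n\frac1n\log\phi^s(\mathtt i|_n)$ (all $s\ge0$) and $\lambda_l(\mu,\mathtt i)=\lim_n\frac1n\log\alpha_l(\mathtt i|_n)$ exist; $P_\mu(s,\mathtt i)=h_\mu(\mathtt i)+\Lambda_\mu(s,\mathtt i)$, and $\dim_{LY}(\mu,\mathtt i)=\inf\{s\ge0:P_\mu(s,\mathtt i)<0\}$. *)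

theory Defs
  imports "HOL-Analysis.Analysis" "HOL-Probability.Probability"
begin

definition seq_space :: "(nat \<Rightarrow> 'i) measure" where
  "seq_space = PiM UNIV (\<lambda>_. count_space UNIV)"

definition shift :: "(nat \<Rightarrow> 'i) \<Rightarrow> (nat \<Rightarrow> 'i)" where
  "shift \<omega> = (\<lambda>n. \<omega> (Suc n))"

definition prefix :: "(nat \<Rightarrow> 'i) \<Rightarrow> nat \<Rightarrow> 'i list" where
  "prefix \<omega> n = map \<omega> [0..<n]"

definition cylinder :: "'i list \<Rightarrow> (nat \<Rightarrow> 'i) set" where
  "cylinder w = {\<omega>. \<forall>k<length w. \<omega> k = w ! k}"

definition part_entropy :: "(nat \<Rightarrow> 'i) measure \<Rightarrow> nat \<Rightarrow> ennreal" where
  "part_entropy \<mu> n =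
     (\<Sum>\<^sub>\<infinity> w\<in>{w::'i list. length w = n}.
        ennreal (- measure \<mu> (cylinder w) * ln (measure \<mu> (cylinder w))))"

definition ks_entropy :: "(nat \<Rightarrow> 'i) measure \<Rightarrow> ennreal" where
  "ks_entropy \<mu> = lim (\<lambda>n. part_entropy \<mu> n / of_nat n)"

definition loc_entropy :: "(nat \<Rightarrow> 'i) measure \<Rightarrow> (nat \<Rightarrow> 'i) \<Rightarrow> ereal" where
  "loc_entropy \<mu> \<omega> =
     lim (\<lambda>n. ereal (- ln (measure \<mu> (cylinder (prefix \<omega> n))) / real n))"

definition eigsp :: "real^'n^'n \<Rightarrow> real \<Rightarrow> (real^'n) set" where
  "eigsp M u = {x. M *v x = u *\<^sub>R x}"

text \<open>number of eigenvalues \<open>\<ge> t\<close> of M, counted with (geometric = algebraic, for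
  symmetric M) multiplicity\<close>
definition eig_count :: "real^'n^'n \<Rightarrow> real \<Rightarrow> nat" where
  "eig_count M t = (\<Sum>u\<in>{u. t \<le> u \<and> eigsp M u \<noteq> {0}}. dim (eigsp M u))"

text \<open>l-th largest eigenvalue (l = 1..d), counted with multiplicity\<close>
definition eig_desc :: "real^'n^'n \<Rightarrow> nat \<Rightarrow> real" where
  "eig_desc M l = Sup {t. l \<le> eig_count M t}"

definition sing_val :: "real^'n^'n \<Rightarrow> nat \<Rightarrow> real" where
  "sing_val M l = sqrt (eig_desc (transpose M ** M) l)"

definition sv_function :: "real \<Rightarrow> real^'n^'n \<Rightarrow> real" where
  "sv_function s M =
     (if s < real CARD('n) then
        (\<Prod>l\<in>{1..nat \<lfloor>s\<rfloor>}. sing_val M l) * sing_val M (nat \<lfloor>s\<rfloor> + 1) powr (s - of_int \<lfloor>s\<rfloor>)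
      else (\<Prod>l\<in>{1..CARD('n)}. sing_val M l) powr (s / real CARD('n)))"

definition word_mat :: "('i \<Rightarrow> real^'n^'n) \<Rightarrow> 'i list \<Rightarrow> real^'n^'n" where
  "word_mat A w = foldr (\<lambda>j M. A j ** M) w (mat 1)"

definition lyap :: "('i \<Rightarrow> real^'n^'n) \<Rightarrow> real \<Rightarrow> (nat \<Rightarrow> 'i) \<Rightarrow> ereal" where
  "lyap A s \<omega> = lim (\<lambda>n. ereal (ln (sv_function s (word_mat A (prefix \<omega> n))) / real n))"

definition pressure :: "(nat \<Rightarrow> 'i) measure \<Rightarrow> ('i \<Rightarrow> real^'n^'n) \<Rightarrow> real \<Rightarrow> (nat \<Rightarrow> 'i) \<Rightarrow> ereal" where
  "pressure \<mu> A s \<omega> = loc_entropy \<mu> \<omega> + lyap A s \<omega>"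

definition dim_LY :: "(nat \<Rightarrow> 'i) measure \<Rightarrow> ('i \<Rightarrow> real^'n^'n) \<Rightarrow> (nat \<Rightarrow> 'i) \<Rightarrow> ereal" where
  "dim_LY \<mu> A \<omega> = Inf {ereal s | s. 0 \<le> s \<and> pressure \<mu> A s \<omega> < 0}"

definition affmap :: "('i \<Rightarrow> real^'n^'n) \<Rightarrow> ('i \<Rightarrow> real^'n) \<Rightarrow> 'i \<Rightarrow> real^'n \<Rightarrow> real^'n" where
  "affmap A a i x = A i *v x + a i"

definition word_map :: "('i \<Rightarrow> real^'n^'n) \<Rightarrow> ('i \<Rightarrow> real^'n) \<Rightarrow> 'i list \<Rightarrow> real^'n \<Rightarrow> real^'n" where
  "word_map A a w = foldr (\<lambda>j g. affmap A a j \<circ> g) w id"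

definition inv_radius :: "('i \<Rightarrow> real^'n^'n) \<Rightarrow> ('i \<Rightarrow> real^'n) \<Rightarrow> real" where
  "inv_radius A a = (SOME R. 0 < R \<and> (\<forall>i. affmap A a i ` cball 0 R \<subseteq> cball 0 R))"

definition coding :: "('i \<Rightarrow> real^'n^'n) \<Rightarrow> ('i \<Rightarrow> real^'n) \<Rightarrow> (nat \<Rightarrow> 'i) \<Rightarrow> real^'n" where
  "coding A a \<omega> =
     (THE x. x \<in> (\<Inter>n. word_map A a (prefix \<omega> n) ` cball 0 (inv_radius A a)))"

definition upper_loc_dim :: "('a::metric_space) measure \<Rightarrow> 'a \<Rightarrow> ereal" where
  "upper_loc_dim \<nu> x = Limsup (at_right 0) (\<lambda>r. ereal (ln (measure \<nu> (ball x r)) / ln r))"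

end

theory Submission
  imports Defs "HOL-Real_Asymp.Real_Asymp"
begin

text \<open>
  Cover the image of the \<open>n\<close>-cylinder around a point by balls of radius \<open>exp (- \<tau> n)\<close>. By
  Borel--Cantelli, almost every point lies in a piece whose mass is at least the average over the
  pieces up to a polynomial factor, so the upper local dimension is at most \<open>(h + G(\<tau>)) / \<tau>\<close>, where
  \<open>h\<close> is the local entropy and \<open>G(\<tau>)\<close> the exponential growth rate of the covering number. Since
  \<open>G(\<tau>) = \<Sum>l. max (\<lambda>\<^sub>l + \<tau>) 0\<close>, letting \<open>\<tau>\<close> tend to infinity gives the bound \<open>d\<close>, and \<open>\<tau>\<close> close to
  \<open>- \<lambda>\<^sub>k\<^sub>+\<^sub>1\<close>, where \<open>k\<close> is the integer part of \<open>t > dim\<^sub>L\<^sub>Y\<close>, gives the bound \<open>t\<close>.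

  All limits come from one subadditive ergodic theorem for nonnegative sequences. The logarithms of
  the covering numbers are subadditive because balls are mapped into scaled ellipsoids, and their
  growth rates for all rational \<open>\<tau>\<close> determine the Lyapunov exponents, so no exterior powers are
  needed. The information function is not subadditive, but it differs by \<open>O(ln n)\<close> from a
  subadditive sequence obtained by summing, with summable length penalties, over all ways to cut a
  word into blocks that are treated as independent.
\<close>

section \<open>Subadditive ergodic theorem\<close>

text \<open>The matrices need not stay away from singular ones, so logarithms of small singular
  values may fail to be integrable and exponents may equal -\<infinity>. Counting balls of radius
  exp (- \<tau> n) truncates them from below at - \<tau>: the resulting cocycle is nonnegative and,
  for one letter, bounded. The price is the free parameter \<tau>; null sets can be collected only
  for countably many values, so \<tau> is kept rational. The choice of \<tau> for t < d comes from
  the pressure. With k the integer part of t and \<tau> = - \<lambda>_(k+1), the growth rate is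
  G(\<tau>) = \<lambda>_1 + ... + \<lambda>_k + k \<tau>, and (h + G(\<tau>)) / \<tau> < t is the
  inequality h + \<lambda>_1 + ... + \<lambda>_k + (t - k) \<lambda>_(k+1) < 0 rearranged, that is,
  negative pressure at t. This requires \<lambda>_(k+1) to be finite, and that is what \<Lambda>(s)
  > -\<infinity> for some s > t provides. The measure need not be ergodic, so every limit is a
  function of the point.\<close>

locale prob_mpt = prob_space M for M :: "'a measure" +
  fixes T :: "'a \<Rightarrow> 'a"
  assumes T_meas [measurable]: "T \<in> M \<rightarrow>\<^sub>M M"
    and T_inv: "distr M M T = M"
begin

lemma AE_T:
  assumes "AE x in M. P x"
  shows "AE x in M. P (T x)"
  by (rule AE_distrD[OF T_meas], subst T_inv, rule assms)

lemma T_pow_meas [measurable]: "T ^^ i \<in> M \<rightarrow>\<^sub>M M"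
  by (induction i) (auto intro: measurable_comp simp: id_def)

lemma AE_T_pow:
  assumes "AE x in M. P x"
  shows "AE x in M. P ((T ^^ i) x)"
proof (induction i)
  case (Suc i)
  from AE_T[OF this] show ?case by (simp add: funpow_swap1)
qed (use assms in simp)

lemma AE_orbit:
  assumes "AE x in M. P x"
  shows "AE x in M. \<forall>i. P ((T ^^ i) x)"
  using AE_T_pow[OF assms] by (simp add: AE_all_countable)

lemma integrable_T:
  fixes f :: "'a \<Rightarrow> real"
  assumes "integrable M f"
  shows "integrable M (\<lambda>x. f (T x))"
  using integrable_distr[OF T_meas, of f] assms T_inv by simp

lemma integral_T:
  fixes f :: "'a \<Rightarrow> real"
  assumes [measurable]: "f \<in> borel_measurable M"
  shows "(\<integral>x. f (T x) \<partial>M) = (\<integral>x. f x \<partial>M)"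
  using integral_distr[OF T_meas, of f] T_inv by simp

text \<open>The maximum of the Birkhoff sums of \<open>k\<close> of lengths 0 to \<open>n\<close>,
  in the recursive form on which Garsia's proof of the maximal ergodic theorem rests.\<close>

primrec max_sum :: "('a \<Rightarrow> real) \<Rightarrow> nat \<Rightarrow> 'a \<Rightarrow> real" where
  "max_sum k 0 x = 0"
| "max_sum k (Suc n) x = max 0 (k x + max_sum k n (T x))"

lemma max_sum_nonneg: "0 \<le> max_sum k n x"
  by (cases n) auto

lemma max_sum_mono: "max_sum k n x \<le> max_sum k (Suc n) x"
proof (induction n arbitrary: x)
  case (Suc n)
  show ?case using Suc[of "T x"] by simp
qed simp

lemma max_sum_integrable:
  assumes "integrable M k"
  shows "integrable M (max_sum k n)"
proof (induction n)
  case (Suc n)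
  have "integrable M (\<lambda>x. k x + max_sum k n (T x))"
    using assms integrable_T[OF Suc] by simp
  then show ?case by simp
qed (simp add: fun_eq_iff)

lemma sum_orbit_le_max_sum: "(\<Sum>i<n. k ((T ^^ i) x)) \<le> max_sum k n x"
proof (induction n arbitrary: x)
  case (Suc n)
  have "(\<Sum>i<Suc n. k ((T ^^ i) x)) = k x + (\<Sum>i<n. k ((T ^^ i) (T x)))"
    by (simp only: sum.lessThan_Suc_shift) (simp add: funpow_swap1)
  with Suc[of "T x"] show ?case by simp
qed simp

lemma maximal_ergodic:
  assumes k: "integrable M k"
  shows "0 \<le> (\<integral>x. k x * indicator {x. 0 < max_sum k n x} x \<partial>M)"
proof -
  note [measurable] = borel_measurable_integrable[OF k] borel_measurable_integrable[OF max_sum_integrable[OF k]]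
  have int: "integrable M (max_sum k n)" by (rule max_sum_integrable[OF k])
  have kint: "integrable M (\<lambda>x. k x * indicator {x. 0 < max_sum k n x} x)"
    by (rule Bochner_Integration.integrable_bound[OF k]) (auto simp: indicator_def)
  \<comment> \<open>Where \<open>max_sum k n x\<close> is positive, its recursion and
    \<open>max_sum_mono\<close> give the bound; elsewhere the left side is 0. After integration the
    two \<open>max_sum\<close> terms cancel by invariance.\<close>
  have "max_sum k n x \<le> k x * indicator {x. 0 < max_sum k n x} x + max_sum k n (T x)" for x
  proof (cases n)
    case (Suc m)
    then show ?thesis
      using max_sum_mono[of k m "T x"] max_sum_nonneg[of k n "T x"] by (auto simp: indicator_def)
  qed simp
  then have "(\<integral>x. max_sum k n x \<partial>M) \<le>
      (\<integral>x. k x * indicator {x. 0 < max_sum k n x} x + max_sum k n (T x) \<partial>M)"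
    using int kint integrable_T[OF int] by (intro integral_mono) auto
  also have "\<dots> = (\<integral>x. k x * indicator {x. 0 < max_sum k n x} x \<partial>M) + (\<integral>x. max_sum k n x \<partial>M)"
    using int kint integrable_T[OF int] integral_T[of "max_sum k n"] by simp
  finally show ?thesis by simp
qed

text \<open>The maximal ergodic theorem for \<open>h - \<delta>\<close>, followed by continuity from
  below. This is all that the subadditive theorem uses about Birkhoff sums; the pointwise theorem of
  Birkhoff never enters.\<close>

lemma maximal_inequality:
  assumes h: "integrable M h" and nonneg: "\<And>x. 0 \<le> h x" and "0 < \<delta>"
  shows "measure M {x \<in> space M. \<exists>n. real n * \<delta> < (\<Sum>i<n. h ((T ^^ i) x))} \<le> (\<integral>x. h x \<partial>M) / \<delta>"
proof -
  define k where "k x = h x - \<delta>" for x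
  have k: "integrable M k" unfolding k_def using h by simp
  note [measurable] = borel_measurable_integrable[OF k] borel_measurable_integrable[OF h]
    borel_measurable_integrable[OF max_sum_integrable[OF k]]
  define E where "E n = {x \<in> space M. 0 < max_sum k n x}" for n
  have [measurable]: "E n \<in> sets M" for n unfolding E_def by measurable
  have bound: "measure M (E n) \<le> (\<integral>x. h x \<partial>M) / \<delta>" for n
  proof -
    have "0 \<le> (\<integral>x. k x * indicator {x. 0 < max_sum k n x} x \<partial>M)"
      by (rule maximal_ergodic[OF k])
    also have "\<dots> = (\<integral>x. k x * indicator (E n) x \<partial>M)"
      by (intro Bochner_Integration.integral_cong) (auto simp: E_def indicator_def)
    \<comment> \<open>Nonnegativity of \<open>h\<close> allows the integral of \<open>h\<close> to
      be extended from \<open>E n\<close> to the whole space.\<close>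
    also have "\<dots> \<le> (\<integral>x. h x - \<delta> * indicator (E n) x \<partial>M)"
    proof (rule integral_mono)
      show "integrable M (\<lambda>x. k x * indicator (E n) x)"
        by (rule Bochner_Integration.integrable_bound[OF k]) (auto simp: indicator_def)
      show "integrable M (\<lambda>x. h x - \<delta> * indicator (E n) x)"
        using h by (intro Bochner_Integration.integrable_diff integrable_mult_right integrable_real_indicator)
          (simp_all add: emeasure_eq_measure)
    qed (use nonneg in \<open>auto simp: k_def indicator_def\<close>)
    also have "\<dots> = (\<integral>x. h x \<partial>M) - \<delta> * measure M (E n)"
      using h by (simp add: emeasure_eq_measure)
    finally show ?thesis using \<open>0 < \<delta>\<close> by (simp add: field_simps)
  qed
  have inc: "incseq E"
    unfolding incseq_Suc_iff E_def using max_sum_mono less_le_trans by blast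
  have "(\<lambda>n. measure M (E n)) \<longlonglongrightarrow> measure M (\<Union>n. E n)"
    by (rule finite_Lim_measure_incseq) (use inc in auto)
  then have le: "measure M (\<Union>n. E n) \<le> (\<integral>x. h x \<partial>M) / \<delta>"
    by (rule LIMSEQ_le_const2) (use bound in auto)
  have "{x \<in> space M. \<exists>n. real n * \<delta> < (\<Sum>i<n. h ((T ^^ i) x))} \<subseteq> (\<Union>n. E n)"
  proof clarify
    fix x n assume "x \<in> space M" "real n * \<delta> < (\<Sum>i<n. h ((T ^^ i) x))"
    then have "0 < (\<Sum>i<n. k ((T ^^ i) x))" by (simp add: k_def sum_subtractf)
    with sum_orbit_le_max_sum[of k x n] \<open>x \<in> space M\<close> show "x \<in> (\<Union>n. E n)"
      by (auto simp: E_def intro: less_le_trans)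
  qed
  then have "measure M {x \<in> space M. \<exists>n. real n * \<delta> < (\<Sum>i<n. h ((T ^^ i) x))} \<le> measure M (\<Union>n. E n)"
    by (intro finite_measure_mono) auto
  with le show ?thesis by simp
qed

text \<open>Passing to exp (- f) gives a bounded function, so the integral argument works although
  \<open>f\<close> need not be integrable: the difference \<open>u x - u (T x)\<close> is
  nonnegative almost everywhere and has integral 0.\<close>

lemma AE_invariant_of_le:
  fixes f :: "'a \<Rightarrow> real"
  assumes [measurable]: "f \<in> borel_measurable M"
    and nonneg: "\<And>x. 0 \<le> f x" and le: "AE x in M. f x \<le> f (T x)"
  shows "AE x in M. f (T x) = f x"
proof -
  define u where "u x = exp (- f x)" for x
  have [measurable]: "u \<in> borel_measurable M" unfolding u_def by measurable
  have u: "integrable M u"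
    by (rule integrable_const_bound[where B = 1]) (use nonneg in \<open>auto simp: u_def\<close>)
  have "(\<integral>x. u x - u (T x) \<partial>M) = 0"
    using u integrable_T[OF u] integral_T[of u] by simp
  moreover have "integrable M (\<lambda>x. u x - u (T x))" using u integrable_T[OF u] by simp
  moreover have "AE x in M. 0 \<le> u x - u (T x)" using le by eventually_elim (simp add: u_def)
  ultimately have "AE x in M. u x - u (T x) = 0" by (simp add: integral_nonneg_eq_0_iff_AE)
  then show ?thesis by eventually_elim (simp add: u_def)
qed

section \<open>Blocks along orbits and almost everywhere convergence\<close>

text \<open>Cut the orbit greedily into blocks of length at most \<open>N\<close> on which \<open>g\<close> is at most \<open>F\<close> per step;
  the remaining points, and the last \<open>N\<close> ones, become blocks of length one.\<close>

lemma subadditive_tiling: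
  fixes g :: "nat \<Rightarrow> 'a \<Rightarrow> real"
  assumes sub: "\<And>i n m. g (n + m) ((T ^^ i) x) \<le> g n ((T ^^ i) x) + g m ((T ^^ (i + n)) x)"
    and g0: "\<And>y. g 0 y = 0" and F: "0 \<le> F" and h: "\<And>y. 0 \<le> h y"
    and block: "\<And>i. g 1 ((T ^^ i) x) \<le> h ((T ^^ i) x) \<or>
       (\<exists>m\<in>{1..N}. g m ((T ^^ i) x) \<le> real m * F)"
    and single: "\<And>i. g 1 ((T ^^ i) x) \<le> h ((T ^^ i) x) + C" and C: "0 \<le> C"
  shows "g n ((T ^^ i) x) \<le> real n * F + (\<Sum>j<n. h ((T ^^ (i + j)) x)) + real N * C"
proof (induction n arbitrary: i rule: less_induct)
  case (less n)
  \<comment> \<open>Length-one blocks only, each costing at most \<open>C\<close> beyond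
    \<open>h\<close>. This is applied once at most \<open>N\<close> points are left, hence the term
    \<open>real N * C\<close>.\<close>
  have short: "g n ((T ^^ i) x) \<le> (\<Sum>j<n. h ((T ^^ (i + j)) x)) + real n * C" for n i
  proof (induction n arbitrary: i)
    case (Suc n)
    have "g (Suc n) ((T ^^ i) x) \<le> g 1 ((T ^^ i) x) + g n ((T ^^ Suc i) x)"
      using sub[of 1 n i] by simp
    also have "\<dots> \<le> (h ((T ^^ i) x) + C) + ((\<Sum>j<n. h ((T ^^ (Suc i + j)) x)) + real n * C)"
      by (intro add_mono single Suc)
    also have "\<dots> = (\<Sum>j<Suc n. h ((T ^^ (i + j)) x)) + real (Suc n) * C"
      by (simp only: sum.lessThan_Suc_shift) (simp add: algebra_simps)
    finally show ?case .
  qed (simp add: g0)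
  show ?case
  proof (cases "n \<le> N")
    case True
    then have "real n * C \<le> real N * C" using C by (intro mult_right_mono) auto
    moreover have "0 \<le> real n * F" using F by simp
    ultimately show ?thesis using short[of n i] by linarith
  next
    case False
    have split: "(\<Sum>j<m + r. h ((T ^^ (i + j)) x)) =
        (\<Sum>j<m. h ((T ^^ (i + j)) x)) + (\<Sum>j<r. h ((T ^^ (i + m + j)) x))" for m r
      by (induction r) (simp_all add: algebra_simps)
    show ?thesis
    proof (cases "g 1 ((T ^^ i) x) \<le> h ((T ^^ i) x)")
      case True
      have n: "n = 1 + (n - 1)" using False by simp
      have "g n ((T ^^ i) x) \<le> g 1 ((T ^^ i) x) + g (n - 1) ((T ^^ (i + 1)) x)"
        using sub[of 1 "n - 1" i] n by simp
      also have "\<dots> \<le> h ((T ^^ i) x) + (real (n - 1) * F +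
          (\<Sum>j<n - 1. h ((T ^^ (i + 1 + j)) x)) + real N * C)"
        using True False by (intro add_mono less) auto
      also have "\<dots> \<le> real n * F + (\<Sum>j<1 + (n - 1). h ((T ^^ (i + j)) x)) + real N * C"
        unfolding split using F by (simp add: of_nat_diff mult_right_mono)
      finally show ?thesis using n by simp
    next
      case False2: False
      then obtain m where m: "1 \<le> m" "m \<le> N" "g m ((T ^^ i) x) \<le> real m * F"
        using block[of i] by auto
      have n: "n = m + (n - m)" using False m by simp
      have "g n ((T ^^ i) x) \<le> g m ((T ^^ i) x) + g (n - m) ((T ^^ (i + m)) x)"
        using sub[of m "n - m" i] n by simp
      also have "\<dots> \<le> real m * F + (real (n - m) * F +
          (\<Sum>j<n - m. h ((T ^^ (i + m + j)) x)) + real N * C)"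
        using m False by (intro add_mono less) auto
      also have "\<dots> \<le> real (m + (n - m)) * F + (\<Sum>j<m + (n - m). h ((T ^^ (i + j)) x)) + real N * C"
        unfolding split using sum_nonneg[of "{..<m}" "\<lambda>j. h ((T ^^ (i + j)) x)"] h
        by (simp add: algebra_simps)
      finally show ?thesis using n by simp
    qed
  qed
qed

text \<open>In the style of Katznelson and Weiss: the lower limit is finite and invariant, and orbit
  pieces that nearly realise it are tiled together to bound the upper limit. Nonnegativity excludes
  the lower limit -\<infinity>. Visits to points without a short good block are paid for by the
  maximal inequality.\<close>

theorem subadditive_ergodic_nonneg:
  fixes g :: "nat \<Rightarrow> 'a \<Rightarrow> real"
  assumes g [measurable]: "\<And>n. g n \<in> borel_measurable M"
    and nonneg: "\<And>n x. 0 \<le> g n x" and g0: "\<And>x. g 0 x = 0"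
    and sub: "AE x in M. \<forall>n m. g (n + m) x \<le> g n x + g m ((T ^^ n) x)"
    and int: "integrable M (g 1)"
  shows "AE x in M. convergent (\<lambda>n. g n x / real n)"
proof -
  define f where "f x = liminf (\<lambda>n. ereal (g n x / real n))" for x
  define fr where "fr x = real_of_ereal (f x)" for x
  have f_meas [measurable]: "f \<in> borel_measurable M" unfolding f_def by measurable
  have fr_meas [measurable]: "fr \<in> borel_measurable M" unfolding fr_def by measurable
  have f_nonneg: "0 \<le> f x" for x
    unfolding f_def by (rule Liminf_bounded) (simp add: nonneg)
  then have fr_nonneg: "0 \<le> fr x" for x unfolding fr_def by (simp add: real_of_ereal_pos)
  have sub_orbit: "AE x in M. \<forall>i n m. g (n + m) ((T ^^ i) x) \<le> g n ((T ^^ i) x) + g m ((T ^^ (i + n)) x)"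
    using AE_orbit[OF sub]
  proof eventually_elim
    case (elim x)
    have "(T ^^ n) ((T ^^ i) x) = (T ^^ (i + n)) x" for n i
      by (metis add.commute comp_apply funpow_add)
    with elim show ?case by metis
  qed
  \<comment> \<open>Where the lower limit is infinite, \<open>g n x\<close> exceeds
    \<open>real n * K\<close> for some \<open>n\<close>, and then so does a Birkhoff sum of
    \<open>g 1\<close>. By the maximal inequality such points have measure at most a constant over
    \<open>K\<close>, for every \<open>K\<close>.\<close>
  have "AE x in M. f x \<noteq> \<infinity>"
  proof -
    let ?B = "{x \<in> space M. f x = \<infinity> \<and> (\<forall>n. g n x \<le> (\<Sum>i<n. g 1 ((T ^^ i) x)))}"
    have le: "measure M ?B \<le> (\<integral>x. g 1 x \<partial>M) / K" if K: "0 < K" for K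
    proof -
      have "?B \<subseteq> {x \<in> space M. \<exists>n. real n * K < (\<Sum>i<n. g 1 ((T ^^ i) x))}"
      proof clarify
        fix x assume "f x = \<infinity>" and le: "\<forall>n. g n x \<le> (\<Sum>i<n. g 1 ((T ^^ i) x))"
        then have "eventually (\<lambda>n. ereal K < ereal (g n x / real n)) sequentially"
          unfolding f_def by (intro less_LiminfD) simp
        then have "eventually (\<lambda>n. ereal K < ereal (g n x / real n) \<and> n > 0) sequentially"
          using eventually_gt_at_top eventually_conj by blast
        then obtain n where "ereal K < ereal (g n x / real n)" "n > 0"
          by (metis (mono_tags, lifting) eventually_at_top_linorder order_refl)
        then have "real n * K < g n x" by (simp add: field_simps)
        with le show "\<exists>n. real n * K < (\<Sum>i<n. g 1 ((T ^^ i) x))" by (meson less_le_trans)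
      qed
      then have "measure M ?B \<le> measure M {x \<in> space M. \<exists>n. real n * K < (\<Sum>i<n. g 1 ((T ^^ i) x))}"
        by (intro finite_measure_mono) measurable
      also have "\<dots> \<le> (\<integral>x. g 1 x \<partial>M) / K"
        by (rule maximal_inequality[OF int nonneg K])
      finally show ?thesis .
    qed
    have "(\<lambda>K. (\<integral>x. g 1 x \<partial>M) / real (Suc K)) \<longlonglongrightarrow> 0"
      by (intro LIMSEQ_Suc lim_const_over_n)
    then have "measure M ?B \<le> 0"
      by (rule LIMSEQ_le_const) (use le in auto)
    then have "emeasure M ?B = 0" by (simp add: emeasure_eq_measure measure_le_0_iff)
    moreover have "?B \<in> sets M" by measurable
    ultimately have "AE x in M. \<not> (f x = \<infinity> \<and> (\<forall>n. g n x \<le> (\<Sum>i<n. g 1 ((T ^^ i) x))))"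
      by (simp add: AE_iff_measurable[OF _ refl])
    then show ?thesis using sub_orbit
    proof eventually_elim
      case (elim x)
      \<comment> \<open>With \<open>N = 0\<close>, \<open>F = 0\<close>, \<open>C = 0\<close> and
        \<open>h = g 1\<close> the tiling bound is plain iterated subadditivity.\<close>
      have "g n ((T ^^ j) x) \<le> (\<Sum>i<n. g 1 ((T ^^ (j + i)) x))" for n j
        using subadditive_tiling[of g x 0 "g 1" 0 0 n j] elim(2) g0 nonneg by simp
      from this[of _ 0] elim(1) show ?case by simp
    qed
  qed
  then have f_fin: "AE x in M. f x = ereal (fr x)"
    by eventually_elim (metis ereal_infty_less_eq(2) f_nonneg fr_def ereal_real' abs_ereal_ge0)
  have "AE x in M. f x \<le> f (T x)"
    using sub
  proof eventually_elim
    case (elim x)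
    have "f x = liminf (\<lambda>n. ereal (g (Suc n) x / real (Suc n)))"
      unfolding f_def by (subst liminf_shift[symmetric]) simp
    also have "\<dots> \<le> liminf (\<lambda>n. ereal (g 1 x / real (Suc n)) + ereal (g n (T x) / real n))"
    proof (rule Liminf_mono, rule always_eventually, rule allI)
      fix n
      have "g (Suc n) x / real (Suc n) \<le> (g 1 x + g n (T x)) / real (Suc n)"
        using elim[rule_format, of 1 n] by (intro divide_right_mono) auto
      also have "\<dots> \<le> g 1 x / real (Suc n) + g n (T x) / real n"
      proof (cases n)
        case (Suc m)
        then show ?thesis using nonneg[of n "T x"]
          by (simp add: add_divide_distrib divide_left_mono)
      qed (simp add: g0)
      finally show "ereal (g (Suc n) x / real (Suc n)) \<le> ereal (g 1 x / real (Suc n)) + ereal (g n (T x) / real n)"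
        by simp
    qed
    also have "\<dots> = 0 + liminf (\<lambda>n. ereal (g n (T x) / real n))"
    proof (rule ereal_liminf_lim_add)
      have "(\<lambda>n. g 1 x / real (Suc n)) \<longlonglongrightarrow> 0" by (intro LIMSEQ_Suc lim_const_over_n)
      then show "(\<lambda>n. ereal (g 1 x / real (Suc n))) \<longlonglongrightarrow> 0"
        by (simp add: zero_ereal_def)
    qed simp
    finally show ?case by (simp add: f_def)
  qed
  then have "AE x in M. fr x \<le> fr (T x)"
    using f_fin AE_T[OF f_fin] by eventually_elim simp
  then have fr_T: "AE x in M. fr (T x) = fr x"
    by (intro AE_invariant_of_le) (auto simp: fr_nonneg)
  have fr_orbit: "AE x in M. \<forall>i. fr ((T ^^ i) x) = fr x"
    using AE_orbit[OF fr_T]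
  proof eventually_elim
    case (elim x)
    have "fr ((T ^^ i) x) = fr x" for i
      using elim by (induction i) auto
    then show ?case by simp
  qed
  \<comment> \<open>One \<epsilon> is the slack of the good blocks, one pays for the visits to the
    bad set, and one absorbs the constant \<open>real N * real N\<close> left by the end of the
    orbit piece.\<close>
  have upper: "AE x in M. eventually (\<lambda>n. g n x \<le> real n * (fr x + 3 * \<epsilon>)) sequentially"
    if \<epsilon>: "0 < \<epsilon>" for \<epsilon>
  proof -
    \<comment> \<open>The first clause says that no block of length at most \<open>N\<close> is
      good. The second caps \<open>g 1\<close> by \<open>real N\<close> outside \<open>A N\<close>,
      so that \<open>real N\<close> can serve as the constant \<open>C\<close> of the
      tiling.\<close>
    define A where "A N = {x \<in> space M. (\<forall>m\<in>{1..N}. real m * (fr x + \<epsilon>) < g m x) \<or> real N < g 1 x}" for N :: nat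
    have A_sets [measurable]: "A N \<in> sets M" for N unfolding A_def by measurable
    define h where "h N x = indicator (A N) x * g 1 x" for N x
    have h_meas [measurable]: "h N \<in> borel_measurable M" for N unfolding h_def by measurable
    have h_nonneg: "0 \<le> h N x" for N x unfolding h_def using nonneg by simp
    have h_int: "integrable M (h N)" for N
      unfolding h_def by (rule Bochner_Integration.integrable_bound[OF int]) (auto simp: indicator_def)
    have h_lim: "AE x in M. (\<lambda>N. h N x) \<longlonglongrightarrow> 0"
      using f_fin AE_space
    proof eventually_elim
      case (elim x)
      have "liminf (\<lambda>n. ereal (g n x / real n)) < ereal (fr x + \<epsilon>)"
        using elim \<epsilon> unfolding f_def by simp
      then have "\<exists>\<^sub>F n in sequentially. ereal (g n x / real n) < ereal (fr x + \<epsilon>)"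
        by (rule contrapos_pp) (simp add: not_frequently not_less Liminf_bounded)
      then have "\<exists>n\<ge>1. ereal (g n x / real n) < ereal (fr x + \<epsilon>)"
        unfolding frequently_sequentially by blast
      then obtain n where n: "n \<ge> 1" "g n x / real n < fr x + \<epsilon>" by auto
      obtain K :: nat where K: "g 1 x \<le> real K" using real_arch_simple by blast
      have "h N x = 0" if "N \<ge> max n K" for N
      proof -
        have "g n x < real n * (fr x + \<epsilon>)" using n by (simp add: field_simps)
        moreover have "g 1 x \<le> real N" using K that by linarith
        ultimately show ?thesis using n that by (force simp: h_def A_def indicator_def)
      qed
      then have "eventually (\<lambda>N. h N x = 0) sequentially"
        unfolding eventually_sequentially by blast
      then show ?case by (rule tendsto_eventually)
    qed
    have lim: "(\<lambda>N. \<integral>x. h N x \<partial>M) \<longlonglongrightarrow> (\<integral>x. 0 \<partial>M)"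
    proof (rule integral_dominated_convergence[OF _ _ int h_lim])
      show "AE x in M. norm (h N x) \<le> g 1 x" for N
        using nonneg by (auto simp: h_def indicator_def)
    qed auto
    let ?B = "{x \<in> space M. \<not> eventually (\<lambda>n. g n x \<le> real n * (fr x + 3 * \<epsilon>)) sequentially}"
    have B_sets [measurable]: "?B \<in> sets M" unfolding eventually_sequentially by measurable
    \<comment> \<open>Since \<open>fr\<close> is constant along almost every orbit, the single value
      \<open>fr x + \<epsilon>\<close> can play the role of \<open>F\<close> for all blocks. The
      bound holds for every \<open>N\<close>, and its right side tends to 0.\<close>
    have "measure M ?B \<le> (\<integral>x. h N x \<partial>M) / \<epsilon>" for N
    proof -
      let ?E = "{x \<in> space M. \<exists>n. real n * \<epsilon> < (\<Sum>i<n. h N ((T ^^ i) x))}"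
      have "AE x in M. x \<in> ?B \<longrightarrow> x \<in> ?E"
        using sub_orbit fr_orbit AE_orbit[OF AE_space]
      proof eventually_elim
        case (elim x)
        show ?case
        proof (rule impI, rule ccontr)
          assume x: "x \<in> ?B" "x \<notin> ?E"
          then have S: "(\<Sum>i<n. h N ((T ^^ i) x)) \<le> real n * \<epsilon>" for n
            by (auto simp: not_less)
          have "g 1 ((T ^^ i) x) \<le> h N ((T ^^ i) x) \<or> (\<exists>m\<in>{1..N}. g m ((T ^^ i) x) \<le> real m * (fr x + \<epsilon>))" for i
            using elim(2,3) by (force simp: h_def A_def indicator_def not_less)
          moreover have "g 1 ((T ^^ i) x) \<le> h N ((T ^^ i) x) + real N" for i
            using elim(3)[rule_format, of i] by (auto simp: h_def A_def indicator_def not_less)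
          ultimately have tile: "g n ((T ^^ 0) x) \<le> real n * (fr x + \<epsilon>) + (\<Sum>j<n. h N ((T ^^ (0 + j)) x)) + real N * real N" for n
            using elim(1) g0 add_nonneg_nonneg[OF fr_nonneg less_imp_le[OF \<epsilon>]] h_nonneg
            by (intro subadditive_tiling) auto
          then have g: "g n x \<le> real n * (fr x + 2 * \<epsilon>) + real N * real N" for n
          proof -
            have "g n x \<le> real n * (fr x + \<epsilon>) + real n * \<epsilon> + real N * real N"
              using tile[of n] S[of n] by simp
            then show ?thesis by (simp add: algebra_simps)
          qed
          obtain n0 :: nat where n0: "real N * real N / \<epsilon> \<le> real n0" using real_arch_simple by blast
          have "g n x \<le> real n * (fr x + 3 * \<epsilon>)" if "n \<ge> n0" for n
          proof -
            have "real N * real N \<le> real n0 * \<epsilon>" using n0 \<epsilon> by (simp add: field_simps)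
            also have "\<dots> \<le> real n * \<epsilon>" using that \<epsilon> by simp
            finally show ?thesis using g[of n] by (simp add: algebra_simps)
          qed
          with x show False unfolding eventually_sequentially by blast
        qed
      qed
      then have "measure M ?B \<le> measure M ?E"
        by (intro finite_measure_mono_AE) measurable
      also have "\<dots> \<le> (\<integral>x. h N x \<partial>M) / \<epsilon>"
        by (rule maximal_inequality[OF h_int h_nonneg \<epsilon>])
      finally show ?thesis .
    qed
    moreover have "(\<lambda>N. (\<integral>x. h N x \<partial>M) / \<epsilon>) \<longlonglongrightarrow> 0 / \<epsilon>"
      using lim \<epsilon> by (intro tendsto_divide) auto
    ultimately have "measure M ?B \<le> 0 / \<epsilon>"
      by (intro LIMSEQ_le_const) auto
    then have "emeasure M ?B = 0" by (simp add: emeasure_eq_measure measure_le_0_iff)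
    then show ?thesis by (simp add: AE_iff_measurable[OF B_sets refl])
  qed
  have "AE x in M. \<forall>k. eventually (\<lambda>n. g n x \<le> real n * (fr x + 3 * (1 / real (Suc k)))) sequentially"
    unfolding AE_all_countable by (intro allI upper) simp
  then show ?thesis using f_fin
  proof eventually_elim
    case (elim x)
    have "(\<lambda>n. g n x / real n) \<longlonglongrightarrow> fr x"
    proof (rule order_tendstoI)
      fix c assume "c < fr x"
      then have "ereal c < liminf (\<lambda>n. ereal (g n x / real n))"
        using elim(2) unfolding f_def by simp
      from less_LiminfD[OF this] show "\<forall>\<^sub>F n in sequentially. c < g n x / real n" by simp
    next
      fix c assume c: "fr x < c"
      have aux: "e < (c - fr x) / 3 \<Longrightarrow> y \<le> fr x + 3 * e \<Longrightarrow> y < c" for e y :: real by (simp add: field_simps)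
      have "0 < (c - fr x) / 3" using c by simp
      then obtain k where k: "1 / real (Suc k) < (c - fr x) / 3" by (rule nat_approx_posE)
      show "\<forall>\<^sub>F n in sequentially. g n x / real n < c"
        using elim(1)[rule_format, of k] eventually_gt_at_top[of 0]
      proof eventually_elim
        case (elim n)
        then have "g n x / real n \<le> fr x + 3 * (1 / real (Suc k))"
          by (simp add: divide_le_eq mult.commute)
        then show ?case by (rule aux[OF k])
      qed
    qed
    then show ?case by (rule convergentI)
  qed
qed

end

section \<open>Singular values and covering numbers\<close>

text \<open>A maximiser \<open>v\<close> of the quadratic form on the unit sphere of
  \<open>S\<close> is an eigenvector: if the residual \<open>y\<close> were nonzero, moving from
  \<open>v\<close> in the direction of - y would raise the Rayleigh quotient above its maximum
  \<open>u\<close>.\<close>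

lemma eigenvector_on_subspace:
  fixes f :: "'a::euclidean_space \<Rightarrow> 'a"
  assumes lin: "linear f" and sym: "\<And>x y. f x \<bullet> y = x \<bullet> f y"
    and S: "subspace S" "f ` S \<subseteq> S" "S \<noteq> {0}"
  obtains v u where "v \<in> S" "norm v = 1" "f v = u *\<^sub>R v"
proof -
  interpret linear f by (rule lin)
  let ?K = "sphere 0 1 \<inter> S"
  obtain w where w: "w \<in> S" "w \<noteq> 0" using S subspace_0 by blast
  then have "w /\<^sub>R norm w \<in> ?K" using S by (simp add: subspace_scale)
  moreover have "compact ?K" using S by (intro compact_Int_closed closed_subspace) auto
  moreover have "continuous_on ?K (\<lambda>x. f x \<bullet> x)"
    by (intro continuous_intros linear_continuous_on linear_conv_bounded_linear[THEN iffD1] lin)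
  ultimately obtain v where v: "v \<in> ?K" and max: "\<And>x. x \<in> ?K \<Longrightarrow> f x \<bullet> x \<le> f v \<bullet> v"
    using continuous_attains_sup[of ?K "\<lambda>x. f x \<bullet> x"] by blast
  define u where "u = f v \<bullet> v"
  define q where "q x = u * (x \<bullet> x) - f x \<bullet> x" for x
  have q: "0 \<le> q x" if "x \<in> S" for x
  proof (cases "x = 0")
    case False
    then have "x /\<^sub>R norm x \<in> ?K" using S that by (simp add: subspace_scale)
    from max[OF this] have "(f x \<bullet> x) / (norm x)^2 \<le> u"
      by (simp add: u_def scale divide_simps power2_eq_square)
    with False show ?thesis
      by (simp add: q_def power2_norm_eq_inner divide_le_eq)
  qed (simp add: q_def zero)
  have v1: "v \<bullet> v = 1" using v by (simp add: norm_eq_1)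
  define y where "y = u *\<^sub>R v - f v"
  have "y \<in> S" using S v unfolding y_def by (auto intro!: subspace_diff subspace_scale)
  have "y \<bullet> y = 0"
  proof (rule ccontr)
    assume nz: "y \<bullet> y \<noteq> 0"
    then have pos: "0 < y \<bullet> y" by (simp add: inner_gt_zero_iff)
    have uv: "v \<bullet> f v = u" by (simp add: u_def inner_commute)
    have exp: "q (v + e *\<^sub>R y) = 2 * e * (y \<bullet> y) + e^2 * q y" for e
    proof -
      have "v \<bullet> y = 0" using v1 by (simp add: y_def inner_diff_right u_def inner_commute)
      moreover have fvy: "f v \<bullet> y = - (y \<bullet> y)"
        using \<open>v \<bullet> y = 0\<close> by (simp add: y_def inner_diff_left inner_diff_right inner_commute)
      moreover have "f y \<bullet> v = - (y \<bullet> y)" using fvy sym[of y v] by (simp add: inner_commute)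
      ultimately show ?thesis
        using v1 by (simp add: q_def add scale inner_add_left inner_add_right uv inner_commute
            algebra_simps power2_eq_square)
    qed
    \<comment> \<open>Negative, and so small that \<open>e * q y\<close> is at least
      \<open>- (y \<bullet> y)\<close>: the linear term of the expansion then wins and makes
      \<open>q\<close> negative at \<open>v + e *\<^sub>R y\<close>. The 1 in the denominator covers
      \<open>q y = 0\<close>.\<close>
    define e where "e = - (y \<bullet> y) / (1 + q y)"
    have qy: "0 \<le> q y" using q \<open>y \<in> S\<close> by blast
    have eneg: "e < 0" unfolding e_def using qy pos by (simp add: divide_neg_pos)
    have "v + e *\<^sub>R y \<in> S" using S v \<open>y \<in> S\<close> by (auto intro!: subspace_add subspace_scale)
    from q[OF this] have "0 \<le> e * (2 * (y \<bullet> y) + e * q y)"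
      unfolding exp by (simp add: power2_eq_square algebra_simps)
    then have "2 * (y \<bullet> y) + e * q y \<le> 0" using eneg by (simp add: zero_le_mult_iff)
    moreover have "e * q y \<ge> - (y \<bullet> y)"
    proof -
      have "(y \<bullet> y) * (q y / (1 + q y)) \<le> (y \<bullet> y) * 1"
        using qy pos by (intro mult_left_mono) auto
      then show ?thesis by (simp add: e_def)
    qed
    ultimately show False using pos by linarith
  qed
  then have "f v = u *\<^sub>R v" by (simp add: y_def)
  with v that show thesis by auto
qed

text \<open>Split off a unit eigenvector; by symmetry its orthogonal complement inside
  \<open>S\<close> is invariant again. Working with invariant subspaces of a fixed \<open>f\<close>
  is what makes the induction on dimension possible.\<close>

lemma orthonormal_eigenbasis_subspace:
  fixes f :: "'a::euclidean_space \<Rightarrow> 'a"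
  assumes lin: "linear f" and sym: "\<And>x y. f x \<bullet> y = x \<bullet> f y"
    and S: "subspace S" "f ` S \<subseteq> S"
  shows "\<exists>B\<subseteq>S. pairwise orthogonal B \<and> (\<forall>b\<in>B. norm b = 1) \<and> span B = S \<and> (\<forall>b\<in>B. \<exists>u. f b = u *\<^sub>R b)"
  using S
proof (induction "dim S" arbitrary: S rule: less_induct)
  case less
  show ?case
  proof (cases "S = {0}")
    case True
    then show ?thesis by (intro exI[of _ "{}"]) (auto simp: pairwise_def)
  next
    case False
    obtain v u where v: "v \<in> S" "norm v = 1" "f v = u *\<^sub>R v"
      using eigenvector_on_subspace[OF lin sym less.prems False] by blast
    have vv: "v \<bullet> v = 1" using v by (simp add: norm_eq_1)
    define S' where "S' = {x \<in> S. x \<bullet> v = 0}"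
    have "subspace S'" using less.prems(1) by (auto simp: S'_def subspace_def inner_add_left)
    moreover have "f ` S' \<subseteq> S'" using less.prems(2) v by (auto simp: S'_def sym)
    moreover have "dim S' < dim S"
    proof (rule dim_psubset)
      have eq: "span S' = S'" "span S = S"
        using \<open>subspace S'\<close> less.prems(1) by (simp_all only: span_eq_iff)
      have "S' \<subseteq> S" "v \<notin> S'" using vv by (auto simp: S'_def)
      then show "span S' \<subset> span S" unfolding eq using v(1) by blast
    qed
    ultimately obtain B where B: "B \<subseteq> S'" "pairwise orthogonal B" "\<forall>b\<in>B. norm b = 1" "span B = S'"
      "\<forall>b\<in>B. \<exists>u. f b = u *\<^sub>R b"
      using less.hyps by blast
    have "S \<subseteq> span (insert v B)"
    proof
      fix x assume "x \<in> S"
      then have "x - (x \<bullet> v) *\<^sub>R v \<in> S'"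
        using v less.prems(1) vv by (auto simp: S'_def inner_diff_left intro!: subspace_diff subspace_scale)
      then show "x \<in> span (insert v B)" using B(4) by (auto simp: span_insert)
    qed
    moreover have "span (insert v B) \<subseteq> S"
      using v B(1) less.prems(1) by (intro span_minimal) (auto simp: S'_def)
    moreover have "pairwise orthogonal (insert v B)"
      using B(1,2) by (auto simp: pairwise_insert S'_def orthogonal_def inner_commute)
    moreover have "insert v B \<subseteq> S" using v B(1) by (auto simp: S'_def)
    ultimately show ?thesis using B v by (intro exI[of _ "insert v B"]) auto
  qed
qed

text \<open>Right singular vectors, numbered from 1 by decreasing singular value. Only the existence
  proof looks into the eigenvalue counts behind \<open>sing_val\<close>; every other fact about
  singular values is derived from this predicate.\<close>

definition singular_basis :: "real^'n^'n \<Rightarrow> (nat \<Rightarrow> real^'n) \<Rightarrow> bool" where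
  "singular_basis M v \<longleftrightarrow>
     (\<forall>i\<in>{1..CARD('n)}. \<forall>j\<in>{1..CARD('n)}. v i \<bullet> v j = (if i = j then 1 else 0)) \<and>
     (\<forall>x. x = (\<Sum>i\<in>{1..CARD('n)}. (x \<bullet> v i) *\<^sub>R v i)) \<and>
     (\<forall>i\<in>{1..CARD('n)}. \<forall>j\<in>{1..CARD('n)}.
        (M *v v i) \<bullet> (M *v v j) = (if i = j then (sing_val M i)\<^sup>2 else 0)) \<and>
     (\<forall>i\<in>{1..CARD('n)}. norm (M *v v i) = sing_val M i) \<and>
     (\<forall>i j. 1 \<le> i \<longrightarrow> i \<le> j \<longrightarrow> j \<le> CARD('n) \<longrightarrow> sing_val M j \<le> sing_val M i)"

lemma singular_basisD:
  fixes M :: "real^'n^'n"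
  assumes "singular_basis M v"
  shows "i \<in> {1..CARD('n)} \<Longrightarrow> j \<in> {1..CARD('n)} \<Longrightarrow> v i \<bullet> v j = (if i = j then 1 else 0)"
    and "x = (\<Sum>i\<in>{1..CARD('n)}. (x \<bullet> v i) *\<^sub>R v i)"
    and "i \<in> {1..CARD('n)} \<Longrightarrow> j \<in> {1..CARD('n)} \<Longrightarrow>
       (M *v v i) \<bullet> (M *v v j) = (if i = j then (sing_val M i)\<^sup>2 else 0)"
    and "i \<in> {1..CARD('n)} \<Longrightarrow> norm (M *v v i) = sing_val M i"
    and "1 \<le> i \<Longrightarrow> i \<le> j \<Longrightarrow> j \<le> CARD('n) \<Longrightarrow> sing_val M j \<le> sing_val M i"
  using assms unfolding singular_basis_def by blast+

text \<open>Sort an orthonormal eigenbasis of \<open>transpose M ** M\<close> by decreasing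
  eigenvalue. Each eigenspace is spanned by the basis vectors it contains, so
  \<open>eig_count\<close> counts basis vectors, and the l-th vector of the sorted list realises
  \<open>eig_desc\<close> at \<open>l\<close>.\<close>

lemma ex_singular_basis:
  fixes M :: "real^'n^'n"
  shows "\<exists>v. singular_basis M v"
proof -
  define P where "P = transpose M ** M"
  let ?d = "CARD('n)"
  have Pin: "(P *v x) \<bullet> y = (M *v x) \<bullet> (M *v y)" for x y
    unfolding P_def by (metis dot_lmul_matrix inner_commute matrix_vector_mul_assoc vector_transpose_matrix)
  have sym: "(P *v x) \<bullet> y = x \<bullet> (P *v y)" for x y
    using Pin[of x y] Pin[of y x] by (simp add: inner_commute)
  obtain B where B: "pairwise orthogonal B" "\<And>b. b \<in> B \<Longrightarrow> norm b = 1" "span B = UNIV"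
    "\<And>b. b \<in> B \<Longrightarrow> \<exists>u. P *v b = u *\<^sub>R b"
    using orthonormal_eigenbasis_subspace[OF matrix_vector_mul_linear[of P] sym, of UNIV] by auto
  have bb: "b \<bullet> b' = (if b = b' then 1 else 0)" if "b \<in> B" "b' \<in> B" for b b'
    using B(1,2) that by (auto simp: pairwise_def orthogonal_def norm_eq_1)
  have "0 \<notin> B" using B(2) by force
  with B(1) have ind: "independent B" by (rule pairwise_orthogonal_independent)
  then have fin: "finite B" by (rule independent_imp_finite)
  have card: "card B = ?d"
    using ind B(3) by (metis dim_UNIV dim_eq_card DIM_cart DIM_real mult.right_neutral span_UNIV)
  define ev where "ev b = (P *v b) \<bullet> b" for b
  have ev: "P *v b = ev b *\<^sub>R b" if "b \<in> B" for b
    using B(4)[OF that] bb[OF that that] by (auto simp: ev_def)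
  have expand: "x = (\<Sum>b\<in>B. (x \<bullet> b) *\<^sub>R b)" for x
  proof -
    have "x \<in> range (\<lambda>c. \<Sum>b\<in>B. c b *\<^sub>R b)" using B(3) span_finite[OF fin] by simp
    then obtain c where c: "x = (\<Sum>b\<in>B. c b *\<^sub>R b)" by blast
    have "x \<bullet> b = c b" if "b \<in> B" for b
    proof -
      have "x \<bullet> b = (\<Sum>b'\<in>B. c b' * (b' \<bullet> b))" by (simp add: c inner_sum_left)
      also have "\<dots> = (\<Sum>b'\<in>B. if b' = b then c b' else 0)"
        using bb that by (intro sum.cong) auto
      finally show ?thesis using fin that by simp
    qed
    then have "(\<Sum>b\<in>B. (x \<bullet> b) *\<^sub>R b) = (\<Sum>b\<in>B. c b *\<^sub>R b)" by (intro sum.cong) auto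
    with c show ?thesis by simp
  qed
  have eigsp: "eigsp P u = span {b\<in>B. ev b = u}" for u
  proof
    show "span {b\<in>B. ev b = u} \<subseteq> eigsp P u"
      by (rule span_minimal) (auto simp: eigsp_def ev subspace_def matrix_vector_right_distrib
          matrix_vector_mult_scaleR scaleR_add_right)
    show "eigsp P u \<subseteq> span {b\<in>B. ev b = u}"
    proof
      fix x assume x: "x \<in> eigsp P u"
      have "(x \<bullet> b) *\<^sub>R b \<in> span {b\<in>B. ev b = u}" if b: "b \<in> B" for b
      proof (cases "ev b = u")
        case False
        have "u * (x \<bullet> b) = ev b * (x \<bullet> b)"
          using sym[of x b] x ev[OF b] by (simp add: eigsp_def)
        then show ?thesis using False by (simp add: span_0)
      qed (use b in \<open>auto intro: span_scale span_base\<close>)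
      then show "x \<in> span {b\<in>B. ev b = u}"
        by (subst expand) (rule span_sum)
    qed
  qed
  have dim_eigsp: "dim (eigsp P u) = card {b\<in>B. ev b = u}" for u
    unfolding eigsp dim_span
    by (rule dim_eq_card_independent) (rule independent_mono[OF ind], auto)
  have count: "eig_count P t = card {b\<in>B. t \<le> ev b}" for t
  proof -
    have "{u. t \<le> u \<and> eigsp P u \<noteq> {0}} = ev ` {b\<in>B. t \<le> ev b}"
    proof -
      have "eigsp P u \<noteq> {0} \<longleftrightarrow> (\<exists>b\<in>B. ev b = u)" for u
      proof
        assume "\<exists>b\<in>B. ev b = u"
        then obtain b where "b \<in> B" "ev b = u" by blast
        then have "b \<in> eigsp P u" "b \<noteq> 0" using \<open>0 \<notin> B\<close> by (auto simp: eigsp intro!: span_base)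
        then show "eigsp P u \<noteq> {0}" by auto
      next
        assume "eigsp P u \<noteq> {0}"
        then have "{b\<in>B. ev b = u} \<noteq> {}" unfolding eigsp by (metis span_empty)
        then show "\<exists>b\<in>B. ev b = u" by blast
      qed
      then show ?thesis by auto
    qed
    then have "eig_count P t = (\<Sum>u\<in>ev ` {b\<in>B. t \<le> ev b}. card {b\<in>{b\<in>B. t \<le> ev b}. ev b = u})"
      unfolding eig_count_def dim_eigsp by (auto intro!: sum.cong arg_cong[where f = card])
    also have "\<dots> = card {b\<in>B. t \<le> ev b}"
      unfolding card_eq_sum using fin by (intro sum.group) auto
    finally show ?thesis .
  qed
  obtain xs where xs: "set xs = B" "distinct xs" using finite_distinct_list[OF fin] by blast
  define ys where "ys = sort_key (\<lambda>b. - ev b) xs"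
  have ys: "set ys = B" "distinct ys" "length ys = ?d" and srt: "sorted (map (\<lambda>b. - ev b) ys)"
    using xs card distinct_card[of xs] by (auto simp: ys_def)
  \<comment> \<open>Singular values are numbered from 1, list entries from 0.\<close>
  define v where "v i = ys ! (i - 1)" for i :: nat
  have bij: "bij_betw v {1..?d} B"
  proof -
    have "bij_betw ((!) ys) {..<?d} B"
      using ys by (intro bij_betw_nth) auto
    moreover have "bij_betw (\<lambda>i. i - 1) {1..?d} {..<?d}"
      by (rule bij_betw_byWitness[where f' = Suc]) auto
    ultimately have "bij_betw ((!) ys \<circ> (\<lambda>i. i - 1)) {1..?d} B" by (rule bij_betw_trans[rotated])
    moreover have "(!) ys \<circ> (\<lambda>i. i - 1) = v" by (auto simp: v_def)
    ultimately show ?thesis by simp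
  qed
  then have vB: "v i \<in> B" if "i \<in> {1..?d}" for i using that by (auto simp: bij_betw_def)
  have vinj: "v i = v j \<longleftrightarrow> i = j" if "i \<in> {1..?d}" "j \<in> {1..?d}" for i j
    using bij that by (metis bij_betw_def inj_on_eq_iff)
  have mono: "ev (v j) \<le> ev (v i)" if "1 \<le> i" "i \<le> j" "j \<le> ?d" for i j
    using sorted_nth_mono[OF srt, of "i - 1" "j - 1"] that ys(3) by (simp add: v_def)
  have desc: "eig_desc P l = ev (v l)" if l: "l \<in> {1..?d}" for l
  proof -
    \<comment> \<open>This equivalence turns the set inside \<open>eig_desc\<close> into the
      half-line up to \<open>ev (v l)\<close>, whose supremum is attained.\<close>
    have "l \<le> card {b\<in>B. t \<le> ev b} \<longleftrightarrow> t \<le> ev (v l)" for t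
    proof
      assume t: "t \<le> ev (v l)"
      have "v ` {1..l} \<subseteq> {b\<in>B. t \<le> ev b}"
      proof clarify
        fix i assume "i \<in> {1..l}"
        then show "v i \<in> B \<and> t \<le> ev (v i)" using l t mono[of i l] vB[of i] by auto
      qed
      moreover have "card (v ` {1..l}) = l"
      proof -
        have "inj_on v {1..l}" using bij l unfolding bij_betw_def by (auto elim: inj_on_subset)
        then show ?thesis by (simp add: card_image)
      qed
      ultimately show "l \<le> card {b\<in>B. t \<le> ev b}"
        using fin card_mono[of "{b\<in>B. t \<le> ev b}" "v ` {1..l}"] by simp
    next
      assume le: "l \<le> card {b\<in>B. t \<le> ev b}"
      show "t \<le> ev (v l)"
      proof (rule ccontr)
        assume "\<not> t \<le> ev (v l)"
        have "{b\<in>B. t \<le> ev b} \<subseteq> v ` {1..<l}"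
        proof
          fix b assume b: "b \<in> {b\<in>B. t \<le> ev b}"
          then obtain i where i: "i \<in> {1..?d}" "b = v i" using bij by (auto simp: bij_betw_def)
          have "i < l"
          proof (rule ccontr)
            assume "\<not> i < l"
            then have "ev (v i) \<le> ev (v l)" using mono[of l i] i l by auto
            with b i \<open>\<not> t \<le> ev (v l)\<close> show False by auto
          qed
          with i show "b \<in> v ` {1..<l}" by auto
        qed
        then have "card {b\<in>B. t \<le> ev b} \<le> card (v ` {1..<l})" by (intro card_mono) auto
        also have "\<dots> \<le> card {1..<l}" by (rule card_image_le) simp
        finally have "card {b\<in>B. t \<le> ev b} \<le> l - 1" by simp
        moreover have "1 \<le> l" using l by simp
        ultimately show False using le by linarith
      qed
    qed
    then have "{t. l \<le> eig_count P t} = {..ev (v l)}" by (auto simp: count)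
    then show ?thesis by (simp add: eig_desc_def)
  qed
  have ev_norm: "ev b = (norm (M *v b))\<^sup>2" for b
    by (simp add: ev_def Pin power2_norm_eq_inner)
  have sv: "sing_val M i = norm (M *v v i)" if "i \<in> {1..?d}" for i
    using desc[OF that] by (simp add: sing_val_def P_def[symmetric] ev_norm)
  have "singular_basis M v"
    unfolding singular_basis_def
  proof (intro conjI ballI allI impI)
    show "v i \<bullet> v j = (if i = j then 1 else 0)" if "i \<in> {1..?d}" "j \<in> {1..?d}" for i j
      using bb[OF vB vB] vinj that by simp
    show "x = (\<Sum>i\<in>{1..?d}. (x \<bullet> v i) *\<^sub>R v i)" for x
      by (subst sum.reindex_bij_betw[OF bij, of "\<lambda>b. (x \<bullet> b) *\<^sub>R b"]) (rule expand)
    show "(M *v v i) \<bullet> (M *v v j) = (if i = j then (sing_val M i)\<^sup>2 else 0)"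
      if "i \<in> {1..?d}" "j \<in> {1..?d}" for i j
    proof (cases "i = j")
      case False
      have "(M *v v i) \<bullet> (M *v v j) = ev (v i) * (v i \<bullet> v j)"
        using Pin[of "v i" "v j"] ev[OF vB] that by simp
      with False show ?thesis using bb[OF vB vB] vinj that by simp
    qed (use sv that in \<open>simp add: power2_norm_eq_inner\<close>)
    show "norm (M *v v i) = sing_val M i" if "i \<in> {1..?d}" for i using sv that by simp
    show "sing_val M j \<le> sing_val M i" if "1 \<le> i" "i \<le> j" "j \<le> ?d" for i j
      using mono[OF that] sv that by (simp add: ev_norm)
  qed
  then show ?thesis by blast
qed

section \<open>Order, size and positivity of singular values\<close>

lemma sing_val_antimono:
  fixes M :: "real^'n^'n"
  assumes "1 \<le> i" "i \<le> j" "j \<le> CARD('n)"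
  shows "sing_val M j \<le> sing_val M i"
  using ex_singular_basis[of M] singular_basisD(5) assms by blast

lemma sing_val_le_onorm:
  fixes M :: "real^'n^'n"
  assumes "i \<in> {1..CARD('n)}"
  shows "sing_val M i \<le> onorm ((*v) M)"
proof -
  obtain v :: "nat \<Rightarrow> real^'n" where "singular_basis M v"
    using ex_singular_basis by blast
  note v = singular_basisD[OF this]
  have "norm (M *v v i) \<le> onorm ((*v) M) * norm (v i)"
    by (rule onorm) (rule matrix_vector_mul_bounded_linear)
  moreover have "norm (v i) = 1" using v(1)[of i i] assms by (simp add: norm_eq_1)
  ultimately show ?thesis using v(4)[of i] assms by simp
qed

lemma sing_val_pos:
  fixes M :: "real^'n^'n"
  assumes "invertible M" "i \<in> {1..CARD('n)}"
  shows "0 < sing_val M i"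
proof -
  obtain v :: "nat \<Rightarrow> real^'n" where "singular_basis M v"
    using ex_singular_basis by blast
  note v = singular_basisD[OF this]
  have "M *v v i \<noteq> 0"
  proof
    assume "M *v v i = 0"
    then have "v i = 0"
      using assms(1) by (metis invertible_def matrix_vector_mul_assoc matrix_vector_mul_lid matrix_vector_mult_0_right)
    with v(1)[of i i] assms show False by simp
  qed
  with v(4)[of i] assms show ?thesis by (metis zero_less_norm_iff)
qed

section \<open>Covering numbers of ellipsoids\<close>

definition covnum :: "'a::metric_space set \<Rightarrow> real \<Rightarrow> nat" where
  "covnum S t = (LEAST k. \<exists>C. finite C \<and> card C = k \<and> S \<subseteq> (\<Union>c\<in>C. cball c t))"

lemma covnum_le:
  assumes "finite C" "S \<subseteq> (\<Union>c\<in>C. cball c t)"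
  shows "covnum S t \<le> card C"
  unfolding covnum_def using assms by (intro Least_le) blast

text \<open>Compactness supplies some finite cover; without one the \<open>LEAST\<close> in
  \<open>covnum\<close> would be unspecified.\<close>

lemma covnum_cover:
  assumes "compact S" "0 < t"
  obtains C where "finite C" "card C = covnum S t" "S \<subseteq> (\<Union>c\<in>C. cball c t)"
proof -
  obtain C where "finite C" "S \<subseteq> (\<Union>c\<in>C. ball c t)"
    using assms by (metis compact_eq_totally_bounded)
  then have "S \<subseteq> (\<Union>c\<in>C. cball c t)" using ball_subset_cball by blast
  with \<open>finite C\<close> have "\<exists>k C. finite C \<and> card C = k \<and> S \<subseteq> (\<Union>c\<in>C. cball c t)" by blast
  from LeastI_ex[OF this] that show thesis unfolding covnum_def by blast
qed

lemma covnum_pos: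
  assumes "compact S" "0 < t" "S \<noteq> {}"
  shows "1 \<le> covnum S t"
proof -
  obtain C where C: "finite C" "card C = covnum S t" "S \<subseteq> (\<Union>c\<in>C. cball c t)"
    using covnum_cover assms by metis
  with assms(3) have "C \<noteq> {}" by auto
  with C show ?thesis by (metis One_nat_def Suc_leI card_gt_0_iff)
qed

text \<open>The radius stays the same because centres may lie outside the covered set.\<close>

lemma covnum_mono:
  assumes "compact S'" "0 < t" "S \<subseteq> S'"
  shows "covnum S t \<le> covnum S' t"
  using covnum_cover[OF assms(1,2)] covnum_le assms(3) by (metis order_trans)

abbreviation mat_ball :: "real^'n^'n \<Rightarrow> (real^'n) set" where
  "mat_ball M \<equiv> (*v) M ` cball 0 1"

lemma compact_mat_ball: "compact (mat_ball (M :: real^'n^'n))"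
  by (intro compact_continuous_image linear_continuous_on matrix_vector_mul_bounded_linear) auto

text \<open>\<open>M\<close> carries a ball of radius \<open>s\<close> to a translate of the
  ellipsoid of \<open>M\<close> scaled by \<open>s\<close>, and a cover of that ellipsoid with
  radius \<open>t\<close> scales to one with radius \<open>t * s\<close>.\<close>

lemma covnum_mat_mult:
  fixes M N :: "real^'n^'n"
  assumes t: "0 < t" and s: "0 < s"
  shows "covnum (mat_ball (M ** N)) (t * s) \<le> covnum (mat_ball M) t * covnum (mat_ball N) s"
proof -
  obtain C where C: "finite C" "card C = covnum (mat_ball M) t" "mat_ball M \<subseteq> (\<Union>c\<in>C. cball c t)"
    using covnum_cover[OF compact_mat_ball t] by metis
  obtain D where D: "finite D" "card D = covnum (mat_ball N) s" "mat_ball N \<subseteq> (\<Union>c\<in>D. cball c s)"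
    using covnum_cover[OF compact_mat_ball s] by metis
  define E where "E = (\<lambda>(c, e). M *v e + s *\<^sub>R c) ` (C \<times> D)"
  have "mat_ball (M ** N) \<subseteq> (\<Union>c\<in>E. cball c (t * s))"
  proof
    fix y assume "y \<in> mat_ball (M ** N)"
    then obtain x where x: "x \<in> cball 0 1" "y = M *v (N *v x)"
      by (auto simp: matrix_vector_mul_assoc)
    then obtain e where e: "e \<in> D" "N *v x \<in> cball e s" using D(3) by blast
    define z where "z = (N *v x - e) /\<^sub>R s"
    have "norm z \<le> 1" using e s by (simp add: z_def dist_norm norm_minus_commute divide_simps)
    then obtain c where c: "c \<in> C" "M *v z \<in> cball c t" using C(3) by (force simp: dist_norm)
    have "N *v x = e + s *\<^sub>R z" using s by (simp add: z_def)
    then have y: "y = M *v e + s *\<^sub>R (M *v z)"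
      by (simp add: x matrix_vector_right_distrib matrix_vector_mult_scaleR)
    have "dist (M *v e + s *\<^sub>R c) y = s * dist c (M *v z)"
      using s unfolding y dist_norm by (simp add: scaleR_diff_right[symmetric])
    also have "\<dots> \<le> s * t" using c s by (intro mult_left_mono) auto
    finally have "y \<in> cball (M *v e + s *\<^sub>R c) (t * s)" by (simp add: mult.commute)
    then show "y \<in> (\<Union>c\<in>E. cball c (t * s))" using c e unfolding E_def by force
  qed
  then have "covnum (mat_ball (M ** N)) (t * s) \<le> card E"
    using C D by (intro covnum_le) (auto simp: E_def)
  also have "\<dots> \<le> card (C \<times> D)" unfolding E_def using C D by (intro card_image_le) auto
  finally show ?thesis using C D by (simp add: card_cartesian_product)
qed

text \<open>A grid along the axes of the ellipsoid with step \<open>t / d\<close>, \<open>d\<close>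
  being the dimension, so that the rounding errors of the \<open>d\<close> coordinates add up to at
  most \<open>t\<close>.\<close>

lemma covnum_mat_ball_le:
  fixes M :: "real^'n^'n"
  assumes t: "0 < t"
  shows "real (covnum (mat_ball M) t) \<le> (\<Prod>i\<in>{1..CARD('n)}. real (2 * CARD('n) + 3) * max (sing_val M i / t) 1)"
proof -
  let ?d = "CARD('n)" and ?I = "{1..CARD('n)}"
  let ?s = "sing_val M"
  obtain v :: "nat \<Rightarrow> real^'n" where "singular_basis M v"
    using ex_singular_basis by blast
  note v = singular_basisD[OF this]
  define K where "K i = \<lceil>?s i * ?d / t\<rceil>" for i
  \<comment> \<open>The vector \<open>M *v v i\<close> has length \<open>?s i\<close>, so one unit
    of \<open>m i\<close> is a step of length \<open>t / ?d\<close>. If \<open>?s i = 0\<close>, the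
    term vanishes.\<close>
  define ctr where "ctr m = (\<Sum>i\<in>?I. (real_of_int (m i) * t / (?d * ?s i)) *\<^sub>R (M *v v i))" for m :: "nat \<Rightarrow> int"
  define C where "C = ctr ` (PiE ?I (\<lambda>i. {- K i..K i}))"
  have s0: "0 \<le> ?s i" if "i \<in> ?I" for i using v(4)[OF that] by (metis norm_ge_zero)
  have K0: "0 \<le> K i" if "i \<in> ?I" for i
  proof -
    have "0 \<le> ?s i * ?d / t" using s0[OF that] t by simp
    then show ?thesis unfolding K_def by linarith
  qed
  have "mat_ball M \<subseteq> (\<Union>c\<in>C. cball c t)"
  proof
    fix y assume "y \<in> mat_ball M"
    then obtain x where x: "norm x \<le> 1" "y = M *v x" by auto
    define m where "m = restrict (\<lambda>i. \<lfloor>(x \<bullet> v i) * ?s i * ?d / t\<rfloor>) ?I"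
    have xv: "\<bar>x \<bullet> v i\<bar> \<le> 1" if "i \<in> ?I" for i
      using Cauchy_Schwarz_ineq2[of x "v i"] v(1)[OF that that] x by (simp add: norm_eq_sqrt_inner[of "v i"])
    have "m \<in> PiE ?I (\<lambda>i. {- K i..K i})"
    proof (rule PiE_I)
      fix i assume i: "i \<in> ?I"
      have a: "\<bar>(x \<bullet> v i) * ?s i * ?d / t\<bar> \<le> ?s i * ?d / t"
        using mult_right_mono[OF xv[OF i], of "?s i * ?d / t"] s0[OF i] t
        by (simp add: abs_mult)
      then have "\<lfloor>(x \<bullet> v i) * ?s i * ?d / t\<rfloor> \<le> K i"
        unfolding K_def by (meson abs_le_D1 ceiling_mono floor_le_ceiling order_trans)
      moreover have "- K i \<le> \<lfloor>(x \<bullet> v i) * ?s i * ?d / t\<rfloor>"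
        unfolding K_def le_floor_iff using a by linarith
      ultimately show "m i \<in> {- K i..K i}" using i by (simp add: m_def)
    next
      show "m i = undefined" if "i \<notin> ?I" for i
        unfolding m_def using that by (rule restrict_apply[THEN trans, OF if_not_P])
    qed
    moreover have "y \<in> cball (ctr m) t"
    proof -
      have "y = (\<Sum>i\<in>?I. (x \<bullet> v i) *\<^sub>R (M *v v i))"
        unfolding x by (subst v(2)) (simp add: linear_sum[OF matrix_vector_mul_linear] matrix_vector_mult_scaleR)
      then have "y - ctr m = (\<Sum>i\<in>?I. (x \<bullet> v i - real_of_int (m i) * t / (?d * ?s i)) *\<^sub>R (M *v v i))"
        by (simp add: ctr_def sum_subtractf scaleR_diff_left)
      also have "norm \<dots> \<le> (\<Sum>i\<in>?I. t / ?d)"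
      proof (rule order_trans[OF norm_sum], rule sum_mono)
        fix i assume i: "i \<in> ?I"
        show "norm ((x \<bullet> v i - real_of_int (m i) * t / (?d * ?s i)) *\<^sub>R (M *v v i)) \<le> t / ?d"
        proof (cases "?s i = 0")
          case True
          then show ?thesis using v(4)[OF i] t by simp
        next
          case False
          then have si: "?s i > 0" using s0[OF i] by simp
          have "norm ((x \<bullet> v i - real_of_int (m i) * t / (?d * ?s i)) *\<^sub>R (M *v v i)) =
             \<bar>x \<bullet> v i - real_of_int (m i) * t / (?d * ?s i)\<bar> * \<bar>?s i\<bar>"
            using v(4)[OF i] si by simp
          also have "\<dots> = \<bar>(x \<bullet> v i) * ?s i * ?d / t - real_of_int (m i)\<bar> * \<bar>t / ?d\<bar>"
          proof -
            have "(x \<bullet> v i - real_of_int (m i) * t / (?d * ?s i)) * ?s i =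
                ((x \<bullet> v i) * ?s i * ?d / t - real_of_int (m i)) * (t / ?d)"
              using si t by (simp add: field_simps)
            then show ?thesis unfolding abs_mult[symmetric] by simp
          qed
          also have "\<dots> \<le> 1 * \<bar>t / ?d\<bar>"
            using i by (intro mult_right_mono) (auto simp: m_def, linarith)
          finally show ?thesis using t by simp
        qed
      qed
      finally show ?thesis by (simp add: dist_norm norm_minus_commute)
    qed
    ultimately show "y \<in> (\<Union>c\<in>C. cball c t)" unfolding C_def by blast
  qed
  then have "covnum (mat_ball M) t \<le> card C"
    by (intro covnum_le) (auto simp: C_def intro!: finite_PiE)
  also have "card C \<le> card (PiE ?I (\<lambda>i. {- K i..K i}))"
    unfolding C_def by (intro card_image_le finite_PiE) auto
  also have "\<dots> = (\<Prod>i\<in>?I. nat (2 * K i + 1))" by (simp add: card_PiE algebra_simps)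
  finally have "real (covnum (mat_ball M) t) \<le> (\<Prod>i\<in>?I. real (nat (2 * K i + 1)))"
    by (metis of_nat_le_iff of_nat_prod)
  also have "\<dots> \<le> (\<Prod>i\<in>?I. real (2 * ?d + 3) * max (?s i / t) 1)"
  proof (rule prod_mono, safe)
    fix i assume i: "i \<in> ?I"
    have "real (nat (2 * K i + 1)) = 2 * real_of_int (K i) + 1" using K0[OF i] by simp
    also have "\<dots> \<le> 2 * (?s i * ?d / t + 1) + 1"
      unfolding K_def by (intro add_right_mono mult_left_mono) auto
    also have "\<dots> = (2 * ?d) * (?s i / t) + 3 * 1" by simp
    also have "\<dots> \<le> (2 * ?d) * max (?s i / t) 1 + 3 * max (?s i / t) 1"
      by (intro add_mono mult_left_mono) auto
    also have "\<dots> = real (2 * ?d + 3) * max (?s i / t) 1" by (simp add: algebra_simps)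
    finally show "real (nat (2 * K i + 1)) \<le> real (2 * ?d + 3) * max (?s i / t) 1" .
  qed simp
  finally show ?thesis .
qed

text \<open>Points of the ellipsoid at mutual distance at least \<open>3 * t\<close>: a closed ball
  of radius \<open>t\<close> contains at most one of them, so they inject into the set of centres of
  any cover.\<close>

lemma le_covnum_mat_ball:
  fixes M :: "real^'n^'n"
  assumes t: "0 < t"
  shows "(\<Prod>i\<in>{1..CARD('n)}. max (sing_val M i / t) 1 / (3 * real CARD('n))) \<le> real (covnum (mat_ball M) t)"
proof -
  let ?d = "CARD('n)" and ?I = "{1..CARD('n)}"
  let ?s = "sing_val M"
  obtain v :: "nat \<Rightarrow> real^'n" where "singular_basis M v"
    using ex_singular_basis by blast
  note v = singular_basisD[OF this]
  have s0: "0 \<le> ?s i" if "i \<in> ?I" for i using v(4)[OF that] by (metis norm_ge_zero)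
  \<comment> \<open>The \<open>3 * t\<close> is the spacing, more than the diameter
    \<open>2 * t\<close> of a covering ball. The factor \<open>?d\<close> keeps the coefficients of
    the preimage below \<open>1 / ?d\<close> each, so that by the triangle inequality the points
    stay in the ellipsoid.\<close>
  define K where "K i = nat \<lfloor>?s i / (3 * t * ?d)\<rfloor>" for i
  define pt where "pt m = (\<Sum>i\<in>?I. (real (m i) * (3 * t) / ?s i) *\<^sub>R (M *v v i))" for m :: "nat \<Rightarrow> nat"
  define X where "X = PiE ?I (\<lambda>i. {0..K i})"
  have Kle: "real (K i) \<le> ?s i / (3 * t * ?d)" if "i \<in> ?I" for i
    unfolding K_def using s0[OF that] t by simp
  obtain C where C: "finite C" "card C = covnum (mat_ball M) t" "mat_ball M \<subseteq> (\<Union>c\<in>C. cball c t)"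
    using covnum_cover[OF compact_mat_ball t] by metis
  have in_ball: "pt m \<in> mat_ball M" if "m \<in> X" for m
  proof -
    have "pt m = M *v (\<Sum>i\<in>?I. (real (m i) * (3 * t) / ?s i) *\<^sub>R v i)"
      by (simp add: pt_def linear_sum[OF matrix_vector_mul_linear] matrix_vector_mult_scaleR)
    moreover have "norm (\<Sum>i\<in>?I. (real (m i) * (3 * t) / ?s i) *\<^sub>R v i) \<le> (\<Sum>i\<in>?I. 1 / ?d)"
    proof (rule order_trans[OF norm_sum], rule sum_mono)
      fix i assume i: "i \<in> ?I"
      have "norm (v i) = 1" using v(1)[OF i i] by (simp add: norm_eq_1)
      have "m i \<le> K i" using that i by (auto simp: X_def)
      then have "real (m i) \<le> ?s i / (3 * t * ?d)" using Kle[OF i] by (meson of_nat_mono order_trans)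
      then have "real (m i) * (3 * t) / ?s i \<le> 1 / ?d"
        using s0[OF i] t by (cases "?s i = 0") (auto simp: field_simps)
      then show "norm ((real (m i) * (3 * t) / ?s i) *\<^sub>R v i) \<le> 1 / ?d"
        using \<open>norm (v i) = 1\<close> s0[OF i] t by simp
    qed
    ultimately show ?thesis by auto
  qed
  have "\<exists>c\<in>C. pt m \<in> cball c t" if "m \<in> X" for m using in_ball[OF that] C(3) by blast
  then obtain c where c: "\<And>m. m \<in> X \<Longrightarrow> c m \<in> C \<and> pt m \<in> cball (c m) t" by metis
  have "inj_on c X"
  proof (rule inj_onI, rule ccontr)
    fix m m' assume m: "m \<in> X" "m' \<in> X" "c m = c m'" "m \<noteq> m'"
    then obtain i where i: "i \<in> ?I" "m i \<noteq> m' i" unfolding X_def by (metis PiE_ext)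
    have "m i \<le> K i" "m' i \<le> K i" using m i by (auto simp: X_def)
    with i have "0 < K i" by linarith
    then have si: "0 < ?s i" using Kle[OF i(1)] s0[OF i(1)] by (cases "?s i = 0") auto
    have "(pt m - pt m') \<bullet> (M *v v i) = (\<Sum>j\<in>?I. (real (m j) * (3 * t) / ?s j - real (m' j) * (3 * t) / ?s j) * ((M *v v j) \<bullet> (M *v v i)))"
      by (simp add: pt_def sum_subtractf[symmetric] scaleR_diff_left[symmetric] inner_sum_left)
    also have "\<dots> = (\<Sum>j\<in>?I. if j = i then (real (m i) * (3 * t) / ?s i - real (m' i) * (3 * t) / ?s i) * (?s i)\<^sup>2 else 0)"
      using i v(3) by (intro sum.cong) auto
    also have "\<dots> = (real (m i) - real (m' i)) * (3 * t) * ?s i"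
      using i si by (simp add: field_simps power2_eq_square)
    finally have "\<bar>real (m i) - real (m' i)\<bar> * (3 * t) * ?s i = \<bar>(pt m - pt m') \<bullet> (M *v v i)\<bar>"
      using si t by (simp add: abs_mult)
    also have "\<dots> \<le> norm (pt m - pt m') * ?s i"
      using Cauchy_Schwarz_ineq2[of "pt m - pt m'" "M *v v i"] v(4)[OF i(1)] by simp
    finally have "\<bar>real (m i) - real (m' i)\<bar> * (3 * t) \<le> norm (pt m - pt m')" using si by simp
    moreover have "1 * (3 * t) \<le> \<bar>real (m i) - real (m' i)\<bar> * (3 * t)"
      using i t by (intro mult_right_mono) linarith+
    moreover have "norm (pt m - pt m') \<le> t + t"
      using c[OF m(1)] c[OF m(2)] m(3) dist_triangle_le[of "pt m" "c m" "pt m'" "t + t"]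
      by (simp add: dist_norm norm_minus_commute)
    ultimately show False using t by linarith
  qed
  then have "card X \<le> card C" using c C(1) by (intro card_inj_on_le[of c]) auto
  moreover have "card X = (\<Prod>i\<in>?I. K i + 1)" by (simp add: X_def card_PiE)
  ultimately have "real (\<Prod>i\<in>?I. K i + 1) \<le> real (covnum (mat_ball M) t)"
    using C(2) by (simp only: of_nat_le_iff)
  then have "(\<Prod>i\<in>?I. real (K i) + 1) \<le> real (covnum (mat_ball M) t)"
    by (simp add: add.commute)
  moreover have "(\<Prod>i\<in>?I. max (?s i / t) 1 / (3 * real ?d)) \<le> (\<Prod>i\<in>?I. real (K i) + 1)"
  proof (rule prod_mono, safe)
    fix i assume i: "i \<in> ?I"
    have "?s i / (3 * t * ?d) \<le> real (K i) + 1" unfolding K_def using s0[OF i] t by linarith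
    moreover have "1 / (3 * real ?d) \<le> real (K i) + 1"
    proof -
      have "0 < real ?d" by simp
      then have "1 \<le> 3 * real ?d" using Suc_leI[OF zero_less_card_finite[where 'a = 'n]] by linarith
      then have "1 / (3 * real ?d) \<le> 1" by simp
      then show ?thesis by linarith
    qed
    moreover have "max (?s i / t) 1 / (3 * real ?d) = max (?s i / (3 * t * ?d)) (1 / (3 * real ?d))"
      using i by (simp add: max_def field_simps)
    ultimately show "max (?s i / t) 1 / (3 * real ?d) \<le> real (K i) + 1" by simp
  qed simp
  ultimately show ?thesis by linarith
qed

section \<open>Almost sure convergence of the information function\<close>

text \<open>Links integrals over a count space with the \<open>infsum\<close> in
  \<open>part_entropy\<close>, which dominates its finite partial sums.\<close>

lemma nn_integral_count_space_le_finite_sums: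
  fixes f :: "'a::countable \<Rightarrow> ennreal"
  assumes "\<And>F. finite F \<Longrightarrow> sum f F \<le> C"
  shows "(\<integral>\<^sup>+x. f x \<partial>count_space UNIV) \<le> C"
proof -
  define F where "F k = {x::'a. to_nat x < k}" for k
  have fin: "finite (F k)" for k
    unfolding F_def by (rule inj_on_finite[of to_nat _ "{..<k}"]) auto
  have "(\<lambda>x. f x) = (\<lambda>x. SUP k. f x * indicator (F k) x)"
  proof
    fix x
    show "f x = (SUP k. f x * indicator (F k) x)"
    proof (rule antisym)
      have "f x = f x * indicator (F (Suc (to_nat x))) x" by (simp add: F_def)
      then show "f x \<le> (SUP k. f x * indicator (F k) x)" by (metis SUP_upper UNIV_I)
      show "(SUP k. f x * indicator (F k) x) \<le> f x"
        by (rule SUP_least) (auto simp: indicator_def)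
    qed
  qed
  then have "(\<integral>\<^sup>+x. f x \<partial>count_space UNIV) = (\<integral>\<^sup>+x. (SUP k. f x * indicator (F k) x) \<partial>count_space UNIV)"
    by (rule arg_cong[where f = "nn_integral (count_space UNIV)"])
  also have "\<dots> = (SUP k. \<integral>\<^sup>+x. f x * indicator (F k) x \<partial>count_space UNIV)"
    by (rule nn_integral_monotone_convergence_SUP)
      (auto simp: incseq_def le_fun_def F_def indicator_def)
  also have "\<dots> \<le> C"
  proof (rule SUP_least)
    fix k
    have "(\<integral>\<^sup>+x. f x * indicator (F k) x \<partial>count_space UNIV) = sum f (F k)"
      by (subst nn_integral_count_space'[OF fin[of k]]) auto
    then show "(\<integral>\<^sup>+x. f x * indicator (F k) x \<partial>count_space UNIV) \<le> C" using assms[OF fin] by simp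
  qed
  finally show ?thesis .
qed

section \<open>Fibres of countable-valued maps\<close>

context prob_space
begin

lemma nn_integral_countable_valued:
  fixes \<Phi> :: "'a \<Rightarrow> 'j::countable" and f :: "'j \<Rightarrow> ennreal"
  assumes [measurable]: "\<Phi> \<in> M \<rightarrow>\<^sub>M count_space UNIV"
  shows "(\<integral>\<^sup>+x. f (\<Phi> x) \<partial>M) = (\<integral>\<^sup>+j. f j * emeasure M {x \<in> space M. \<Phi> x = j} \<partial>count_space UNIV)"
proof -
  have "f (\<Phi> x) = (\<integral>\<^sup>+j. f j * indicator {\<Phi> x} j \<partial>count_space UNIV)" for x
    by (subst nn_integral_count_space'[of "{\<Phi> x}"]) auto
  then have "(\<integral>\<^sup>+x. f (\<Phi> x) \<partial>M) = (\<integral>\<^sup>+x. \<integral>\<^sup>+j. f j * indicator {x \<in> space M. \<Phi> x = j} x \<partial>count_space UNIV \<partial>M)"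
    by (auto intro!: nn_integral_cong simp: indicator_def)
  also have "\<dots> = (\<integral>\<^sup>+j. \<integral>\<^sup>+x. f j * indicator {x \<in> space M. \<Phi> x = j} x \<partial>M \<partial>count_space UNIV)"
    by (rule nn_integral_count_space_nn_integral) auto
  also have "\<dots> = (\<integral>\<^sup>+j. f j * emeasure M {x \<in> space M. \<Phi> x = j} \<partial>count_space UNIV)"
    by (simp add: nn_integral_cmult_indicator)
  finally show ?thesis .
qed

lemma AE_fibre_pos:
  fixes \<Phi> :: "'a \<Rightarrow> 'j::countable"
  assumes [measurable]: "\<Phi> \<in> M \<rightarrow>\<^sub>M count_space UNIV"
  shows "AE x in M. 0 < measure M {y \<in> space M. \<Phi> y = \<Phi> x}"
proof -
  let ?m = "\<lambda>j. measure M {y \<in> space M. \<Phi> y = j}"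
  have "(\<integral>\<^sup>+x. (if ?m (\<Phi> x) = 0 then 1 else 0) \<partial>M) =
     (\<integral>\<^sup>+j. (if ?m j = 0 then 1 else 0) * emeasure M {x \<in> space M. \<Phi> x = j} \<partial>count_space UNIV)"
    by (rule nn_integral_countable_valued) simp
  also have "\<dots> = (\<integral>\<^sup>+(j::'j). 0 \<partial>count_space UNIV)"
    by (intro nn_integral_cong) (simp add: emeasure_eq_measure)
  finally have "(\<integral>\<^sup>+x. (if ?m (\<Phi> x) = 0 then 1 else 0) \<partial>M) = (0::ennreal)" by simp
  moreover have [measurable]: "(\<lambda>x. ?m (\<Phi> x)) \<in> borel_measurable M"
    by (rule measurable_compose[OF assms]) simp
  ultimately have "AE x in M. (if ?m (\<Phi> x) = 0 then 1 else 0) = (0::ennreal)"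
    by (subst (asm) nn_integral_0_iff_AE) auto
  then show ?thesis by eventually_elim (simp add: zero_less_measure_iff split: if_splits)
qed

text \<open>Markov's inequality on each fibre, then Borel--Cantelli.\<close>

lemma AE_eventually_weight_le_fibre:
  fixes \<Phi> :: "nat \<Rightarrow> 'a \<Rightarrow> 'j::countable" and q :: "nat \<Rightarrow> 'j \<Rightarrow> real"
  assumes \<Phi> [measurable]: "\<And>n. \<Phi> n \<in> M \<rightarrow>\<^sub>M count_space UNIV"
    and q: "\<And>n j. 0 \<le> q n j" "\<And>n. (\<integral>\<^sup>+j. ennreal (q n j) \<partial>count_space UNIV) \<le> 1"
  shows "AE x in M. eventually (\<lambda>n. q n (\<Phi> n x) / (real (Suc n))\<^sup>2 \<le> measure M {y \<in> space M. \<Phi> n y = \<Phi> n x}) sequentially"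
proof -
  let ?m = "\<lambda>n j. measure M {y \<in> space M. \<Phi> n y = j}"
  let ?bad = "\<lambda>n j. ?m n j < q n j / (real (Suc n))\<^sup>2"
  define B where "B n = {x \<in> space M. ?bad n (\<Phi> n x)}" for n
  have B_sets: "B n \<in> sets M" for n
  proof -
    have "Measurable.pred M (\<lambda>x. ?bad n (\<Phi> n x))"
      by (rule measurable_compose[OF \<Phi>, where g = "?bad n"]) simp
    then show ?thesis by (simp add: B_def pred_def)
  qed
  have B_le: "emeasure M (B n) \<le> ennreal (1 / (real (Suc n))\<^sup>2)" for n
  proof -
    have "emeasure M (B n) = (\<integral>\<^sup>+x. indicator (B n) x \<partial>M)"
      using B_sets[of n] by simp
    also have "\<dots> = (\<integral>\<^sup>+x. (if ?bad n (\<Phi> n x) then 1 else 0) \<partial>M)"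
      by (intro nn_integral_cong) (simp add: B_def indicator_def)
    also have "\<dots> = (\<integral>\<^sup>+j. (if ?bad n j then 1 else 0) * emeasure M {x \<in> space M. \<Phi> n x = j} \<partial>count_space UNIV)"
      by (rule nn_integral_countable_valued) simp
    \<comment> \<open>A bad value has fibre mass below
      \<open>q n j / (real (Suc n))\<^sup>2\<close>, a good one contributes 0. The square makes the
      bounds summable in \<open>n\<close>.\<close>
    also have "\<dots> \<le> (\<integral>\<^sup>+j. ennreal (1 / (real (Suc n))\<^sup>2) * ennreal (q n j) \<partial>count_space UNIV)"
      by (intro nn_integral_mono) (auto simp: emeasure_eq_measure ennreal_mult''[symmetric] q intro!: ennreal_leI)
    also have "\<dots> = ennreal (1 / (real (Suc n))\<^sup>2) * (\<integral>\<^sup>+j. ennreal (q n j) \<partial>count_space UNIV)"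
      by (rule nn_integral_cmult) simp
    also have "\<dots> \<le> ennreal (1 / (real (Suc n))\<^sup>2) * 1" by (intro mult_left_mono q) simp
    finally show ?thesis by simp
  qed
  have "summable (\<lambda>n. 1 / (real (Suc n))\<^sup>2)"
    using inverse_power_summable[of 2, where 'a = real] by (subst summable_Suc_iff) (simp add: field_simps)
  have "AE x in M. eventually (\<lambda>n. x \<in> space M - B n) sequentially"
  proof (rule borel_cantelli_AE1)
    show "emeasure M (B n) < \<infinity>" for n by (simp add: less_top[symmetric])
    show "summable (\<lambda>n. measure M (B n))"
    proof (rule summable_comparison_test_ev[OF _ \<open>summable (\<lambda>n. 1 / (real (Suc n))\<^sup>2)\<close>])
      have "measure M (B n) \<le> 1 / (real (Suc n))\<^sup>2" for n
        using B_le[of n] by (simp add: emeasure_eq_measure)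
      then show "eventually (\<lambda>n. norm (measure M (B n)) \<le> 1 / (real (Suc n))\<^sup>2) sequentially" by simp
    qed
  qed (rule B_sets)
  then show ?thesis by eventually_elim (auto simp: B_def elim!: eventually_mono)
qed

end

section \<open>Words, cylinders and tiling weights\<close>

lemma length_prefix [simp]: "length (prefix \<omega> n) = n"
  by (simp add: prefix_def)

lemma mem_cylinder_iff: "\<omega> \<in> cylinder w \<longleftrightarrow> prefix \<omega> (length w) = w"
proof
  assume "\<omega> \<in> cylinder w"
  then show "prefix \<omega> (length w) = w"
    by (intro nth_equalityI) (simp_all add: cylinder_def prefix_def)
next
  assume eq: "prefix \<omega> (length w) = w"
  have "\<omega> k = w ! k" if "k < length w" for k
    using arg_cong[OF eq, of "\<lambda>v. v ! k"] that by (simp add: prefix_def)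
  then show "\<omega> \<in> cylinder w" by (simp add: cylinder_def)
qed

lemma mem_cylinder_prefix: "\<omega>' \<in> cylinder (prefix \<omega> n) \<longleftrightarrow> (\<forall>k<n. \<omega>' k = \<omega> k)"
  by (simp add: cylinder_def prefix_def)

lemma shift_pow: "(shift ^^ n) \<omega> = (\<lambda>k. \<omega> (n + k))"
  by (induction n) (auto simp: shift_def)

lemma prefix_add: "prefix \<omega> (n + m) = prefix \<omega> n @ prefix ((shift ^^ n) \<omega>) m"
  by (rule nth_equalityI) (auto simp: prefix_def shift_pow nth_append)

text \<open>Sum over all cuts of \<open>w\<close> into blocks of the product of the \<open>c\<close>-weights of the blocks; the penalty
  \<open>1 / (k (k + 1))\<close> of a block of length \<open>k\<close> keeps the total mass on words of each length at most 1.\<close>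

function tiling_weight :: "('i list \<Rightarrow> real) \<Rightarrow> 'i list \<Rightarrow> real" where
  "tiling_weight c w = (if w = [] then 1 else
     sum_list (map (\<lambda>k. 1 / (real k * real (Suc k)) * c (take k w) * tiling_weight c (drop k w)) [1..<Suc (length w)]))"
  by auto
termination by (relation "Wellfounded.measure (\<lambda>(c, w). length w)") auto

declare tiling_weight.simps [simp del]

lemma tiling_weight_Nil [simp]: "tiling_weight c [] = 1"
  by (subst tiling_weight.simps) simp

lemma tiling_weight_eq:
  assumes "w \<noteq> []"
  shows "tiling_weight c w =
    (\<Sum>k\<in>{1..length w}. 1 / (real k * real (Suc k)) * c (take k w) * tiling_weight c (drop k w))"
  by (subst tiling_weight.simps, subst sum_list_distinct_conv_sum_set)
    (use assms in \<open>auto simp del: upt_Suc simp: atLeastLessThanSuc_atLeastAtMost\<close>)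

lemma sum_inverse_products: "(\<Sum>k\<in>{1..n}. 1 / (real k * real (Suc k))) = 1 - 1 / real (Suc n)"
proof (induction n)
  case (Suc n)
  have "1 - 1 / x + 1 / (x * (x + 1)) = 1 - 1 / (x + 1)" if "0 < x" for x :: real
    using that by (simp add: divide_simps) (simp add: algebra_simps)
  from this[of "real (Suc n)"] Suc show ?case by simp
qed simp

lemma nn_integral_words_append:
  fixes f g :: "'i::countable list \<Rightarrow> ennreal"
  shows "(\<integral>\<^sup>+w. f (take k w) * g (drop k w) \<partial>count_space {w. length w = k + m}) =
    (\<integral>\<^sup>+u. f u \<partial>count_space {u. length u = k}) * (\<integral>\<^sup>+v. g v \<partial>count_space {v. length v = m})"
proof -
  let ?U = "{u::'i list. length u = k}" and ?V = "{v::'i list. length v = m}"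
  have "bij_betw (\<lambda>(u, v). u @ v) (?U \<times> ?V) {w. length w = k + m}"
    by (rule bij_betw_byWitness[where f' = "\<lambda>w. (take k w, drop k w)"]) auto
  from nn_integral_bij_count_space[OF this, of "\<lambda>w. f (take k w) * g (drop k w)", symmetric]
  have "(\<integral>\<^sup>+w. f (take k w) * g (drop k w) \<partial>count_space {w. length w = k + m}) =
      (\<integral>\<^sup>+p. f (fst p) * g (snd p) \<partial>count_space (?U \<times> ?V))"
    by (simp add: case_prod_beta) (rule nn_integral_cong, auto)
  also have "\<dots> = (\<integral>\<^sup>+p. (f (fst p) * indicator ?U (fst p)) * (g (snd p) * indicator ?V (snd p)) \<partial>count_space UNIV)"
    by (subst nn_integral_count_space_indicator) (auto intro!: nn_integral_cong simp: indicator_def)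
  also have "\<dots> = (\<integral>\<^sup>+u. \<integral>\<^sup>+v. (f u * indicator ?U u) * (g v * indicator ?V v) \<partial>count_space UNIV \<partial>count_space UNIV)"
    by (subst nn_integral_fst_count_space[symmetric]) simp
  also have "\<dots> = (\<integral>\<^sup>+u. f u * indicator ?U u \<partial>count_space UNIV) * (\<integral>\<^sup>+v. g v * indicator ?V v \<partial>count_space UNIV)"
    by (simp add: nn_integral_cmult nn_integral_multc)
  finally show ?thesis by (simp add: nn_integral_count_space_indicator)
qed

lemma tiling_weight_nonneg: "(\<And>u. 0 \<le> c u) \<Longrightarrow> 0 \<le> tiling_weight c w"
proof (induction "length w" arbitrary: w rule: less_induct)
  case less
  show ?case
  proof (cases "w = []")
    case False
    then show ?thesis unfolding tiling_weight_eq[OF False]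
      by (intro sum_nonneg mult_nonneg_nonneg less) auto
  qed simp
qed

text \<open>A cut of \<open>u\<close> followed by a cut of \<open>v\<close> is a cut of
  \<open>u @ v\<close>; the terms left out, where a block straddles the border, are nonnegative.
  Thus \<open>- ln\<close> of the weight is subadditive where the weights are positive.\<close>

lemma tiling_weight_append:
  assumes "\<And>u. 0 \<le> c u"
  shows "tiling_weight c u * tiling_weight c v \<le> tiling_weight c (u @ v)"
proof (induction "length u" arbitrary: u rule: less_induct)
  case less
  let ?p = "\<lambda>k. 1 / (real k * real (Suc k))"
  show ?case
  proof (cases "u = []")
    case False
    have "tiling_weight c u * tiling_weight c v =
        (\<Sum>k\<in>{1..length u}. ?p k * c (take k u) * (tiling_weight c (drop k u) * tiling_weight c v))"
      by (simp add: tiling_weight_eq[OF False] sum_distrib_right mult.assoc)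
    also have "\<dots> \<le> (\<Sum>k\<in>{1..length u}. ?p k * c (take k u) * tiling_weight c (drop k u @ v))"
      using False by (intro sum_mono mult_left_mono less) (auto simp: assms)
    also have "\<dots> = (\<Sum>k\<in>{1..length u}. ?p k * c (take k (u @ v)) * tiling_weight c (drop k (u @ v)))"
      by (intro sum.cong) auto
    also have "\<dots> \<le> (\<Sum>k\<in>{1..length (u @ v)}. ?p k * c (take k (u @ v)) * tiling_weight c (drop k (u @ v)))"
      by (intro sum_mono2) (auto simp: assms tiling_weight_nonneg)
    finally show ?thesis using False by (subst tiling_weight_eq[of "u @ v"]) auto
  qed simp
qed

text \<open>The uncut word is among the cuts. Its penalty is polynomial in the length and disappears
  after taking logarithms and dividing by the length.\<close>

lemma tiling_weight_ge:
  assumes "\<And>u. 0 \<le> c u" "w \<noteq> []"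
  shows "1 / (real (length w) * real (Suc (length w))) * c w \<le> tiling_weight c w"
proof -
  let ?f = "\<lambda>k. 1 / (real k * real (Suc k)) * c (take k w) * tiling_weight c (drop k w)"
  have "?f (length w) \<le> sum ?f {1..length w}"
    using assms by (intro member_le_sum) (auto simp: tiling_weight_nonneg Suc_leI)
  then show ?thesis by (simp add: tiling_weight_eq[OF assms(2)])
qed

text \<open>Group the cuts by the length \<open>k\<close> of the first block: each group has mass at
  most the penalty of \<open>k\<close>, because block and remainder have mass at most 1 each. The
  penalties telescope to \<open>1 - 1 / real (Suc n)\<close>.\<close>

lemma nn_integral_tiling_weight_le_1:
  fixes c :: "'i::countable list \<Rightarrow> real"
  assumes c: "\<And>u. 0 \<le> c u" "\<And>k. (\<integral>\<^sup>+u. ennreal (c u) \<partial>count_space {u. length u = k}) \<le> 1"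
  shows "(\<integral>\<^sup>+w. ennreal (tiling_weight c w) \<partial>count_space {w. length w = n}) \<le> 1"
proof (induction n rule: less_induct)
  case (less n)
  let ?p = "\<lambda>k. 1 / (real k * real (Suc k))"
  show ?case
  proof (cases "n = 0")
    case True
    then have "{w::'i list. length w = n} = {[]}" by auto
    then show ?thesis by (simp add: nn_integral_count_space_finite)
  next
    case False
    have "(\<integral>\<^sup>+w. ennreal (tiling_weight c w) \<partial>count_space {w. length w = n}) =
      (\<integral>\<^sup>+w. (\<Sum>k\<in>{1..n}. ennreal (?p k) * (ennreal (c (take k w)) * ennreal (tiling_weight c (drop k w)))) \<partial>count_space {w. length w = n})"
    proof (rule nn_integral_cong)
      fix w :: "'i list" assume "w \<in> space (count_space {w. length w = n})"
      then have w: "length w = n" "w \<noteq> []" using False by auto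
      show "ennreal (tiling_weight c w) = (\<Sum>k\<in>{1..n}. ennreal (?p k) * (ennreal (c (take k w)) * ennreal (tiling_weight c (drop k w))))"
      proof -
        have "0 \<le> ?p k * c (take k w) * tiling_weight c (drop k w)" for k
          by (intro mult_nonneg_nonneg tiling_weight_nonneg c) auto
        then have "ennreal (tiling_weight c w) = (\<Sum>k\<in>{1..n}. ennreal (?p k * c (take k w) * tiling_weight c (drop k w)))"
          unfolding tiling_weight_eq[OF w(2)] w(1) by (subst sum_ennreal) auto
        also have "\<dots> = (\<Sum>k\<in>{1..n}. ennreal (?p k) * (ennreal (c (take k w)) * ennreal (tiling_weight c (drop k w))))"
          by (intro sum.cong refl) (simp only: ennreal_mult[symmetric] c tiling_weight_nonneg mult_nonneg_nonneg
              mult.assoc zero_le_divide_1_iff of_nat_0_le_iff)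
        finally show ?thesis .
      qed
    qed
    also have "\<dots> = (\<Sum>k\<in>{1..n}. ennreal (?p k) * (\<integral>\<^sup>+w. ennreal (c (take k w)) * ennreal (tiling_weight c (drop k w)) \<partial>count_space {w. length w = k + (n - k)}))"
      by (subst nn_integral_sum) (auto simp: nn_integral_cmult intro!: sum.cong)
    also have "\<dots> \<le> (\<Sum>k\<in>{1..n}. ennreal (?p k) * (1 * 1))"
    proof (intro sum_mono mult_left_mono)
      fix k assume k: "k \<in> {1..n}"
      show "(\<integral>\<^sup>+w. ennreal (c (take k w)) * ennreal (tiling_weight c (drop k w)) \<partial>count_space {w. length w = k + (n - k)}) \<le> 1 * 1"
        unfolding nn_integral_words_append[where f = "\<lambda>u. ennreal (c u)" and g = "\<lambda>v. ennreal (tiling_weight c v)"]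
        using k by (intro mult_mono c less) auto
    qed simp
    also have "\<dots> = ennreal (\<Sum>k\<in>{1..n}. ?p k)" by (subst sum_ennreal[symmetric]) auto
    also have "\<dots> \<le> 1" unfolding sum_inverse_products by simp
    finally show ?thesis .
  qed
qed

section \<open>Cylinder masses of a shift-invariant measure and their decay\<close>

locale shift_space = prob_space \<mu> for \<mu> :: "(nat \<Rightarrow> 'i::countable) measure" +
  assumes sets_eq: "sets \<mu> = sets seq_space"
    and shift_invariant: "distr \<mu> \<mu> shift = \<mu>"
begin

lemma space_eq [simp]: "space \<mu> = UNIV"
  using sets_eq_imp_space_eq[OF sets_eq] by (simp add: seq_space_def space_PiM)

lemma coordinate_measurable [measurable]: "(\<lambda>\<omega>. \<omega> k) \<in> \<mu> \<rightarrow>\<^sub>M count_space UNIV"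
  unfolding measurable_cong_sets[OF sets_eq refl] seq_space_def
  by (rule measurable_component_singleton) simp

lemma shift_measurable [measurable]: "shift \<in> \<mu> \<rightarrow>\<^sub>M \<mu>"
proof -
  have "(\<lambda>\<omega> n. \<omega> (Suc n)) \<in> \<mu> \<rightarrow>\<^sub>M (\<Pi>\<^sub>M n\<in>UNIV. count_space UNIV)"
    by (rule measurable_abs_UNIV) measurable
  then show ?thesis
    unfolding measurable_cong_sets[OF refl sets_eq] seq_space_def shift_def[abs_def] .
qed

sublocale prob_mpt \<mu> shift
  by unfold_locales (auto simp: shift_invariant)

lemma cylinder_sets [measurable]: "cylinder w \<in> sets \<mu>"
proof -
  have "{\<omega> \<in> space \<mu>. \<forall>k<length w. \<omega> k = w ! k} \<in> sets \<mu>" by measurable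
  then show ?thesis by (simp add: cylinder_def)
qed

lemma prefix_measurable [measurable]: "(\<lambda>\<omega>. prefix \<omega> n) \<in> \<mu> \<rightarrow>\<^sub>M count_space UNIV"
  unfolding measurable_count_space_eq_countable[OF countableI_type]
proof safe
  fix w :: "'i list"
  show "(\<lambda>\<omega>. prefix \<omega> n) -` {w} \<inter> space \<mu> \<in> sets \<mu>"
  proof (cases "length w = n")
    case True
    then have "(\<lambda>\<omega>. prefix \<omega> n) -` {w} \<inter> space \<mu> = cylinder w" by (auto simp: mem_cylinder_iff)
    then show ?thesis by simp
  next
    case False
    then have "(\<lambda>\<omega>. prefix \<omega> n) -` {w} \<inter> space \<mu> = {}" by auto
    then show ?thesis by (metis sets.empty_sets)
  qed
qed simp

lemma prefix_fibre: "{\<omega>' \<in> space \<mu>. prefix \<omega>' n = prefix \<omega> n} = cylinder (prefix \<omega> n)"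
  by (simp add: set_eq_iff mem_cylinder_iff)

lemma borel_measurable_prefix:
  fixes f :: "'i list \<Rightarrow> 'b::topological_space"
  shows "(\<lambda>\<omega>. f (prefix \<omega> n)) \<in> borel_measurable \<mu>"
  by (rule measurable_compose[OF prefix_measurable]) simp

definition cyl :: "'i list \<Rightarrow> real" where
  "cyl w = measure \<mu> (cylinder w)"

lemma cyl_nonneg: "0 \<le> cyl w" and cyl_le_1: "cyl w \<le> 1"
  by (simp_all add: cyl_def)

text \<open>Null cylinders are included, as \<open>ln 0 = 0\<close>.\<close>

lemma ln_cyl_nonpos: "ln (cyl w) \<le> 0"
  using cyl_nonneg[of w] cyl_le_1[of w] by (cases "cyl w = 0") auto

lemma AE_cyl_prefix_pos: "AE \<omega> in \<mu>. \<forall>n. 0 < cyl (prefix \<omega> n)"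
  unfolding AE_all_countable
proof
  fix n
  show "AE \<omega> in \<mu>. 0 < cyl (prefix \<omega> n)"
    unfolding cyl_def using AE_fibre_pos[OF prefix_measurable, of n] by (simp only: prefix_fibre)
qed

lemma nn_integral_prefix:
  "(\<integral>\<^sup>+\<omega>. f (prefix \<omega> n) \<partial>\<mu>) = (\<integral>\<^sup>+w. f w * ennreal (cyl w) \<partial>count_space {w. length w = n})"
proof -
  have "(\<integral>\<^sup>+\<omega>. f (prefix \<omega> n) \<partial>\<mu>) = (\<integral>\<^sup>+w. f w * emeasure \<mu> {\<omega> \<in> space \<mu>. prefix \<omega> n = w} \<partial>count_space UNIV)"
    by (rule nn_integral_countable_valued) simp
  also have "\<dots> = (\<integral>\<^sup>+w. f w * ennreal (cyl w) * indicator {w. length w = n} w \<partial>count_space UNIV)"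
  proof (rule nn_integral_cong)
    fix w
    show "f w * emeasure \<mu> {\<omega> \<in> space \<mu>. prefix \<omega> n = w} = f w * ennreal (cyl w) * indicator {w. length w = n} w"
    proof (cases "length w = n")
      case True
      then have "{\<omega> \<in> space \<mu>. prefix \<omega> n = w} = cylinder w" by (auto simp: mem_cylinder_iff)
      with True show ?thesis by (simp add: cyl_def emeasure_eq_measure)
    next
      case False
      then have "{\<omega> \<in> space \<mu>. prefix \<omega> n = w} = {}" by auto
      with False show ?thesis by (simp only: emeasure_empty) simp
    qed
  qed
  finally show ?thesis by (simp add: nn_integral_count_space_indicator)
qed

lemma nn_integral_cyl: "(\<integral>\<^sup>+w. ennreal (cyl w) \<partial>count_space {w. length w = n}) = 1"
proof -
  have "(\<integral>\<^sup>+w. ennreal (cyl w) \<partial>count_space {w. length w = n}) =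
      (\<integral>\<^sup>+w. 1 * ennreal (cyl w) \<partial>count_space {w. length w = n})" by (simp only: mult_1)
  also have "\<dots> = (\<integral>\<^sup>+\<omega>. 1 \<partial>\<mu>)" by (rule nn_integral_prefix[symmetric])
  also have "\<dots> = 1" by (simp only: nn_integral_const emeasure_space_1 mult_1)
  finally show ?thesis .
qed

lemma cyl_prefix_antimono: "n \<le> m \<Longrightarrow> cyl (prefix \<omega> m) \<le> cyl (prefix \<omega> n)"
  unfolding cyl_def by (rule finite_measure_mono[OF _ cylinder_sets]) (auto simp: mem_cylinder_prefix)

text \<open>If all \<open>part_entropy \<mu> n\<close> with positive \<open>n\<close> were infinite,
  so would be the limit. One finite value suffices: longer cylinders are smaller, so the information
  of \<open>n\<close> letters dominates that of the first letter.\<close>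

lemma integrable_ln_cyl_1:
  assumes "ks_entropy \<mu> < \<infinity>"
  shows "integrable \<mu> (\<lambda>\<omega>. ln (cyl (prefix \<omega> 1)))"
proof -
  have "\<exists>n\<ge>1. part_entropy \<mu> n \<noteq> \<infinity>"
  proof (rule ccontr)
    assume "\<not> (\<exists>n\<ge>1. part_entropy \<mu> n \<noteq> \<infinity>)"
    then have "part_entropy \<mu> n = top" if "n \<ge> 1" for n using that by auto
    then have "part_entropy \<mu> n / of_nat n = \<infinity>" if "n \<ge> 1" for n
      using that by (simp add: ennreal_top_divide)
    then have "(\<lambda>n. part_entropy \<mu> n / of_nat n) \<longlonglongrightarrow> \<infinity>"
      by (intro tendsto_eventually eventually_sequentiallyI[of 1])
    then have "ks_entropy \<mu> = \<infinity>" unfolding ks_entropy_def by (rule limI)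
    with assms show False by simp
  qed
  then obtain n where n: "n \<ge> 1" "part_entropy \<mu> n < \<infinity>" by (auto simp: less_top)
  let ?L = "\<lambda>\<omega> n. - ln (cyl (prefix \<omega> n))"
  have "(\<integral>\<^sup>+\<omega>. ennreal (?L \<omega> 1) \<partial>\<mu>) \<le> (\<integral>\<^sup>+\<omega>. ennreal (?L \<omega> n) \<partial>\<mu>)"
  proof (rule nn_integral_mono_AE)
    show "AE \<omega> in \<mu>. ennreal (?L \<omega> 1) \<le> ennreal (?L \<omega> n)"
      using AE_cyl_prefix_pos
    proof eventually_elim
      case (elim \<omega>)
      then have "ln (cyl (prefix \<omega> n)) \<le> ln (cyl (prefix \<omega> 1))"
        using cyl_prefix_antimono[OF n(1)] by (intro ln_mono) auto
      then show ?case by (intro ennreal_leI) simp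
    qed
  qed
  also have "\<dots> = (\<integral>\<^sup>+w. ennreal (- ln (cyl w)) * ennreal (cyl w) \<partial>count_space {w. length w = n})"
    by (rule nn_integral_prefix)
  also have "\<dots> = (\<integral>\<^sup>+w. ennreal (- cyl w * ln (cyl w)) * indicator {w. length w = n} w \<partial>count_space UNIV)"
    by (subst nn_integral_count_space_indicator)
      (auto intro!: nn_integral_cong simp: ennreal_mult[symmetric] cyl_nonneg ln_cyl_nonpos mult.commute indicator_def)
  also have "\<dots> \<le> part_entropy \<mu> n"
  proof (rule nn_integral_count_space_le_finite_sums)
    fix F :: "'i list set" assume F: "finite F"
    let ?f = "\<lambda>w. ennreal (- cyl w * ln (cyl w))"
    have "(\<Sum>w\<in>F. ?f w * indicator {w. length w = n} w) = sum ?f (F \<inter> {w. length w = n})"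
      using F by (intro sum.mono_neutral_cong_right) (auto simp: indicator_def)
    also have "\<dots> = infsum ?f (F \<inter> {w. length w = n})" using F by simp
    also have "\<dots> \<le> infsum ?f {w. length w = n}"
      by (intro infsum_mono_neutral nonneg_summable_on_complete) auto
    finally show "(\<Sum>w\<in>F. ?f w * indicator {w. length w = n} w) \<le> part_entropy \<mu> n"
      by (simp add: part_entropy_def cyl_def)
  qed
  finally have fin: "(\<integral>\<^sup>+\<omega>. ennreal (?L \<omega> 1) \<partial>\<mu>) < \<infinity>" using n(2) by (auto simp: less_top)
  have "integrable \<mu> (\<lambda>\<omega>. ?L \<omega> 1)"
  proof (rule integrableI_nonneg)
    show "AE \<omega> in \<mu>. 0 \<le> ?L \<omega> 1" by (simp add: ln_cyl_nonpos)
  qed (use fin in \<open>auto intro: borel_measurable_prefix\<close>)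
  then show ?thesis by simp
qed

text \<open>The subadditive theorem applies to \<open>Y = - ln Q\<close>. The information is at
  least \<open>Y - ln (n * (n + 1))\<close> because of the uncut word. Eventually it is at most
  \<open>Y + 2 * ln (n + 1)\<close>: the weights \<open>Q\<close> of words of one length have sum at
  most 1, so on a typical word \<open>Q\<close> exceeds the cylinder mass by a polynomial factor at
  most.\<close>

theorem AE_convergent_information:
  assumes ent: "ks_entropy \<mu> < \<infinity>"
  shows "AE \<omega> in \<mu>. convergent (\<lambda>n. - ln (cyl (prefix \<omega> n)) / real n)"
proof -
  define Q where "Q = tiling_weight cyl"
  have Q0: "0 \<le> Q w" for w unfolding Q_def by (rule tiling_weight_nonneg) (rule cyl_nonneg)
  have Q_sum: "(\<integral>\<^sup>+w. ennreal (Q w) \<partial>count_space {w. length w = n}) \<le> 1" for n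
    unfolding Q_def by (rule nn_integral_tiling_weight_le_1) (simp_all add: cyl_nonneg nn_integral_cyl)
  \<comment> \<open>Makes \<open>Y\<close> nonnegative, as the subadditive theorem demands.\<close>
  have Q1: "Q w \<le> 1" for w
  proof -
    have "ennreal (Q w) = (\<integral>\<^sup>+u. ennreal (Q u) * indicator {w} u \<partial>count_space UNIV)"
      by (subst nn_integral_count_space'[of "{w}"]) auto
    also have "\<dots> \<le> (\<integral>\<^sup>+u. ennreal (Q u) * indicator {u. length u = length w} u \<partial>count_space UNIV)"
      by (intro nn_integral_mono) (auto simp: indicator_def)
    also have "\<dots> \<le> 1" using Q_sum[of "length w"] by (simp add: nn_integral_count_space_indicator)
    finally show ?thesis by simp
  qed
  have pos: "AE \<omega> in \<mu>. \<forall>i n. 0 < cyl (prefix ((shift ^^ i) \<omega>) n)"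
    by (rule AE_orbit[OF AE_cyl_prefix_pos])
  have Q_ge: "cyl (prefix \<omega> n) / (real n * real (Suc n)) \<le> Q (prefix \<omega> n)" if "n \<ge> 1" for \<omega> n
    using tiling_weight_ge[of cyl "prefix \<omega> n"] that cyl_nonneg unfolding Q_def
    by (simp add: prefix_def)
  have Q_pos: "0 < Q (prefix \<omega> n)" if "0 < cyl (prefix \<omega> n)" for \<omega> n
  proof (cases "n = 0")
    case False
    then have "0 < cyl (prefix \<omega> n) / (real n * real (Suc n))" using that by simp
    also have "\<dots> \<le> Q (prefix \<omega> n)" using False by (intro Q_ge) simp
    finally show ?thesis .
  qed (simp add: Q_def prefix_def)
  define Y where "Y n \<omega> = - ln (Q (prefix \<omega> n))" for n \<omega>
  have "AE \<omega> in \<mu>. convergent (\<lambda>n. Y n \<omega> / real n)"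
  proof (rule subadditive_ergodic_nonneg)
    show "Y n \<in> borel_measurable \<mu>" for n
      unfolding Y_def[abs_def] by (rule borel_measurable_prefix)
    show "0 \<le> Y n \<omega>" for n \<omega>
      unfolding Y_def using Q0[of "prefix \<omega> n"] Q1[of "prefix \<omega> n"]
      by (cases "Q (prefix \<omega> n) = 0") auto
    show "Y 0 \<omega> = 0" for \<omega> by (simp add: Y_def Q_def prefix_def)
    show "AE \<omega> in \<mu>. \<forall>n m. Y (n + m) \<omega> \<le> Y n \<omega> + Y m ((shift ^^ n) \<omega>)"
      using pos
    proof eventually_elim
      case (elim \<omega>)
      show ?case
      proof (intro allI)
        fix n m
        let ?u = "prefix \<omega> n" and ?v = "prefix ((shift ^^ n) \<omega>) m"
        have "0 < Q ?u" "0 < Q ?v" using elim[rule_format, of 0] elim by (auto intro!: Q_pos)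
        moreover have "Q ?u * Q ?v \<le> Q (?u @ ?v)"
          unfolding Q_def by (rule tiling_weight_append) (rule cyl_nonneg)
        ultimately have "ln (Q ?u) + ln (Q ?v) \<le> ln (Q (?u @ ?v))"
          by (metis ln_mult_pos ln_mono mult_pos_pos)
        then show "Y (n + m) \<omega> \<le> Y n \<omega> + Y m ((shift ^^ n) \<omega>)"
          by (simp add: Y_def prefix_add)
      qed
    qed
    have "integrable \<mu> (\<lambda>\<omega>. ln 2 - ln (cyl (prefix \<omega> 1)))"
      using integrable_ln_cyl_1[OF ent] by simp
    then show "integrable \<mu> (Y 1)"
    proof (rule integrable_cong_AE_imp)
      show "AE \<omega> in \<mu>. ln 2 - ln (cyl (prefix \<omega> 1)) = Y 1 \<omega>"
        using AE_cyl_prefix_pos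
      proof eventually_elim
        case (elim \<omega>)
        \<comment> \<open>A one-letter word has a single cut, with penalty 1 / (1 * 2).\<close>
        have "Q (prefix \<omega> 1) = cyl (prefix \<omega> 1) / 2"
          by (subst Q_def, subst tiling_weight_eq) (auto simp: prefix_def)
        then show ?case using elim[rule_format, of 1] by (simp only: Y_def) (simp add: ln_div)
      qed
    qed (simp add: Y_def[abs_def] borel_measurable_prefix)
  qed
  moreover have "AE \<omega> in \<mu>. eventually (\<lambda>n. (if length (prefix \<omega> n) = n then Q (prefix \<omega> n) else 0) / (real (Suc n))\<^sup>2
      \<le> measure \<mu> {\<omega>' \<in> space \<mu>. prefix \<omega>' n = prefix \<omega> n}) sequentially"
  proof (rule AE_eventually_weight_le_fibre)
    show "(\<integral>\<^sup>+w. ennreal (if length w = n then Q w else 0) \<partial>count_space UNIV) \<le> 1" for n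
    proof -
      have "(\<integral>\<^sup>+w. ennreal (if length w = n then Q w else 0) \<partial>count_space UNIV) =
        (\<integral>\<^sup>+w. ennreal (Q w) \<partial>count_space {w. length w = n})"
        by (subst nn_integral_count_space_indicator) (auto intro!: nn_integral_cong simp: indicator_def)
      with Q_sum show ?thesis by simp
    qed
  qed (auto simp: Q0)
  ultimately show ?thesis using AE_cyl_prefix_pos
  proof eventually_elim
    case (elim \<omega>)
    let ?X = "\<lambda>n. - ln (cyl (prefix \<omega> n))"
    obtain l where l: "(\<lambda>n. Y n \<omega> / real n) \<longlonglongrightarrow> l" using elim(1) by (auto simp: convergent_def)
    have "(\<lambda>n. ?X n / real n) \<longlonglongrightarrow> l"
    proof (rule tendsto_sandwich)
      have "(\<lambda>n. Y n \<omega> / real n - ln (real n * real (Suc n)) / real n) \<longlonglongrightarrow> l - 0"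
        by (intro tendsto_diff l) real_asymp
      then show "(\<lambda>n. Y n \<omega> / real n - ln (real n * real (Suc n)) / real n) \<longlonglongrightarrow> l" by simp
      have "(\<lambda>n. Y n \<omega> / real n + 2 * ln (real (Suc n)) / real n) \<longlonglongrightarrow> l + 0"
        by (intro tendsto_add l) real_asymp
      then show "(\<lambda>n. Y n \<omega> / real n + 2 * ln (real (Suc n)) / real n) \<longlonglongrightarrow> l" by simp
      show "eventually (\<lambda>n. Y n \<omega> / real n - ln (real n * real (Suc n)) / real n \<le> ?X n / real n) sequentially"
        using eventually_ge_at_top[of 1]
      proof eventually_elim
        case (elim n)
        have c: "0 < cyl (prefix \<omega> n)" using \<open>\<forall>n. 0 < cyl (prefix \<omega> n)\<close> by blast
        have "ln (cyl (prefix \<omega> n) / (real n * real (Suc n))) \<le> ln (Q (prefix \<omega> n))"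
          using Q_ge[OF elim] c elim by (intro ln_mono) auto
        then have "Y n \<omega> - ln (real n * real (Suc n)) \<le> ?X n"
          using c elim by (simp add: Y_def ln_div)
        from divide_right_mono[OF this, of "real n"] show ?case by (simp add: diff_divide_distrib)
      qed
      show "eventually (\<lambda>n. ?X n / real n \<le> Y n \<omega> / real n + 2 * ln (real (Suc n)) / real n) sequentially"
        using elim(2)
      proof eventually_elim
        case (elim n)
        have c: "0 < cyl (prefix \<omega> n)" using \<open>\<forall>n. 0 < cyl (prefix \<omega> n)\<close> by blast
        have "Q (prefix \<omega> n) / (real (Suc n))\<^sup>2 \<le> cyl (prefix \<omega> n)"
          using elim by (simp only: prefix_fibre cyl_def length_prefix simp_thms if_True)
        then have "ln (Q (prefix \<omega> n) / (real (Suc n))\<^sup>2) \<le> ln (cyl (prefix \<omega> n))"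
          using Q_pos[OF c] by (intro ln_mono) auto
        then have "?X n \<le> Y n \<omega> + 2 * ln (real (Suc n))"
          using Q_pos[OF c] by (simp add: Y_def ln_div ln_realpow)
        from divide_right_mono[OF this, of "real n"] show ?case by (simp add: add_divide_distrib)
      qed
    qed
    then show ?case by (rule convergentI)
  qed
qed

end

section \<open>Coding map and covering of cylinders\<close>

lemma word_mat_Nil [simp]: "word_mat A [] = mat 1"
  and word_mat_Cons [simp]: "word_mat A (i # w) = A i ** word_mat A w"
  by (simp_all add: word_mat_def)

lemma word_map_Nil [simp]: "word_map A a [] x = x"
  and word_map_Cons [simp]: "word_map A a (i # w) x = affmap A a i (word_map A a w x)"
  by (simp_all add: word_map_def)

lemma word_mat_append: "word_mat A (u @ v) = word_mat A u ** word_mat A v"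
  by (induction u) (simp_all add: matrix_mul_assoc)

lemma word_map_append: "word_map A a (u @ v) x = word_map A a u (word_map A a v x)"
  by (induction u) simp_all

lemma word_map_affine: "word_map A a w x = word_mat A w *v x + word_map A a w 0"
proof (induction w)
  case (Cons i w)
  then have "word_map A a (i # w) x = A i *v (word_mat A w *v x + word_map A a w 0) + a i"
    by (simp add: affmap_def)
  then show ?case by (simp add: affmap_def matrix_vector_right_distrib matrix_vector_mul_assoc)
qed simp

text \<open>The radii \<open>K * exp (- \<tau> * real n)\<close> have constant ratio, so every small
  ball contains one of them whose index is - ln r / \<tau> up to a bounded error. That error
  disappears on division by ln r.\<close>

lemma upper_loc_dim_le:
  fixes \<nu> :: "'a::metric_space measure"
  assumes \<nu>: "finite_measure \<nu>" "sets \<nu> = sets borel" and \<tau>: "0 < \<tau>" and K: "0 < K"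
    and b: "eventually (\<lambda>n. exp (- b n) \<le> measure \<nu> (cball x (K * exp (- \<tau> * real n)))) sequentially"
    and lim: "(\<lambda>n. b n / real n) \<longlonglongrightarrow> L" and L: "0 \<le> L"
  shows "upper_loc_dim \<nu> x \<le> ereal (L / \<tau>)"
proof (rule ereal_le_epsilon2)
  fix e :: real assume e: "0 < e"
  define u where "u = L / \<tau> + e"
  define L' where "L' = L + \<tau> * e / 2"
  have L': "L < L'" "0 < L'" using \<tau> e L by (simp_all add: L'_def add_nonneg_pos)
  have gap: "u - L' / \<tau> = e / 2" using \<tau> by (simp add: u_def L'_def field_simps)
  have "eventually (\<lambda>n. b n / real n < L') sequentially"
    using lim L' by (intro order_tendstoD) auto
  then have "eventually (\<lambda>n. exp (- (L' * real n)) \<le> measure \<nu> (cball x (K * exp (- \<tau> * real n)))) sequentially"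
    using b eventually_gt_at_top[of 0]
  proof eventually_elim
    case (elim n)
    then have "b n \<le> L' * real n" by (simp add: field_simps)
    then have "exp (- (L' * real n)) \<le> exp (- b n)" by simp
    then show ?case using elim(2) by linarith
  qed
  then obtain n0 where n0: "\<And>n. n \<ge> n0 \<Longrightarrow> exp (- (L' * real n)) \<le> measure \<nu> (cball x (K * exp (- \<tau> * real n)))"
    unfolding eventually_sequentially by blast
  \<comment> \<open>Three lower bounds for - ln r: the 1 makes ln r negative, the second takes the
    index past \<open>n0\<close>, and the third lets half of \<open>e\<close> absorb the bounded
    error of the index.\<close>
  define Y where "Y = max 1 (max (\<tau> * real n0 - ln K) (L' * (\<bar>ln K\<bar> / \<tau> + 2) * 2 / e))"
  have "eventually (\<lambda>r. r < exp (- Y)) (at_right 0)"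
    by (rule eventually_at_right_less[THEN eventually_mono, of "0", THEN eventually_rev_mp])
      (auto simp: eventually_at_right_field intro!: exI[of _ "exp (- Y)"])
  moreover have "eventually (\<lambda>r::real. 0 < r) (at_right 0)" by (rule eventually_at_right_less)
  ultimately have "eventually (\<lambda>r. ereal (ln (measure \<nu> (ball x r)) / ln r) \<le> ereal u) (at_right 0)"
  proof eventually_elim
    case (elim r)
    define y where "y = - ln r"
    have "ln r < ln (exp (- Y))" using elim by (subst ln_less_cancel_iff) auto
    then have "Y < y" by (simp add: y_def)
    then have y: "1 < y" "\<tau> * real n0 - ln K < y" "L' * (\<bar>ln K\<bar> / \<tau> + 2) * 2 / e < y"
      by (simp_all add: Y_def)
    define z where "z = (ln K + y) / \<tau>"
    \<comment> \<open>The added 1 makes \<open>z < real n\<close> strict, which places the closed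
      ball inside the open one.\<close>
    define n where "n = nat \<lceil>z\<rceil> + 1"
    have z: "real n0 < z" using y(2) \<tau> by (simp add: z_def field_simps)
    then have z0: "0 < z" using of_nat_0_le_iff[of n0] by linarith
    have n_gt: "z < real n" and n_le: "real n \<le> z + 2" unfolding n_def using z0 by linarith+
    have "K * exp (- \<tau> * real n) < r"
    proof -
      have "ln K + y < \<tau> * real n" using n_gt \<tau> by (simp add: z_def field_simps)
      then have "ln (K * exp (- \<tau> * real n)) < ln r" using K by (simp add: ln_mult y_def)
      then show ?thesis using K elim by (subst (asm) ln_less_cancel_iff) auto
    qed
    then have "cball x (K * exp (- \<tau> * real n)) \<subseteq> ball x r" by auto
    then have "measure \<nu> (cball x (K * exp (- \<tau> * real n))) \<le> measure \<nu> (ball x r)"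
      using \<nu> by (intro finite_measure.finite_measure_mono) auto
    moreover have "n0 \<le> n" using z n_gt by linarith
    ultimately have "exp (- (L' * real n)) \<le> measure \<nu> (ball x r)" using n0[of n] by linarith
    then have "ln (exp (- (L' * real n))) \<le> ln (measure \<nu> (ball x r))" by (intro ln_mono) auto
    then have "- (L' * real n) \<le> ln (measure \<nu> (ball x r))" by simp
    moreover have "L' * real n \<le> u * y"
    proof -
      have "z + 2 \<le> y / \<tau> + (\<bar>ln K\<bar> / \<tau> + 2)"
        using divide_right_mono[OF abs_ge_self[of "ln K"], of \<tau>] \<tau> by (simp add: z_def add_divide_distrib)
      then have "L' * real n \<le> L' * (y / \<tau> + (\<bar>ln K\<bar> / \<tau> + 2))"
        using n_le L' by (intro mult_left_mono) auto
      also have "\<dots> = L' / \<tau> * y + L' * (\<bar>ln K\<bar> / \<tau> + 2)" by (simp add: algebra_simps)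
      also have "\<dots> \<le> L' / \<tau> * y + e / 2 * y" using y(3) e by (simp add: field_simps)
      also have "\<dots> = u * y"
      proof -
        have "u = L' / \<tau> + e / 2" using gap by simp
        then show ?thesis by (simp only: distrib_right)
      qed
      finally show ?thesis .
    qed
    ultimately have "u * ln r \<le> ln (measure \<nu> (ball x r))" by (simp add: y_def)
    moreover have "ln r < 0" using y(1) by (simp add: y_def)
    ultimately show ?case by (simp add: divide_le_eq)
  qed
  then have "upper_loc_dim \<nu> x \<le> ereal u" unfolding upper_loc_dim_def by (rule Limsup_bounded)
  then show "upper_loc_dim \<nu> x \<le> ereal (L / \<tau>) + ereal e" by (simp add: u_def)
qed

section \<open>The coding map of a contracting affine system\<close>

locale affine_ifs =
  fixes A :: "'i \<Rightarrow> real^'n^'n" and a :: "'i \<Rightarrow> real^'n" and c B :: real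
  assumes c: "0 < c" "c < 1" and contraction: "\<And>i. onorm ((*v) (A i)) \<le> c"
    and translation: "\<And>i. norm (a i) \<le> B"
begin

lemma norm_mat_le: "norm (A i *v x) \<le> c * norm x"
proof -
  have "norm (A i *v x) \<le> onorm ((*v) (A i)) * norm x"
    by (rule onorm) (rule matrix_vector_mul_bounded_linear)
  also have "\<dots> \<le> c * norm x" by (intro mult_right_mono contraction) simp
  finally show ?thesis .
qed

lemma norm_word_mat_le: "norm (word_mat A w *v x) \<le> c ^ length w * norm x"
proof (induction w)
  case (Cons i w)
  have "norm (word_mat A (i # w) *v x) \<le> c * norm (word_mat A w *v x)"
    using norm_mat_le[of i "word_mat A w *v x"] by (simp add: matrix_vector_mul_assoc)
  also have "\<dots> \<le> c * (c ^ length w * norm x)" using c by (intro mult_left_mono Cons) auto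
  finally show ?case by (simp add: mult.assoc)
qed simp

lemma onorm_word_mat_le: "onorm ((*v) (word_mat A w)) \<le> c ^ length w"
  by (rule onorm_le) (rule norm_word_mat_le)

definition R :: real where "R = inv_radius A a"

lemma R: "0 < R" "affmap A a i ` cball 0 R \<subseteq> cball 0 R"
proof -
  have "0 \<le> B" using translation[of undefined] norm_ge_zero order_trans by blast
  \<comment> \<open>The fixed point of r \<mapsto> c r + B, plus 1 to be positive also for
    \<open>B = 0\<close>. It witnesses that the \<open>SOME\<close> in \<open>inv_radius\<close> can
    be satisfied; \<open>R\<close> itself may be another invariant radius.\<close>
  let ?R = "B / (1 - c) + 1"
  have "0 < ?R" using c \<open>0 \<le> B\<close> by (simp add: add_nonneg_pos)
  moreover have "affmap A a i ` cball 0 ?R \<subseteq> cball 0 ?R" for i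
  proof clarsimp
    fix x :: "real^'n" assume x: "norm x \<le> ?R"
    have "norm (affmap A a i x) \<le> c * norm x + B"
      unfolding affmap_def by (intro norm_triangle_le add_mono norm_mat_le translation)
    also have "\<dots> \<le> c * ?R + B" using x c by (intro add_mono mult_left_mono) auto
    also have "\<dots> \<le> ?R"
    proof -
      define b where "b = B / (1 - c)"
      have "B = (1 - c) * b" using c by (simp add: b_def)
      then show ?thesis unfolding b_def[symmetric] using c by (simp add: algebra_simps)
    qed
    finally show "norm (affmap A a i x) \<le> ?R" .
  qed
  ultimately have "\<exists>R. 0 < R \<and> (\<forall>i. affmap A a i ` cball 0 R \<subseteq> cball 0 R)" by blast
  from someI_ex[OF this] show "0 < R" "affmap A a i ` cball 0 R \<subseteq> cball 0 R"
    unfolding R_def inv_radius_def by blast+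
qed

lemma word_map_cball: "x \<in> cball 0 R \<Longrightarrow> word_map A a w x \<in> cball 0 R"
proof (induction w)
  case (Cons i w)
  then have "affmap A a i (word_map A a w x) \<in> affmap A a i ` cball 0 R" by blast
  with R(2)[of i] show ?case by (auto simp del: mem_cball)
qed simp

lemma dist_word_map_le:
  assumes "x \<in> cball 0 R" "y \<in> cball 0 R"
  shows "dist (word_map A a w x) (word_map A a w y) \<le> c ^ length w * (2 * R)"
proof -
  have "dist (word_map A a w x) (word_map A a w y) = norm (word_mat A w *v (x - y))"
    by (subst (1 2) word_map_affine) (simp add: dist_norm matrix_vector_mult_diff_distrib)
  also have "\<dots> \<le> c ^ length w * norm (x - y)" by (rule norm_word_mat_le)
  also have "\<dots> \<le> c ^ length w * (2 * R)"
    using assms c norm_triangle_ineq4[of x y] by (intro mult_left_mono) auto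
  finally show ?thesis .
qed

text \<open>Shows that the \<open>THE\<close> in \<open>coding\<close> picks an actual point: the
  images of the ball are nested compact sets of diameter at most
  \<open>c ^ n * (2 * R)\<close>.\<close>

lemma coding_mem: "coding A a \<omega> \<in> word_map A a (prefix \<omega> n) ` cball 0 R"
proof -
  let ?K = "\<lambda>n. word_map A a (prefix \<omega> n) ` cball 0 R"
  have "(\<Inter>n. ?K n) \<noteq> {}"
  proof (rule compact_nest)
    show "compact (?K n)" for n
    proof (rule compact_continuous_image)
      have "continuous_on (cball 0 R) (\<lambda>x. word_mat A (prefix \<omega> n) *v x + word_map A a (prefix \<omega> n) 0)"
        by (intro continuous_intros linear_continuous_on matrix_vector_mul_bounded_linear)
      then show "continuous_on (cball 0 R) (word_map A a (prefix \<omega> n))"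
        by (subst (asm) word_map_affine[symmetric])
    qed simp
    show "?K n \<noteq> {}" for n using R(1) by simp
    show "?K m \<subseteq> ?K n" if "n \<le> m" for n m
    proof -
      have "prefix \<omega> m = prefix \<omega> n @ prefix ((shift ^^ n) \<omega>) (m - n)"
        using prefix_add[of \<omega> n "m - n"] that by simp
      then show ?thesis using word_map_cball by (auto simp: word_map_append simp del: mem_cball)
    qed
  qed
  then obtain x where x: "x \<in> (\<Inter>n. ?K n)" by blast
  have uniq: "y = x" if y: "y \<in> (\<Inter>n. ?K n)" for y
  proof -
    have "dist y x \<le> c ^ n * (2 * R)" for n
    proof -
      obtain x' y' where "x' \<in> cball 0 R" "x = word_map A a (prefix \<omega> n) x'"
        "y' \<in> cball 0 R" "y = word_map A a (prefix \<omega> n) y'"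
        using x y by blast
      with dist_word_map_le[of y' x' "prefix \<omega> n"] show ?thesis by simp
    qed
    moreover have "(\<lambda>n. c ^ n * (2 * R)) \<longlonglongrightarrow> 0 * (2 * R)"
      using c by (intro tendsto_intros LIMSEQ_realpow_zero) auto
    ultimately have "dist y x \<le> 0 * (2 * R)" by (intro LIMSEQ_le_const) auto
    then show ?thesis by simp
  qed
  have "coding A a \<omega> = x"
    unfolding coding_def R_def[symmetric] by (rule the_equality, rule x, rule uniq)
  with x show ?thesis by blast
qed

text \<open>Exhibits the coding map as a pointwise limit of functions of finitely many letters,
  which makes it measurable.\<close>

lemma word_map_0_tendsto_coding: "(\<lambda>n. word_map A a (prefix \<omega> n) 0) \<longlonglongrightarrow> coding A a \<omega>"
proof (rule tendsto_dist_iff[THEN iffD2], rule tendsto_sandwich[of "\<lambda>_. 0" _ _ "\<lambda>n. c ^ n * (2 * R)"])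
  show "eventually (\<lambda>n. dist (word_map A a (prefix \<omega> n) 0) (coding A a \<omega>) \<le> c ^ n * (2 * R)) sequentially"
  proof (rule always_eventually, rule allI)
    fix n
    obtain x where "x \<in> cball 0 R" "coding A a \<omega> = word_map A a (prefix \<omega> n) x"
      using coding_mem[of \<omega> n] by blast
    with dist_word_map_le[of 0 x "prefix \<omega> n"] R(1)
    show "dist (word_map A a (prefix \<omega> n) 0) (coding A a \<omega>) \<le> c ^ n * (2 * R)" by simp
  qed
  have "(\<lambda>n. c ^ n * (2 * R)) \<longlonglongrightarrow> 0 * (2 * R)"
    using c by (intro tendsto_intros LIMSEQ_realpow_zero) auto
  then show "(\<lambda>n. c ^ n * (2 * R)) \<longlonglongrightarrow> 0" by simp
qed auto

end

section \<open>Covering numbers along orbits and the mass of small balls\<close>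

locale affine_measure = shift_space \<mu> + affine_ifs A a c B
  for \<mu> :: "(nat \<Rightarrow> 'i::countable) measure" and A :: "'i \<Rightarrow> real^'n^'n" and a c B
begin

lemma coding_measurable [measurable]: "coding A a \<in> borel_measurable \<mu>"
  by (rule borel_measurable_LIMSEQ_metric[OF _ word_map_0_tendsto_coding])
    (rule borel_measurable_prefix)

text \<open>The radius is tied to the word length, so that radii multiply under concatenation. This
  makes the logarithm subadditive without an error term.\<close>

definition cov :: "real \<Rightarrow> 'i list \<Rightarrow> nat" where
  "cov \<tau> w = covnum (mat_ball (word_mat A w)) (exp (- \<tau> * real (length w)))"

lemma cov_ge_1: "1 \<le> cov \<tau> w"
  unfolding cov_def by (rule covnum_pos[OF compact_mat_ball]) auto

lemma cov_append: "cov \<tau> (u @ v) \<le> cov \<tau> u * cov \<tau> v"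
proof -
  have "- \<tau> * real (length (u @ v)) = - \<tau> * real (length u) + - \<tau> * real (length v)"
    by (simp add: distrib_left)
  then show ?thesis
    unfolding cov_def word_mat_append by (simp only: exp_add) (rule covnum_mat_mult; simp)
qed

lemma AE_convergent_cov: "AE \<omega> in \<mu>. convergent (\<lambda>n. ln (real (cov \<tau> (prefix \<omega> n))) / real n)"
proof (rule subadditive_ergodic_nonneg)
  show "(\<lambda>\<omega>. ln (real (cov \<tau> (prefix \<omega> n)))) \<in> borel_measurable \<mu>" for n
    by (rule borel_measurable_prefix)
  show "0 \<le> ln (real (cov \<tau> (prefix \<omega> n)))" for n \<omega>
    using cov_ge_1[of \<tau> "prefix \<omega> n"] by (intro ln_ge_zero) simp
  \<comment> \<open>For the empty word the matrix is the identity and the radius is 1, so one ball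
    suffices.\<close>
  show "ln (real (cov \<tau> (prefix \<omega> 0))) = 0" for \<omega>
  proof -
    have "cov \<tau> (prefix \<omega> 0) \<le> card {0::real^'n}"
      unfolding cov_def by (rule covnum_le) (auto simp: prefix_def)
    then have "cov \<tau> (prefix \<omega> 0) = 1" using cov_ge_1[of \<tau> "prefix \<omega> 0"] by simp
    then show ?thesis by simp
  qed
  show "AE \<omega> in \<mu>. \<forall>n m. ln (real (cov \<tau> (prefix \<omega> (n + m)))) \<le>
      ln (real (cov \<tau> (prefix \<omega> n))) + ln (real (cov \<tau> (prefix ((shift ^^ n) \<omega>) m)))"
  proof (intro AE_I2 allI)
    fix \<omega> :: "nat \<Rightarrow> 'i" and n m
    let ?u = "prefix \<omega> n" and ?v = "prefix ((shift ^^ n) \<omega>) m"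
    have pos: "0 < real (cov \<tau> w)" for w using cov_ge_1[of \<tau> w] by simp
    have "ln (real (cov \<tau> (?u @ ?v))) \<le> ln (real (cov \<tau> ?u) * real (cov \<tau> ?v))"
      using cov_append[of \<tau> ?u ?v] pos by (intro ln_mono) (auto simp flip: of_nat_mult)
    also have "\<dots> = ln (real (cov \<tau> ?u)) + ln (real (cov \<tau> ?v))" using pos by (simp add: ln_mult_pos)
    finally show "ln (real (cov \<tau> (prefix \<omega> (n + m)))) \<le> ln (real (cov \<tau> ?u)) + ln (real (cov \<tau> ?v))"
      by (simp add: prefix_add)
  qed
  show "integrable \<mu> (\<lambda>\<omega>. ln (real (cov \<tau> (prefix \<omega> 1))))"
  \<comment> \<open>Contractions map the unit ball into itself, so its own covering number at radius
    exp (- \<tau>) bounds all one-letter values, however small the singular values are.\<close>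
  proof (rule integrable_const_bound[where B = "ln (real (covnum (cball (0::real^'n) 1) (exp (- \<tau>))))"])
    show "AE \<omega> in \<mu>. norm (ln (real (cov \<tau> (prefix \<omega> 1)))) \<le> ln (real (covnum (cball (0::real^'n) 1) (exp (- \<tau>))))"
    proof (rule AE_I2)
      fix \<omega> :: "nat \<Rightarrow> 'i"
      have "mat_ball (word_mat A (prefix \<omega> 1)) \<subseteq> cball 0 1"
      proof clarsimp
        fix x :: "real^'n" assume "norm x \<le> 1"
        have "c * norm x \<le> 1 * 1" using c \<open>norm x \<le> 1\<close> by (intro mult_mono) auto
        then show "norm (word_mat A (prefix \<omega> (Suc 0)) *v x) \<le> 1"
          using norm_word_mat_le[of "prefix \<omega> (Suc 0)" x] by simp
      qed
      then have "cov \<tau> (prefix \<omega> 1) \<le> covnum (cball (0::real^'n) 1) (exp (- \<tau>))"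
        unfolding cov_def using covnum_mono[OF compact_cball exp_gt_zero, of "mat_ball (word_mat A (prefix \<omega> 1))" 0 1 "- \<tau>"]
        by simp
      then show "norm (ln (real (cov \<tau> (prefix \<omega> 1)))) \<le> ln (real (covnum (cball (0::real^'n) 1) (exp (- \<tau>))))"
        using cov_ge_1[of \<tau> "prefix \<omega> 1"] by simp
    qed
  qed (rule borel_measurable_prefix)
qed

text \<open>Split each cylinder by the covering ball that the coded point hits, and give each of the
  \<open>cov\<close> pieces the weight \<open>cyl / cov\<close>. For fixed \<open>n\<close> these
  weights sum to 1, so the Borel-Cantelli lemma for fibres applies. Points of one piece are coded
  within two radii of each other.\<close>

lemma AE_eventually_ball_measure_ge:
  "AE \<omega> in \<mu>. eventually (\<lambda>n. cyl (prefix \<omega> n) / real (cov \<tau> (prefix \<omega> n)) / (real (Suc n))\<^sup>2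
     \<le> measure (distr \<mu> borel (coding A a)) (cball (coding A a \<omega>) (2 * R * exp (- \<tau> * real n)))) sequentially"
proof -
  have "\<exists>ctr. mat_ball (word_mat A w) \<subseteq> (\<Union>j<cov \<tau> w. cball (ctr j) (exp (- \<tau> * real (length w))))" for w
  proof -
    obtain C where C: "finite C" "card C = cov \<tau> w"
      "mat_ball (word_mat A w) \<subseteq> (\<Union>c\<in>C. cball c (exp (- \<tau> * real (length w))))"
      using covnum_cover[OF compact_mat_ball, of "exp (- \<tau> * real (length w))" "word_mat A w"]
      unfolding cov_def by auto
    obtain ctr where "bij_betw ctr {0..<card C} C" using ex_bij_betw_nat_finite[OF C(1)] by blast
    then have "C = ctr ` {..<cov \<tau> w}" using C(2) by (simp add: bij_betw_def lessThan_atLeast0)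
    with C(3) show ?thesis by auto
  qed
  then obtain ctr where ctr: "\<And>w. mat_ball (word_mat A w) \<subseteq> (\<Union>j<cov \<tau> w. cball (ctr w j) (exp (- \<tau> * real (length w))))"
    by metis
  \<comment> \<open>A cover of the image of the unit ball, scaled by \<open>R\<close> and moved by
    the translation part, covers the image of \<open>cball 0 R\<close>.\<close>
  define P where "P w x j \<longleftrightarrow> dist (R *\<^sub>R ctr w j + word_map A a w 0) x \<le> R * exp (- \<tau> * real (length w))"
    for w x j
  have P_ex: "\<exists>j<cov \<tau> (prefix \<omega> n). P (prefix \<omega> n) (coding A a \<omega>) j" for \<omega> n
  proof -
    let ?w = "prefix \<omega> n"
    obtain z where "z \<in> cball 0 R" "coding A a \<omega> = word_map A a ?w z"
      using coding_mem[of \<omega> n] by blast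
    then have z: "norm z \<le> R" "coding A a \<omega> = word_mat A ?w *v z + word_map A a ?w 0"
      using word_map_affine[of A a ?w z] by auto
    have "z /\<^sub>R R \<in> cball 0 1" using z(1) R(1) by (simp add: field_simps)
    then obtain j where j: "j < cov \<tau> ?w" "dist (ctr ?w j) (word_mat A ?w *v (z /\<^sub>R R)) \<le> exp (- \<tau> * real n)"
      using ctr[of ?w] by fastforce
    have "coding A a \<omega> = R *\<^sub>R (word_mat A ?w *v (z /\<^sub>R R)) + word_map A a ?w 0"
      using R(1) z(2) by (simp add: matrix_vector_mult_scaleR)
    then have "dist (R *\<^sub>R ctr ?w j + word_map A a ?w 0) (coding A a \<omega>) = R * dist (ctr ?w j) (word_mat A ?w *v (z /\<^sub>R R))"
      using R(1) by (simp add: dist_norm scaleR_diff_right[symmetric] del: scaleR_diff_right)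
    also have "\<dots> \<le> R * exp (- \<tau> * real n)" using R(1) j(2) by (intro mult_left_mono) auto
    finally show ?thesis using j(1) unfolding P_def by auto
  qed
  \<comment> \<open>Taking the least index makes the pieces disjoint and the choice
    measurable.\<close>
  define idx where "idx \<omega> n = (LEAST j. P (prefix \<omega> n) (coding A a \<omega>) j)" for \<omega> n
  have idx: "P (prefix \<omega> n) (coding A a \<omega>) (idx \<omega> n)" "idx \<omega> n < cov \<tau> (prefix \<omega> n)" for \<omega> n
    using P_ex[of \<omega> n] unfolding idx_def by (auto intro: LeastI Least_le[THEN le_less_trans])
  define \<Phi> where "\<Phi> n \<omega> = (prefix \<omega> n, idx \<omega> n)" for n \<omega>
  define q where "q n p = (if length (fst p) = n \<and> snd p < cov \<tau> (fst p) then cyl (fst p) / real (cov \<tau> (fst p)) else 0)"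
    for n :: nat and p :: "'i list \<times> nat"
  have \<Phi>_meas: "\<Phi> n \<in> \<mu> \<rightarrow>\<^sub>M count_space UNIV" for n
  proof -
    have "(\<lambda>\<omega>. (\<lambda>w \<omega>. (w, LEAST j. P w (coding A a \<omega>) j)) (prefix \<omega> n) \<omega>) \<in> \<mu> \<rightarrow>\<^sub>M count_space UNIV"
    proof (rule measurable_compose_countable[OF _ prefix_measurable])
      fix w
      have "(\<lambda>\<omega>. LEAST j. P w (coding A a \<omega>) j) \<in> \<mu> \<rightarrow>\<^sub>M count_space UNIV"
        unfolding P_def by measurable
      then show "(\<lambda>\<omega>. (w, LEAST j. P w (coding A a \<omega>) j)) \<in> \<mu> \<rightarrow>\<^sub>M count_space UNIV"
        by (rule measurable_compose) simp
    qed
    then show ?thesis by (simp add: \<Phi>_def[abs_def] idx_def)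
  qed
  have "AE \<omega> in \<mu>. eventually (\<lambda>n. q n (\<Phi> n \<omega>) / (real (Suc n))\<^sup>2 \<le>
      measure \<mu> {\<omega>' \<in> space \<mu>. \<Phi> n \<omega>' = \<Phi> n \<omega>}) sequentially"
  proof (rule AE_eventually_weight_le_fibre[OF \<Phi>_meas])
    show "0 \<le> q n p" for n p by (simp add: q_def cyl_nonneg)
    show "(\<integral>\<^sup>+p. ennreal (q n p) \<partial>count_space UNIV) \<le> 1" for n
    proof -
      have "(\<integral>\<^sup>+p. ennreal (q n p) \<partial>count_space UNIV) =
          (\<integral>\<^sup>+w. \<integral>\<^sup>+j. ennreal (q n (w, j)) \<partial>count_space UNIV \<partial>count_space UNIV)"
        by (rule nn_integral_fst_count_space[symmetric])
      also have "\<dots> = (\<integral>\<^sup>+w. ennreal (cyl w) * indicator {w. length w = n} w \<partial>count_space UNIV)"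
      proof (rule nn_integral_cong)
        fix w :: "'i list"
        have "(\<integral>\<^sup>+j. ennreal (q n (w, j)) \<partial>count_space UNIV) = (\<Sum>j<cov \<tau> w. ennreal (q n (w, j)))"
          by (rule nn_integral_count_space') (auto simp: q_def)
        also have "\<dots> = ennreal (\<Sum>j<cov \<tau> w. q n (w, j))"
          by (rule sum_ennreal) (simp add: q_def cyl_nonneg)
        also have "\<dots> = ennreal (cyl w) * indicator {w. length w = n} w"
          using cov_ge_1[of \<tau> w] by (simp add: q_def indicator_def)
        finally show "(\<integral>\<^sup>+j. ennreal (q n (w, j)) \<partial>count_space UNIV) = ennreal (cyl w) * indicator {w. length w = n} w" .
      qed
      also have "\<dots> = 1" using nn_integral_cyl[of n] by (simp add: nn_integral_count_space_indicator)
      finally show ?thesis by simp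
    qed
  qed
  then show ?thesis
  proof eventually_elim
    case (elim \<omega>)
    then show ?case
    proof eventually_elim
      case (elim n)
      let ?B = "cball (coding A a \<omega>) (2 * R * exp (- \<tau> * real n))"
      have "{\<omega>' \<in> space \<mu>. \<Phi> n \<omega>' = \<Phi> n \<omega>} \<subseteq> coding A a -` ?B \<inter> space \<mu>"
      proof clarsimp
        fix \<omega>' assume "\<Phi> n \<omega>' = \<Phi> n \<omega>"
        then have "prefix \<omega>' n = prefix \<omega> n" "idx \<omega>' n = idx \<omega> n" by (auto simp: \<Phi>_def)
        with idx(1)[of \<omega> n] idx(1)[of \<omega>' n]
        have *: "dist (R *\<^sub>R ctr (prefix \<omega> n) (idx \<omega> n) + word_map A a (prefix \<omega> n) 0) (coding A a \<omega>) \<le> R * exp (- \<tau> * real n)"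
          "dist (R *\<^sub>R ctr (prefix \<omega> n) (idx \<omega> n) + word_map A a (prefix \<omega> n) 0) (coding A a \<omega>') \<le> R * exp (- \<tau> * real n)"
          by (simp_all add: P_def)
        show "dist (coding A a \<omega>) (coding A a \<omega>') \<le> 2 * R * exp (- (\<tau> * real n))"
          using order_trans[OF dist_triangle3 add_mono[OF *]] by simp
      qed
      then have "measure \<mu> {\<omega>' \<in> space \<mu>. \<Phi> n \<omega>' = \<Phi> n \<omega>} \<le> measure \<mu> (coding A a -` ?B \<inter> space \<mu>)"
        by (intro finite_measure_mono measurable_sets[OF coding_measurable]) auto
      also have "\<dots> = measure (distr \<mu> borel (coding A a)) ?B"
        by (rule measure_distr[symmetric]) auto
      finally show ?case using elim idx(2)[of \<omega> n] by (simp add: q_def \<Phi>_def)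
    qed
  qed
qed

lemma AE_upper_loc_dim_le:
  assumes ent: "ks_entropy \<mu> < \<infinity>" and \<tau>: "0 < \<tau>"
  shows "AE \<omega> in \<mu>. \<exists>h G. 0 \<le> h \<and> loc_entropy \<mu> \<omega> = ereal h \<and>
     (\<lambda>n. ln (real (cov \<tau> (prefix \<omega> n))) / real n) \<longlonglongrightarrow> G \<and>
     upper_loc_dim (distr \<mu> borel (coding A a)) (coding A a \<omega>) \<le> ereal ((h + G) / \<tau>)"
  using AE_convergent_information[OF ent] AE_convergent_cov[of \<tau>] AE_eventually_ball_measure_ge[of \<tau>]
    AE_cyl_prefix_pos
proof eventually_elim
  case (elim \<omega>)
  let ?X = "\<lambda>n. - ln (cyl (prefix \<omega> n))" and ?N = "\<lambda>n. ln (real (cov \<tau> (prefix \<omega> n)))"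
  obtain h where h: "(\<lambda>n. ?X n / real n) \<longlonglongrightarrow> h" using elim(1) by (auto simp: convergent_def)
  obtain G where G: "(\<lambda>n. ?N n / real n) \<longlonglongrightarrow> G" using elim(2) by (auto simp: convergent_def)
  have h0: "0 \<le> h" by (rule LIMSEQ_le_const[OF h]) (auto simp: divide_nonpos_nonneg ln_cyl_nonpos)
  have N0: "0 \<le> ?N n" for n
    using cov_ge_1[of \<tau> "prefix \<omega> n"] by (intro ln_ge_zero) simp
  have G0: "0 \<le> G" by (rule LIMSEQ_le_const[OF G]) (use N0 in auto)
  have "(\<lambda>n. ereal (?X n / real n)) \<longlonglongrightarrow> ereal h" using h by simp
  then have "loc_entropy \<mu> \<omega> = ereal h" unfolding loc_entropy_def cyl_def[symmetric] by (rule limI)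
  moreover have "upper_loc_dim (distr \<mu> borel (coding A a)) (coding A a \<omega>) \<le> ereal ((h + G) / \<tau>)"
  proof (rule upper_loc_dim_le[OF _ _ \<tau>, where K = "2 * R" and b = "\<lambda>n. ?X n + ?N n + 2 * ln (real (Suc n))"])
    show "finite_measure (distr \<mu> borel (coding A a))"
      by (intro prob_space.finite_measure prob_space_distr) simp
    show "eventually (\<lambda>n. exp (- (?X n + ?N n + 2 * ln (real (Suc n)))) \<le>
        measure (distr \<mu> borel (coding A a)) (cball (coding A a \<omega>) (2 * R * exp (- \<tau> * real n)))) sequentially"
      using elim(3)
    proof eventually_elim
      case (elim n)
      have "0 < cyl (prefix \<omega> n)" using \<open>\<forall>n. 0 < cyl (prefix \<omega> n)\<close> by blast
      moreover have "0 < real (cov \<tau> (prefix \<omega> n))" using cov_ge_1[of \<tau> "prefix \<omega> n"] by simp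
      moreover have "exp (2 * ln (real (Suc n))) = (real (Suc n))\<^sup>2"
        by (subst exp_double) simp
      moreover have "- (?X n + ?N n + 2 * ln (real (Suc n))) = ln (cyl (prefix \<omega> n)) - ?N n - 2 * ln (real (Suc n))"
        by simp
      ultimately have "exp (- (?X n + ?N n + 2 * ln (real (Suc n)))) =
          cyl (prefix \<omega> n) / real (cov \<tau> (prefix \<omega> n)) / (real (Suc n))\<^sup>2"
        by (simp only: exp_diff exp_ln)
      with elim show ?case by simp
    qed
    have "(\<lambda>n. ?X n / real n + ?N n / real n + 2 * ln (real (Suc n)) / real n) \<longlonglongrightarrow> h + G + 0"
      by (intro tendsto_add h G) real_asymp
    then show "(\<lambda>n. (?X n + ?N n + 2 * ln (real (Suc n))) / real n) \<longlonglongrightarrow> h + G"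
      by (simp add: add_divide_distrib diff_divide_distrib)
  qed (use R h0 G0 in auto)
  ultimately show ?case using h0 G by blast
qed

end

section \<open>Lyapunov exponents and the dimension estimate\<close>

lemma le_limit_of_frequently:
  fixes X :: "nat \<Rightarrow> real"
  assumes "X \<longlonglongrightarrow> D" "\<exists>\<^sub>F n in sequentially. C \<le> X n"
  shows "C \<le> D"
proof (rule ccontr)
  assume "\<not> C \<le> D"
  then have "eventually (\<lambda>n. X n < C) sequentially"
    using assms(1) by (intro order_tendstoD) auto
  with assms(2) show False by (simp add: frequently_def not_le)
qed

lemma limit_le_of_frequently:
  fixes X :: "nat \<Rightarrow> real"
  assumes "X \<longlonglongrightarrow> D" "\<exists>\<^sub>F n in sequentially. X n \<le> C"
  shows "D \<le> C"
  using le_limit_of_frequently[OF tendsto_minus[OF assms(1)], of "- C"] assms(2) by simp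

text \<open>The slope of \<open>t \<mapsto> \<Sum>l. max (b l + t) 0\<close> counts the entries above \<open>- t\<close>, so the limits of these
  sums determine the limits of the sorted entries.\<close>

lemma sorted_convergent_of_truncated_sums:
  fixes b :: "nat \<Rightarrow> nat \<Rightarrow> real"
  assumes sorted: "\<And>n i j. 1 \<le> i \<Longrightarrow> i \<le> j \<Longrightarrow> j \<le> d \<Longrightarrow> b n j \<le> b n i"
    and nonpos: "\<And>n l. l \<in> {1..d} \<Longrightarrow> b n l \<le> 0"
    and conv: "\<And>t. t \<in> \<rat> \<Longrightarrow> 0 < t \<Longrightarrow> convergent (\<lambda>n. \<Sum>l\<in>{1..d}. max (b n l + t) 0)"
    and l: "l \<in> {1..d}"
  shows "\<exists>L. (\<lambda>n. ereal (b n l)) \<longlonglongrightarrow> L"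
proof -
  let ?x = "\<lambda>n. ereal (b n l)"
  have "liminf ?x = limsup ?x"
  proof (rule ccontr)
    assume "liminf ?x \<noteq> limsup ?x"
    moreover have "liminf ?x \<le> limsup ?x" by (rule Liminf_le_Limsup) simp
    ultimately have less: "liminf ?x < limsup ?x" by simp
    obtain p :: rat where p: "liminf ?x < ereal (real_of_rat p)" "ereal (real_of_rat p) < limsup ?x"
      using ereal_dense3[OF less] by blast
    obtain q :: rat where q: "ereal (real_of_rat p) < ereal (real_of_rat q)" "ereal (real_of_rat q) < limsup ?x"
      using ereal_dense3[OF p(2)] by blast
    \<comment> \<open>Nonpositivity puts the gap between \<open>p\<close> and \<open>q\<close> to
      the left of 0, so that the shifts \<open>s\<close> and \<open>t\<close> are positive and
      \<open>conv\<close> applies.\<close>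
    have "limsup ?x \<le> ereal 0"
      using nonpos[OF l] by (intro Limsup_bounded always_eventually) simp
    with q(2) have "real_of_rat q < 0" by (meson less_le_trans less_ereal.simps(1))
    define s where "s = - real_of_rat q"
    define t where "t = - real_of_rat p"
    have st: "0 < s" "s < t" "s \<in> \<rat>" "t \<in> \<rat>"
      using q(1) \<open>real_of_rat q < 0\<close> by (auto simp: s_def t_def)
    define S where "S t n = (\<Sum>l\<in>{1..d}. max (b n l + t) 0)" for t n
    obtain Ls Lt where lim: "S s \<longlonglongrightarrow> Ls" "S t \<longlonglongrightarrow> Lt"
      using conv[of s] conv[of t] st unfolding S_def convergent_def by auto
    have D: "(\<lambda>n. S t n - S s n) \<longlonglongrightarrow> Lt - Ls" by (intro tendsto_diff lim)
    \<comment> \<open>An entry below \<open>- t\<close> contributes nothing to the increment, an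
      entry above \<open>- s\<close> contributes \<open>t - s\<close>. Infinitely often the l-th
      entry is low, leaving at most l - 1 contributions; infinitely often it is high, giving at
      least l full ones. A convergent increment cannot do both.\<close>
    have diff: "S t n - S s n = (\<Sum>m\<in>{1..d}. max (b n m + t) 0 - max (b n m + s) 0)" for n
      unfolding S_def by (simp add: sum_subtractf)
    have "\<exists>\<^sub>F n in sequentially. b n l < - t"
    proof (rule ccontr)
      assume "\<not> (\<exists>\<^sub>F n in sequentially. b n l < - t)"
      then have "eventually (\<lambda>n. ereal (- t) \<le> ?x n) sequentially" by (simp add: not_frequently not_less)
      then have "ereal (- t) \<le> liminf ?x" by (rule Liminf_bounded)
      with p(1) show False by (simp add: t_def)
    qed
    then have "\<exists>\<^sub>F n in sequentially. S t n - S s n \<le> real (l - 1) * (t - s)"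
    proof (rule frequently_elim1)
      fix n assume n: "b n l < - t"
      have "S t n - S s n \<le> (\<Sum>m\<in>{1..d}. if m < l then t - s else 0)"
        unfolding diff
      proof (rule sum_mono)
        fix m assume m: "m \<in> {1..d}"
        show "max (b n m + t) 0 - max (b n m + s) 0 \<le> (if m < l then t - s else 0)"
        proof (cases "m < l")
          case False
          then have "b n m \<le> b n l" using sorted[of l m n] m l by simp
          then show ?thesis using n st False by simp
        qed (use st in auto)
      qed
      also have "\<dots> = (\<Sum>m\<in>{1..<l}. t - s)"
        using l by (intro sum.mono_neutral_cong_right) auto
      finally show "S t n - S s n \<le> real (l - 1) * (t - s)" by simp
    qed
    with D have upper: "Lt - Ls \<le> real (l - 1) * (t - s)" by (rule limit_le_of_frequently)
    have "\<exists>\<^sub>F n in sequentially. - s < b n l"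
    proof (rule ccontr)
      assume "\<not> (\<exists>\<^sub>F n in sequentially. - s < b n l)"
      then have "eventually (\<lambda>n. ?x n \<le> ereal (- s)) sequentially" by (simp add: not_frequently not_less)
      then have "limsup ?x \<le> ereal (- s)" by (rule Limsup_bounded)
      with q(2) show False by (simp add: s_def)
    qed
    then have "\<exists>\<^sub>F n in sequentially. real l * (t - s) \<le> S t n - S s n"
    proof (rule frequently_elim1)
      fix n assume n: "- s < b n l"
      have "real l * (t - s) = (\<Sum>m\<in>{1..l}. t - s)" by simp
      also have "\<dots> = (\<Sum>m\<in>{1..d}. if m \<le> l then t - s else 0)"
        using l by (intro sum.mono_neutral_cong_left) auto
      also have "\<dots> \<le> S t n - S s n"
        unfolding diff
      proof (rule sum_mono)
        fix m assume m: "m \<in> {1..d}"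
        show "(if m \<le> l then t - s else 0) \<le> max (b n m + t) 0 - max (b n m + s) 0"
        proof (cases "m \<le> l")
          case True
          then have "b n l \<le> b n m" using sorted[of m l n] m l by simp
          then show ?thesis using n st True by simp
        qed (use st in auto)
      qed
      finally show "real l * (t - s) \<le> S t n - S s n" .
    qed
    with D have "real l * (t - s) \<le> Lt - Ls" by (rule le_limit_of_frequently)
    with upper have "real l * (t - s) \<le> real (l - 1) * (t - s)" by linarith
    then have "real l \<le> real (l - 1)" using st by simp
    with l show False by auto
  qed
  then have "?x \<longlonglongrightarrow> limsup ?x" by (intro Liminf_eq_Limsup) auto
  then show ?thesis by blast
qed

text \<open>The exponent of the l-th singular value in the singular value function. It turns
  \<Lambda> into a weighted sum of exponents whose dependence on \<open>s\<close> sits in the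
  weights alone.\<close>

definition sv_weight :: "nat \<Rightarrow> real \<Rightarrow> nat \<Rightarrow> real" where
  "sv_weight d s l = (if s < real d then
     (if l \<le> nat \<lfloor>s\<rfloor> then 1 else if l = nat \<lfloor>s\<rfloor> + 1 then s - of_int \<lfloor>s\<rfloor> else 0) else s / real d)"

lemma sv_weight_nonneg: "0 \<le> s \<Longrightarrow> 0 \<le> sv_weight d s l"
  by (simp add: sv_weight_def)

text \<open>Passing an integer fills a weight up to 1, and beyond \<open>d\<close> all weights equal
  s / d, which is at least 1; so there is no drop where the formula changes.\<close>

lemma sv_weight_mono:
  assumes "0 \<le> s" "s \<le> t" "l \<in> {1..d}"
  shows "sv_weight d s l \<le> sv_weight d t l"
proof (cases "t < real d")
  case True
  have fl: "\<lfloor>s\<rfloor> \<le> \<lfloor>t\<rfloor>" using assms by (intro floor_mono)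
  show ?thesis
  proof (cases "\<lfloor>s\<rfloor> = \<lfloor>t\<rfloor>")
    case True
    then show ?thesis using assms \<open>t < real d\<close> by (simp add: sv_weight_def)
  next
    case False
    then have "nat \<lfloor>s\<rfloor> + 1 \<le> nat \<lfloor>t\<rfloor>" using fl assms(1) by linarith
    moreover have "s - of_int \<lfloor>s\<rfloor> \<le> 1" by linarith
    ultimately show ?thesis using assms \<open>t < real d\<close> by (auto simp: sv_weight_def)
  qed
next
  case False
  have "s - of_int \<lfloor>s\<rfloor> \<le> 1" by linarith
  moreover have "1 \<le> t / real d" using False assms(3) by (simp add: le_divide_eq)
  moreover have "s / real d \<le> t / real d" using assms by (simp add: divide_right_mono)
  ultimately show ?thesis using False by (auto simp: sv_weight_def)
qed

lemma sum_sv_weight: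
  assumes "0 \<le> s" "s < real d"
  shows "(\<Sum>l\<in>{1..d}. sv_weight d s l * f l) = (\<Sum>l\<in>{1..nat \<lfloor>s\<rfloor>}. f l) + (s - of_int \<lfloor>s\<rfloor>) * f (nat \<lfloor>s\<rfloor> + 1)"
proof -
  let ?k = "nat \<lfloor>s\<rfloor>"
  have k: "?k < d" using assms by linarith
  have "(\<Sum>l\<in>{1..d}. sv_weight d s l * f l) = (\<Sum>l\<in>{1..?k + 1}. sv_weight d s l * f l)"
    using k assms by (intro sum.mono_neutral_right) (auto simp: sv_weight_def)
  also have "\<dots> = (\<Sum>l\<in>{1..?k}. sv_weight d s l * f l) + sv_weight d s (?k + 1) * f (?k + 1)" by simp
  also have "(\<Sum>l\<in>{1..?k}. sv_weight d s l * f l) = (\<Sum>l\<in>{1..?k}. f l)"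
    using assms by (intro sum.cong) (auto simp: sv_weight_def)
  finally show ?thesis using assms by (simp add: sv_weight_def)
qed

lemma ln_sv_function:
  fixes M :: "real^'n^'n"
  assumes M: "invertible M" and s: "0 \<le> s"
  shows "ln (sv_function s M) = (\<Sum>l\<in>{1..CARD('n)}. sv_weight CARD('n) s l * ln (sing_val M l))"
proof (cases "s < real CARD('n)")
  case True
  let ?k = "nat \<lfloor>s\<rfloor>"
  have k: "?k < CARD('n)" using s True by linarith
  have pos: "0 < sing_val M l" if "l \<in> {1..?k + 1}" for l
    using sing_val_pos[OF M, of l] that k by simp
  have "ln (sv_function s M) = ln (\<Prod>l\<in>{1..?k}. sing_val M l) + ln (sing_val M (?k + 1) powr (s - of_int \<lfloor>s\<rfloor>))"
  proof -
    have "0 < (\<Prod>l\<in>{1..?k}. sing_val M l)" using pos by (intro prod_pos) auto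
    moreover have "0 < sing_val M (?k + 1) powr (s - of_int \<lfloor>s\<rfloor>)" using pos[of "?k + 1"] by simp
    ultimately show ?thesis unfolding sv_function_def using True by (simp only: if_True ln_mult_pos)
  qed
  also have "ln (\<Prod>l\<in>{1..?k}. sing_val M l) = (\<Sum>l\<in>{1..?k}. ln (sing_val M l))"
  proof (rule ln_prod)
    show "sing_val M l \<noteq> 0" if "l \<in> {1..?k}" for l using pos[of l] that by simp
  qed simp
  finally show ?thesis unfolding sum_sv_weight[OF s True] using pos[of "?k + 1"] by (simp add: ln_powr)
next
  case False
  have pos: "0 < sing_val M l" if "l \<in> {1..CARD('n)}" for l by (rule sing_val_pos[OF M that])
  have "ln (sv_function s M) = s / real CARD('n) * ln (\<Prod>l\<in>{1..CARD('n)}. sing_val M l)"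
    unfolding sv_function_def using False prod_pos[of "{1..CARD('n)}" "sing_val M"] pos by (simp add: ln_powr)
  also have "ln (\<Prod>l\<in>{1..CARD('n)}. sing_val M l) = (\<Sum>l\<in>{1..CARD('n)}. ln (sing_val M l))"
  proof (rule ln_prod)
    show "sing_val M l \<noteq> 0" if "l \<in> {1..CARD('n)}" for l using pos[OF that] by simp
  qed simp
  finally show ?thesis using False by (simp add: sv_weight_def sum_distrib_left)
qed

text \<open>Logarithms of the two grid estimates. The factor \<open>5 * CARD('n)\<close> dominates
  both \<open>2 * CARD('n) + 3\<close> and \<open>3 * CARD('n)\<close>. The error is independent of
  \<open>M\<close> and \<open>t\<close>, hence negligible after division by the word length.\<close>

lemma ln_covnum_approx:
  fixes M :: "real^'n^'n"
  assumes M: "invertible M" and t: "0 < t"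
  shows "\<bar>ln (real (covnum (mat_ball M) t)) - (\<Sum>l\<in>{1..CARD('n)}. max (ln (sing_val M l) - ln t) 0)\<bar>
    \<le> real CARD('n) * ln (real (5 * CARD('n)))"
proof -
  let ?d = "CARD('n)" and ?I = "{1..CARD('n)}"
  let ?m = "\<lambda>l. max (sing_val M l / t) 1"
  have d: "1 \<le> ?d" by (simp add: Suc_leI)
  have m: "1 \<le> ?m l" for l by simp
  have "ln (?m l) = max (ln (sing_val M l) - ln t) 0" if "l \<in> ?I" for l
  proof -
    have s: "0 < sing_val M l" by (rule sing_val_pos[OF M that])
    show ?thesis
    proof (cases "sing_val M l / t \<le> 1")
      case True
      then have "ln (sing_val M l / t) \<le> 0" using s t by (simp add: ln_le_zero_iff)
      with True s t show ?thesis by (simp add: ln_div max_def)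
    next
      case False
      then have "0 < ln (sing_val M l / t)" by (intro ln_gt_zero) simp
      with False s t show ?thesis by (simp add: ln_div max_def)
    qed
  qed
  then have S: "(\<Sum>l\<in>?I. max (ln (sing_val M l) - ln t) 0) = (\<Sum>l\<in>?I. ln (?m l))"
    by (intro sum.cong) auto
  have N: "1 \<le> covnum (mat_ball M) t" by (rule covnum_pos[OF compact_mat_ball t]) simp
  have "ln (real (covnum (mat_ball M) t)) \<le> ln (\<Prod>l\<in>?I. real (2 * ?d + 3) * ?m l)"
    using N covnum_mat_ball_le[OF t, of M] by (intro ln_mono) auto
  also have "\<dots> = (\<Sum>l\<in>?I. ln (real (2 * ?d + 3) * ?m l))"
    by (rule ln_prod) (use m in \<open>auto intro!: mult_pos_pos\<close>)
  also have "\<dots> \<le> (\<Sum>l\<in>?I. ln (real (5 * ?d)) + ln (?m l))"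
  proof (rule sum_mono)
    fix l
    have "0 < ?m l" using m[of l] by linarith
    then have "ln (real (2 * ?d + 3) * ?m l) = ln (real (2 * ?d + 3)) + ln (?m l)" by (simp add: ln_mult_pos)
    moreover have "ln (real (2 * ?d + 3)) \<le> ln (real (5 * ?d))" using d by (intro ln_mono) (auto simp del: of_nat_add of_nat_mult)
    ultimately show "ln (real (2 * ?d + 3) * ?m l) \<le> ln (real (5 * ?d)) + ln (?m l)" by linarith
  qed
  also have "\<dots> = real ?d * ln (real (5 * ?d)) + (\<Sum>l\<in>?I. ln (?m l))" by (simp add: sum.distrib)
  finally have upper: "ln (real (covnum (mat_ball M) t)) \<le> real ?d * ln (real (5 * ?d)) + (\<Sum>l\<in>?I. ln (?m l))" .
  have pos: "0 < ?m l / (3 * real ?d)" for l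
  proof -
    have "0 < ?m l" using m[of l] by linarith
    then show ?thesis by (intro divide_pos_pos) auto
  qed
  have "(\<Sum>l\<in>?I. ln (?m l)) - real ?d * ln (real (5 * ?d)) = (\<Sum>l\<in>?I. ln (?m l) - ln (real (5 * ?d)))"
    by (simp add: sum_subtractf)
  also have "\<dots> \<le> (\<Sum>l\<in>?I. ln (?m l / (3 * real ?d)))"
  proof (rule sum_mono)
    fix l
    have "0 < ?m l" using m[of l] by linarith
    then have "ln (?m l / (3 * real ?d)) = ln (?m l) - ln (3 * real ?d)" by (simp add: ln_div)
    moreover have "ln (3 * real ?d) \<le> ln (real (5 * ?d))" by (intro ln_mono) auto
    ultimately show "ln (?m l) - ln (real (5 * ?d)) \<le> ln (?m l / (3 * real ?d))" by linarith
  qed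
  also have "\<dots> = ln (\<Prod>l\<in>?I. ?m l / (3 * real ?d))" by (rule ln_prod[symmetric]) (use pos in auto)
  also have "\<dots> \<le> ln (real (covnum (mat_ball M) t))"
    using le_covnum_mat_ball[OF t, of M] prod_pos[of ?I "\<lambda>l. ?m l / (3 * real ?d)"] pos by (intro ln_mono) auto
  finally show ?thesis using upper unfolding S by linarith
qed

section \<open>Finite-level exponents and the estimate at a single point\<close>

context affine_measure
begin

definition exponent :: "(nat \<Rightarrow> 'i) \<Rightarrow> nat \<Rightarrow> nat \<Rightarrow> real" where
  "exponent \<omega> n l = ln (sing_val (word_mat A (prefix \<omega> n)) l) / real n"

context
  assumes inv: "\<And>i. invertible (A i)"
begin

lemma invertible_word_mat: "invertible (word_mat A w)"
proof (induction w)
  case Nil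
  show ?case by (auto simp: invertible_def intro!: exI[of _ "mat 1"])
next
  case (Cons i w)
  then show ?case by (simp add: inv invertible_mult)
qed

lemma exponent_antimono: "1 \<le> i \<Longrightarrow> i \<le> j \<Longrightarrow> j \<le> CARD('n) \<Longrightarrow> exponent \<omega> n j \<le> exponent \<omega> n i"
  unfolding exponent_def
  by (intro divide_right_mono ln_mono sing_val_antimono sing_val_pos[OF invertible_word_mat]) auto

text \<open>The bound is uniform and strictly negative because \<open>c < 1\<close>; it keeps the
  scale \<open>\<tau>0\<close> of the final estimate positive.\<close>

lemma exponent_le:
  assumes l: "l \<in> {1..CARD('n)}" and n: "0 < n"
  shows "exponent \<omega> n l \<le> ln c"
proof -
  let ?M = "word_mat A (prefix \<omega> n)"
  have "sing_val ?M l \<le> c ^ n"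
    using sing_val_le_onorm[OF l, of ?M] onorm_word_mat_le[of "prefix \<omega> n"] by simp
  then have "ln (sing_val ?M l) \<le> ln (c ^ n)"
    using sing_val_pos[OF invertible_word_mat l] by (intro ln_mono) auto
  also have "\<dots> = real n * ln c" using c by (simp add: ln_realpow)
  finally show ?thesis using n by (simp add: exponent_def divide_le_eq mult.commute)
qed

lemma exponent_nonpos:
  assumes "l \<in> {1..CARD('n)}"
  shows "exponent \<omega> n l \<le> 0"
proof (cases "n = 0")
  case False
  then have "exponent \<omega> n l \<le> ln c" by (intro exponent_le assms) simp
  also have "\<dots> \<le> 0" using c by simp
  finally show ?thesis .
qed (simp add: exponent_def)

lemma truncated_exponents_tendsto:
  assumes "(\<lambda>n. ln (real (cov \<tau> (prefix \<omega> n))) / real n) \<longlonglongrightarrow> G"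
  shows "(\<lambda>n. \<Sum>l\<in>{1..CARD('n)}. max (exponent \<omega> n l + \<tau>) 0) \<longlonglongrightarrow> G"
proof -
  let ?d = "CARD('n)"
  let ?S = "\<lambda>n. \<Sum>l\<in>{1..?d}. max (exponent \<omega> n l + \<tau>) 0"
  let ?C = "real ?d * ln (real (5 * ?d))"
  have "(\<lambda>n. ?S n - ln (real (cov \<tau> (prefix \<omega> n))) / real n) \<longlonglongrightarrow> 0"
  proof (rule Lim_null_comparison)
    show "eventually (\<lambda>n. norm (?S n - ln (real (cov \<tau> (prefix \<omega> n))) / real n) \<le> ?C / real n) sequentially"
      using eventually_gt_at_top[of 0]
    proof eventually_elim
      case (elim n)
      let ?M = "word_mat A (prefix \<omega> n)"
      have "(\<Sum>l\<in>{1..?d}. max (ln (sing_val ?M l) - ln (exp (- \<tau> * real n))) 0) = real n * ?S n"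
        unfolding sum_distrib_left
      proof (rule sum.cong)
        fix l
        have "ln (sing_val ?M l) - ln (exp (- \<tau> * real n)) = real n * (exponent \<omega> n l + \<tau>)"
          using elim by (simp add: exponent_def algebra_simps)
        then show "max (ln (sing_val ?M l) - ln (exp (- \<tau> * real n))) 0 = real n * max (exponent \<omega> n l + \<tau>) 0"
          by (simp only:) (simp add: max_def zero_le_mult_iff mult_le_0_iff)
      qed simp
      then have "\<bar>ln (real (cov \<tau> (prefix \<omega> n))) - real n * ?S n\<bar> \<le> ?C"
        using ln_covnum_approx[OF invertible_word_mat, of "exp (- \<tau> * real n)" "prefix \<omega> n"] by (simp add: cov_def)
      then have "\<bar>real n * ?S n - ln (real (cov \<tau> (prefix \<omega> n)))\<bar> / real n \<le> ?C / real n"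
        by (intro divide_right_mono) (simp_all add: abs_minus_commute)
      moreover have "\<bar>?S n - ln (real (cov \<tau> (prefix \<omega> n))) / real n\<bar> = \<bar>real n * ?S n - ln (real (cov \<tau> (prefix \<omega> n)))\<bar> / real n"
      proof -
        have "?S n - ln (real (cov \<tau> (prefix \<omega> n))) / real n = (real n * ?S n - ln (real (cov \<tau> (prefix \<omega> n)))) / real n"
          using elim by (simp add: diff_divide_distrib)
        then show ?thesis using elim by (simp only:) simp
      qed
      ultimately show ?case by (simp only: real_norm_def)
    qed
    show "(\<lambda>n. ?C / real n) \<longlonglongrightarrow> 0" by (rule lim_const_over_n)
  qed
  from tendsto_add[OF this assms] show ?thesis by simp
qed

lemma lyap_seq_eq:
  assumes "0 \<le> s"
  shows "ln (sv_function s (word_mat A (prefix \<omega> n))) / real n =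
    (\<Sum>l\<in>{1..CARD('n)}. sv_weight CARD('n) s l * exponent \<omega> n l)"
  unfolding ln_sv_function[OF invertible_word_mat assms] by (simp add: exponent_def sum_divide_distrib)

text \<open>Convergence is asked only where the weight is nonzero, since exponents of higher index
  may tend to -\<infinity>.\<close>

lemma lyap_eq_sum:
  assumes s: "0 \<le> s"
    and x: "\<And>l. l \<in> {1..CARD('n)} \<Longrightarrow> sv_weight CARD('n) s l \<noteq> 0 \<Longrightarrow> (\<lambda>n. exponent \<omega> n l) \<longlonglongrightarrow> x l"
  shows "lyap A s \<omega> = ereal (\<Sum>l\<in>{1..CARD('n)}. sv_weight CARD('n) s l * x l)"
proof -
  have "(\<lambda>n. \<Sum>l\<in>{1..CARD('n)}. sv_weight CARD('n) s l * exponent \<omega> n l) \<longlonglongrightarrow>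
      (\<Sum>l\<in>{1..CARD('n)}. sv_weight CARD('n) s l * x l)"
  proof (rule tendsto_sum)
    fix l assume l: "l \<in> {1..CARD('n)}"
    show "(\<lambda>n. sv_weight CARD('n) s l * exponent \<omega> n l) \<longlonglongrightarrow> sv_weight CARD('n) s l * x l"
      using x[OF l] by (cases "sv_weight CARD('n) s l = 0") (auto intro: tendsto_mult_left)
  qed
  then show ?thesis unfolding lyap_def lyap_seq_eq[OF s] by (intro limI) simp
qed

text \<open>All terms are nonpositive, so nothing compensates one that tends to -\<infinity>. Read
  backwards, \<Lambda>(s) > -\<infinity> forces every exponent with nonzero weight at
  \<open>s\<close> to be finite.\<close>

lemma lyap_eq_MInfty:
  assumes s: "0 \<le> s" and l: "l \<in> {1..CARD('n)}" "sv_weight CARD('n) s l \<noteq> 0"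
    and lim: "(\<lambda>n. ereal (exponent \<omega> n l)) \<longlonglongrightarrow> -\<infinity>"
  shows "lyap A s \<omega> = -\<infinity>"
proof -
  let ?w = "sv_weight CARD('n) s"
  have w: "0 < ?w l" using sv_weight_nonneg[OF s, of "CARD('n)" l] l by simp
  have "(\<lambda>n. ereal (\<Sum>l\<in>{1..CARD('n)}. ?w l * exponent \<omega> n l)) \<longlonglongrightarrow> -\<infinity>"
    unfolding tendsto_MInfty
  proof
    fix r :: real
    have "eventually (\<lambda>n. ereal (exponent \<omega> n l) < ereal (r / ?w l)) sequentially"
      using lim unfolding tendsto_MInfty by blast
    then show "eventually (\<lambda>n. ereal (\<Sum>l\<in>{1..CARD('n)}. ?w l * exponent \<omega> n l) < ereal r) sequentially"
    proof eventually_elim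
      case (elim n)
      have "(\<Sum>l\<in>{1..CARD('n)}. ?w l * exponent \<omega> n l) = ?w l * exponent \<omega> n l + (\<Sum>l\<in>{1..CARD('n)} - {l}. ?w l * exponent \<omega> n l)"
        using l by (intro sum.remove) auto
      also have "\<dots> \<le> ?w l * exponent \<omega> n l + 0"
        by (intro add_left_mono sum_nonpos mult_nonneg_nonpos sv_weight_nonneg[OF s] exponent_nonpos) auto
      also have "\<dots> < r" using elim w by (simp add: field_simps)
      finally show ?case by simp
    qed
  qed
  then show ?thesis unfolding lyap_def lyap_seq_eq[OF s] by (rule limI)
qed

text \<open>A deterministic statement about one sequence \<open>\<omega>\<close>, to be used with
  the upper local dimension as \<open>U\<close>; the almost sure facts enter as hypotheses.\<close>

lemma upper_loc_dim_le_dim_LY: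
  fixes U :: ereal
  assumes bound: "\<And>\<tau>. \<tau> \<in> \<rat> \<Longrightarrow> 0 < \<tau> \<Longrightarrow> \<exists>G. (\<lambda>n. ln (real (cov \<tau> (prefix \<omega> n))) / real n) \<longlonglongrightarrow> G \<and> U \<le> ereal ((h + G) / \<tau>)"
    and h: "loc_entropy \<mu> \<omega> = ereal h"
    and s0: "dim_LY \<mu> A \<omega> < ereal s0" "-\<infinity> < lyap A s0 \<omega>"
  shows "U \<le> min (ereal (real CARD('n))) (dim_LY \<mu> A \<omega>)"
proof -
  let ?d = "CARD('n)"
  let ?I = "{1..CARD('n)}"
  let ?D = "dim_LY \<mu> A \<omega>"
  let ?S = "\<lambda>\<tau> n. \<Sum>l\<in>?I. max (exponent \<omega> n l + \<tau>) 0"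
  have bound': "\<exists>G. ?S \<tau> \<longlonglongrightarrow> G \<and> U \<le> ereal ((h + G) / \<tau>)" if "\<tau> \<in> \<rat>" "0 < \<tau>" for \<tau>
    using bound[OF that] truncated_exponents_tendsto by blast
  \<comment> \<open>Exponents are nonpositive, so G is at most d \<tau> and the quotient at most d +
    h / \<tau>.\<close>
  have U_d: "U \<le> ereal (real ?d)"
  proof (rule ereal_le_epsilon2)
    fix e :: real assume e: "0 < e"
    obtain m :: nat where m: "max 1 (h / e) < real m" using reals_Archimedean2 by blast
    define \<tau> where "\<tau> = real m"
    have \<tau>: "\<tau> \<in> \<rat>" "max 1 (h / e) < \<tau>" using m by (simp_all add: \<tau>_def)
    then have \<tau>0: "0 < \<tau>" by linarith
    obtain G where G: "?S \<tau> \<longlonglongrightarrow> G" "U \<le> ereal ((h + G) / \<tau>)" using bound'[OF \<tau>(1) \<tau>0] by blast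
    have "G \<le> real ?d * \<tau>"
    proof (rule LIMSEQ_le_const2[OF G(1)], intro exI allI impI)
      fix n
      have "?S \<tau> n \<le> (\<Sum>l\<in>?I. \<tau>)"
        by (rule sum_mono) (use exponent_nonpos \<tau>0 in \<open>auto simp: max_def\<close>)
      then show "?S \<tau> n \<le> real ?d * \<tau>" by simp
    qed
    moreover have "h \<le> e * \<tau>" using \<tau> e by (simp add: field_simps)
    ultimately have "(h + G) / \<tau> \<le> real ?d + e" using \<tau>0 by (simp add: divide_le_eq algebra_simps)
    then show "U \<le> ereal (real ?d) + ereal e" using G(2) by (metis ereal_less_eq(3) order_trans plus_ereal.simps(1))
  qed
  have "0 \<le> ?D" unfolding dim_LY_def by (rule Inf_greatest) auto
  have "U \<le> ?D"
  proof (cases "?D < ereal (real ?d)")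
    case False
    then show ?thesis using U_d by (meson not_less order_trans)
  next
    case True
    have "\<exists>L. (\<lambda>n. ereal (exponent \<omega> n l)) \<longlonglongrightarrow> L" if "l \<in> ?I" for l
    proof (rule sorted_convergent_of_truncated_sums[OF exponent_antimono exponent_nonpos _ that])
      show "convergent (?S \<tau>)" if "\<tau> \<in> \<rat>" "0 < \<tau>" for \<tau>
        using bound'[OF that] by (auto simp: convergent_def)
    qed
    then obtain L where L: "\<And>l. l \<in> ?I \<Longrightarrow> (\<lambda>n. ereal (exponent \<omega> n l)) \<longlonglongrightarrow> L l" by metis
    define x where "x l = real_of_ereal (L l)" for l
    have s0_pos: "0 \<le> s0" using s0(1) \<open>0 \<le> ?D\<close> by (metis ereal_less_eq(5) less_imp_le order_trans)
    have x: "(\<lambda>n. exponent \<omega> n l) \<longlonglongrightarrow> x l" if l: "l \<in> ?I" "sv_weight ?d s0 l \<noteq> 0" for l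
    proof -
      have "L l \<noteq> -\<infinity>" using lyap_eq_MInfty[OF s0_pos l] L[OF l(1)] s0(2) by auto
      moreover have "L l \<le> ereal 0"
        using exponent_nonpos[OF l(1)] by (intro LIMSEQ_le_const2[OF L[OF l(1)]]) (auto simp: zero_ereal_def)
      ultimately have "L l = ereal (x l)" unfolding x_def by (cases "L l") auto
      with L[OF l(1)] show ?thesis by simp
    qed
    have x_neg: "x l \<le> ln c" if l: "l \<in> ?I" "sv_weight ?d s0 l \<noteq> 0" for l
      by (rule LIMSEQ_le_const2[OF x[OF l]]) (use exponent_le[OF l(1)] in \<open>auto intro!: exI[of _ 1]\<close>)
    have ln_c: "ln c < 0" using c by simp
    show ?thesis
    proof (rule dense_ge_bounded[of _ "min (ereal s0) (ereal (real ?d))"])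
      \<comment> \<open>It suffices to bound \<open>U\<close> by reals between \<open>?D\<close> and
        this minimum: below d the weights have their floor form, and below \<open>s0\<close> the
        exponents involved are finite.\<close>
      show "?D < min (ereal s0) (ereal (real ?d))" using s0(1) True by simp
      fix t' assume t': "?D < t'" "t' < min (ereal s0) (ereal (real ?d))"
      obtain t where t: "t' = ereal t" using t' \<open>0 \<le> ?D\<close> by (cases t') auto
      have t_s0: "t < s0" and t_d: "t < real ?d" using t' t by auto
      obtain s1 where s1: "0 \<le> s1" "pressure \<mu> A s1 \<omega> < 0" "s1 < t"
        using t'(1) unfolding t dim_LY_def Inf_less_iff by auto
      have t0: "0 \<le> t" using s1 by linarith
      have supp: "sv_weight ?d s0 l \<noteq> 0" if "sv_weight ?d s l \<noteq> 0" "0 \<le> s" "s \<le> s0" "l \<in> ?I" for s l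
        using sv_weight_mono[OF that(2-4)] sv_weight_nonneg[OF that(2), of ?d l] that(1) by linarith
      have "lyap A s1 \<omega> = ereal (\<Sum>l\<in>?I. sv_weight ?d s1 l * x l)"
        by (rule lyap_eq_sum[OF s1(1)]) (use x supp s1 t_s0 in auto)
      with s1(2) h have "h + (\<Sum>l\<in>?I. sv_weight ?d s1 l * x l) < 0" by (simp add: pressure_def)
      \<comment> \<open>Negative pressure passes from \<open>s1\<close> up to \<open>t\<close>:
        weights grow, while the exponents they multiply are negative.\<close>
      moreover have "(\<Sum>l\<in>?I. sv_weight ?d t l * x l) \<le> (\<Sum>l\<in>?I. sv_weight ?d s1 l * x l)"
      proof (rule sum_mono)
        fix l assume l: "l \<in> ?I"
        show "sv_weight ?d t l * x l \<le> sv_weight ?d s1 l * x l"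
        proof (cases "sv_weight ?d t l = 0")
          case True
          then have "sv_weight ?d s1 l = 0"
            using sv_weight_mono[of s1 t l ?d] sv_weight_nonneg[OF s1(1), of ?d l] s1 l by simp
          with True show ?thesis by simp
        next
          case False
          then have "x l \<le> 0" using x_neg[OF l supp[OF False t0 less_imp_le[OF t_s0] l]] ln_c by linarith
          then show ?thesis using sv_weight_mono[of s1 t l ?d] s1 l by (intro mult_right_mono_neg) auto
        qed
      qed
      ultimately have neg: "h + (\<Sum>l\<in>?I. sv_weight ?d t l * x l) < 0" by linarith
      define k where "k = nat \<lfloor>t\<rfloor>"
      have k_d: "k < ?d" using t0 t_d unfolding k_def by linarith
      \<comment> \<open>Not an instance of \<open>supp\<close>: for an integer \<open>t\<close> the
        weight of index k + 1 at \<open>t\<close> is 0. The strict inequality \<open>t < s0\<close>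
        still gives it a positive weight at \<open>s0\<close>, so \<open>x (k + 1)\<close> is a true
        limit.\<close>
      have fin: "sv_weight ?d s0 l \<noteq> 0" if "l \<in> {1..k + 1}" for l
      proof (cases "s0 < real ?d")
        case True
        show ?thesis
        proof (cases "\<lfloor>s0\<rfloor> = \<lfloor>t\<rfloor>")
          case eq: True
          have "of_int \<lfloor>t\<rfloor> < s0" using t_s0 by linarith
          with eq True that show ?thesis by (simp add: sv_weight_def k_def)
        next
          case False
          then have "\<lfloor>t\<rfloor> + 1 \<le> \<lfloor>s0\<rfloor>" using floor_mono[of t s0] t_s0 by linarith
          then have "k + 1 \<le> nat \<lfloor>s0\<rfloor>" using t0 unfolding k_def by linarith
          with True that show ?thesis by (simp add: sv_weight_def)
        qed
      next
        case False
        then show ?thesis using k_d by (simp add: sv_weight_def)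
      qed
      have xk: "(\<lambda>n. exponent \<omega> n l) \<longlonglongrightarrow> x l" if "l \<in> {1..k + 1}" for l
        using x[OF _ fin[OF that]] that k_d by simp
      \<comment> \<open>At this scale axis k + 1 of the ellipsoid shrinks at the same exponential
        rate as the covering radius.\<close>
      define \<tau>0 where "\<tau>0 = - x (k + 1)"
      have \<tau>0: "0 < \<tau>0" using x_neg[OF _ fin, of "k + 1"] k_d ln_c by (simp add: \<tau>0_def)
      define X where "X = (\<Sum>l\<in>{1..k}. x l)"
      have "(\<Sum>l\<in>?I. sv_weight ?d t l * x l) = X - (t - real k) * \<tau>0"
        unfolding sum_sv_weight[OF t0 t_d] using t0 by (simp add: X_def \<tau>0_def k_def)
      \<comment> \<open>Negative pressure at \<open>t\<close>, rearranged. The slack is then divided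
        by d because each of the d axes adds at most \<open>\<tau> - \<tau>0\<close> to the growth
        rate when the scale moves from \<open>\<tau>0\<close> to a rational
        \<open>\<tau>\<close>.\<close>
      with neg have \<eta>: "0 < t * \<tau>0 - (h + X + real k * \<tau>0)" by (simp add: algebra_simps)
      define \<eta> where "\<eta> = (t * \<tau>0 - (h + X + real k * \<tau>0)) / real ?d"
      have "0 < \<eta>" unfolding \<eta>_def using \<eta> by (intro divide_pos_pos) auto
      then obtain \<tau> where \<tau>: "\<tau> \<in> \<rat>" "\<tau>0 < \<tau>" "\<tau> < \<tau>0 + \<eta>"
        using Rats_dense_in_real[of \<tau>0 "\<tau>0 + \<eta>"] by auto
      have \<tau>_pos: "0 < \<tau>" using \<tau> \<tau>0 by linarith
      obtain G where G: "?S \<tau> \<longlonglongrightarrow> G" "U \<le> ereal ((h + G) / \<tau>)" using bound'[OF \<tau>(1) \<tau>_pos] by blast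
      \<comment> \<open>Axes beyond k + 1 are bounded by axis k + 1 through the ordering, so their
        exponents may well be -\<infinity>.\<close>
      have "G \<le> (\<Sum>l\<in>{1..k}. max (x l + \<tau>) 0) + (real ?d - real k) * max (x (k + 1) + \<tau>) 0"
      proof (rule LIMSEQ_le[OF G(1)])
        show "(\<lambda>n. (\<Sum>l\<in>{1..k}. max (exponent \<omega> n l + \<tau>) 0) + (real ?d - real k) * max (exponent \<omega> n (k + 1) + \<tau>) 0)
            \<longlonglongrightarrow> (\<Sum>l\<in>{1..k}. max (x l + \<tau>) 0) + (real ?d - real k) * max (x (k + 1) + \<tau>) 0"
          by (intro tendsto_intros tendsto_max tendsto_sum xk) auto
        have "?S \<tau> n \<le> (\<Sum>l\<in>{1..k}. max (exponent \<omega> n l + \<tau>) 0) + (real ?d - real k) * max (exponent \<omega> n (k + 1) + \<tau>) 0" for n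
        proof -
          have split: "?I = {1..k} \<union> {k + 1..?d}" using k_d by auto
          have "?S \<tau> n = (\<Sum>l\<in>{1..k}. max (exponent \<omega> n l + \<tau>) 0) + (\<Sum>l\<in>{k + 1..?d}. max (exponent \<omega> n l + \<tau>) 0)"
            unfolding split by (rule sum.union_disjoint) auto
          also have "(\<Sum>l\<in>{k + 1..?d}. max (exponent \<omega> n l + \<tau>) 0) \<le> (\<Sum>l\<in>{k + 1..?d}. max (exponent \<omega> n (k + 1) + \<tau>) 0)"
            by (intro sum_mono max.mono add_right_mono exponent_antimono) auto
          also have "\<dots> = (real ?d - real k) * max (exponent \<omega> n (k + 1) + \<tau>) 0"
            using k_d by (simp add: of_nat_diff)
          finally show ?thesis by simp
        qed
        then show "\<exists>N. \<forall>n\<ge>N. ?S \<tau> n \<le> (\<Sum>l\<in>{1..k}. max (exponent \<omega> n l + \<tau>) 0) + (real ?d - real k) * max (exponent \<omega> n (k + 1) + \<tau>) 0"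
          by blast
      qed
      also have "(\<Sum>l\<in>{1..k}. max (x l + \<tau>) 0) = X + real k * \<tau>"
      proof -
        have "max (x l + \<tau>) 0 = x l + \<tau>" if l: "l \<in> {1..k}" for l
        proof -
          have "x (k + 1) \<le> x l"
            by (rule LIMSEQ_le[OF xk xk]) (use l k_d exponent_antimono in auto)
          then show ?thesis using \<tau>(2) by (simp add: \<tau>0_def)
        qed
        then have "(\<Sum>l\<in>{1..k}. max (x l + \<tau>) 0) = (\<Sum>l\<in>{1..k}. x l + \<tau>)" by (intro sum.cong) auto
        then show ?thesis by (simp add: sum.distrib X_def)
      qed
      also have "max (x (k + 1) + \<tau>) 0 = \<tau> - \<tau>0" using \<tau>(2) by (simp add: \<tau>0_def)
      finally have G_le: "G \<le> X + real k * \<tau> + (real ?d - real k) * (\<tau> - \<tau>0)" .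
      have "real ?d * (\<tau> - \<tau>0) \<le> real ?d * \<eta>" using \<tau>(3) by (intro mult_left_mono) auto
      also have "\<dots> = t * \<tau>0 - (h + X + real k * \<tau>0)" by (simp add: \<eta>_def)
      finally have "h + X + real k * \<tau>0 + real ?d * (\<tau> - \<tau>0) \<le> t * \<tau>0" by linarith
      also have "t * \<tau>0 \<le> t * \<tau>" using t0 \<tau>(2) by (intro mult_left_mono) auto
      finally have "h + G \<le> t * \<tau>" using G_le by (simp add: algebra_simps)
      then have "(h + G) / \<tau> \<le> t" using \<tau>_pos by (simp add: divide_le_eq)
      then show "U \<le> t'" unfolding t using G(2) by (meson ereal_less_eq(3) order_trans)
    qed
  qed
  with U_d show ?thesis by simp
qed

end

end

theorem mainTheorem3:
  fixes \<mu> :: "(nat \<Rightarrow> 'i::countable) measure"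
    and A :: "'i \<Rightarrow> real^'n^'n"
    and a :: "'i \<Rightarrow> real^'n"
  assumes inv: "\<And>i. invertible (A i)"
    and contr: "\<exists>c<1. \<forall>i. onorm (\<lambda>x. A i *v x) \<le> c"
    and a_Q: "\<And>i k. \<bar>a i $ k\<bar> \<le> 1/2"
    and prob: "prob_space \<mu>"
    and sets_mu: "sets \<mu> = sets seq_space"
    and invariant: "distr \<mu> \<mu> shift = \<mu>"
    and fin_ent: "ks_entropy \<mu> < \<infinity>"
  shows "AE \<omega> in \<mu>.
           (\<exists>s::real. ereal s > dim_LY \<mu> A \<omega> \<and> lyap A s \<omega> > -\<infinity>) \<longrightarrow>
           upper_loc_dim (distr \<mu> borel (coding A a)) (coding A a \<omega>)
             \<le> min (ereal (real CARD('n))) (dim_LY \<mu> A \<omega>)"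
proof -
  obtain c where c: "c < 1" "\<And>i. onorm ((*v) (A i)) \<le> c" using contr by auto
  define B where "B = real CARD('n) / 2"
  have B: "norm (a i) \<le> B" for i
  proof -
    have "norm (a i) \<le> (\<Sum>k\<in>UNIV. \<bar>a i $ k\<bar>)" by (rule norm_le_l1_cart)
    also have "\<dots> \<le> (\<Sum>k\<in>(UNIV::'n set). 1/2)" by (intro sum_mono a_Q)
    finally show ?thesis by (simp add: B_def)
  qed
  interpret prob_space \<mu> by (rule prob)
  \<comment> \<open>The maximum with 1/2 keeps the constant below 1 and makes it positive, as
    \<open>affine_ifs\<close> demands.\<close>
  interpret affine_measure \<mu> A a "max c (1/2)" B
    by unfold_locales (use c sets_mu invariant B in \<open>auto intro: order_trans[OF c(2)]\<close>)
  let ?U = "\<lambda>\<omega>. upper_loc_dim (distr \<mu> borel (coding A a)) (coding A a \<omega>)"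
  have "countable {\<tau>\<in>\<rat>. 0 < (\<tau>::real)}" by (rule countable_subset[OF _ countable_rat]) auto
  then have "AE \<omega> in \<mu>. \<forall>\<tau>\<in>{\<tau>\<in>\<rat>. 0 < (\<tau>::real)}. \<exists>h G. 0 \<le> h \<and> loc_entropy \<mu> \<omega> = ereal h \<and>
     (\<lambda>n. ln (real (cov \<tau> (prefix \<omega> n))) / real n) \<longlonglongrightarrow> G \<and> ?U \<omega> \<le> ereal ((h + G) / \<tau>)"
    unfolding AE_ball_countable[OF \<open>countable _\<close>] by (intro ballI AE_upper_loc_dim_le[OF fin_ent]) simp
  then show ?thesis
  proof eventually_elim
    case (elim \<omega>)
    \<comment> \<open>Any admissible \<tau> yields \<open>h\<close>; it is the same for all of them,
      being determined by \<open>loc_entropy \<mu> \<omega>\<close>.\<close>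
    have "1 \<in> {\<tau>\<in>\<rat>. 0 < (\<tau>::real)}" by simp
    with elim obtain h where h: "loc_entropy \<mu> \<omega> = ereal h" by blast
    have "\<exists>G. (\<lambda>n. ln (real (cov \<tau> (prefix \<omega> n))) / real n) \<longlonglongrightarrow> G \<and> ?U \<omega> \<le> ereal ((h + G) / \<tau>)"
      if "\<tau> \<in> \<rat>" "0 < \<tau>" for \<tau>
      using elim that h by fastforce
    then show ?case using upper_loc_dim_le_dim_LY[OF inv _ h] by blast
  qed
qed

end
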